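(* Every 2-connected claw-free and $N$-$pq$-heavy graph is hamiltonian.
   Context: All graphs are finite and simple. For a graph $G$ on $n$ vertices, $d(v)$ is the degree of $v$ in $G$; $v$ is heavy if $d(v)\ge n/2$; an adjacent pair $\{u,v\}$ is $a$-heavy if $d(u)+d(v)\ge n$. The net has vertices $a_1,a_2,a_3,b_1,b_2,b_3$ and edges $a_1a_2,a_2a_3,a_1a_3,a_1b_1,a_2b_2,a_3b_3$. An induced net of $G$ (labelled this way) is $p$-heavy if $\{a_1,a_2,a_3\}$ contains an $a$-heavy pair of $G$; it is $q$-heavy if there is $i\in\{1,2,3\}$ such that (i) $a_i,b_i$ are heavy in $G$; (ii) $d(a_j)=3$ and $d(b_j)=2$ for both $j\ne i$; (iii) for both $j\ne i$, the neighbor of $b_j$ other than $a_j$ is heavy in $G$. $G$ is $N$-$pq$-heavy if every induced net of $G$ is $p$-heavy or $q$-heavy. *)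

theory Defs
  imports "Graph_Theory.Graph_Theory"
begin

text \<open>
  A finite simple graph is a symmetric digraph in the sense of the locale \<open>graph\<close> (finite, loopless,
  without parallel arcs); an edge \<open>uv\<close> is the pair of opposite arcs, so the degree of a vertex is its
  out-degree.
\<close>

definition k_connected :: "nat \<Rightarrow> ('a, 'b) pre_digraph \<Rightarrow> bool" where
  "k_connected k G \<longleftrightarrow> k < card (verts G) \<and>
     (\<forall>X. X \<subseteq> verts G \<and> card X < k \<longrightarrow> Digraph_Component.connected (G \<restriction> (verts G - X)))"

text \<open>
  The library counts \<open>u, v, u\<close> as a cycle of a symmetric digraph; the length bound excludes it.
\<close>

definition hamiltonian :: "('a, 'b) pre_digraph \<Rightarrow> bool" where
  "hamiltonian G \<longleftrightarrow>
     (\<exists>p. pre_digraph.cycle G p \<and> 3 \<le> length p \<and> tail G ` set p = verts G)"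

definition claw_free :: "('a, 'b) pre_digraph \<Rightarrow> bool" where
  "claw_free G \<longleftrightarrow> \<not> (\<exists>H. induced_subgraph H G \<and> complete_bipartite_digraph 1 3 H)"

definition heavy :: "('a, 'b) pre_digraph \<Rightarrow> 'a \<Rightarrow> bool" where
  "heavy G v \<longleftrightarrow> real (out_degree G v) \<ge> real (card (verts G)) / 2"

definition a_heavy_pair :: "('a, 'b) pre_digraph \<Rightarrow> 'a \<Rightarrow> 'a \<Rightarrow> bool" where
  "a_heavy_pair G u v \<longleftrightarrow> u \<rightarrow>\<^bsub>G\<^esub> v \<and> out_degree G u + out_degree G v \<ge> card (verts G)"

text \<open>
  The labelled vertices of a net are \<open>a 1, a 2, a 3, b 1, b 2, b 3\<close>; other values of \<open>a\<close> and \<open>b\<close> are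
  irrelevant.
\<close>

definition induced_net :: "('a, 'b) pre_digraph \<Rightarrow> (nat \<Rightarrow> 'a) \<Rightarrow> (nat \<Rightarrow> 'a) \<Rightarrow> bool" where
  "induced_net G a b \<longleftrightarrow>
     distinct [a 1, a 2, a 3, b 1, b 2, b 3] \<and>
     {a 1, a 2, a 3, b 1, b 2, b 3} \<subseteq> verts G \<and>
     arcs_ends (G \<restriction> {a 1, a 2, a 3, b 1, b 2, b 3}) =
       symcl {(a 1, a 2), (a 2, a 3), (a 1, a 3), (a 1, b 1), (a 2, b 2), (a 3, b 3)}"

definition p_heavy :: "('a, 'b) pre_digraph \<Rightarrow> (nat \<Rightarrow> 'a) \<Rightarrow> (nat \<Rightarrow> 'a) \<Rightarrow> bool" where
  "p_heavy G a b \<longleftrightarrow> (\<exists>u \<in> {a 1, a 2, a 3}. \<exists>v \<in> {a 1, a 2, a 3}. a_heavy_pair G u v)"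

text \<open>
  Since \<open>b j\<close> has degree 2 and is adjacent to \<open>a j\<close>, the last quantifier ranges over exactly one
  vertex \<open>w\<close>.
\<close>

definition q_heavy :: "('a, 'b) pre_digraph \<Rightarrow> (nat \<Rightarrow> 'a) \<Rightarrow> (nat \<Rightarrow> 'a) \<Rightarrow> bool" where
  "q_heavy G a b \<longleftrightarrow>
     (\<exists>i \<in> {1, 2, 3}. heavy G (a i) \<and> heavy G (b i) \<and>
        (\<forall>j \<in> {1, 2, 3} - {i}. out_degree G (a j) = 3 \<and> out_degree G (b j) = 2 \<and>
           (\<forall>w. b j \<rightarrow>\<^bsub>G\<^esub> w \<and> w \<noteq> a j \<longrightarrow> heavy G w)))"

definition N_pq_heavy :: "('a, 'b) pre_digraph \<Rightarrow> bool" where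
  "N_pq_heavy G \<longleftrightarrow> (\<forall>a b. induced_net G a b \<longrightarrow> p_heavy G a b \<or> q_heavy G a b)"

end

theory Submission
  imports Defs
begin

text \<open>
  The graph is replaced by its closure, the least diamond-free supergraph: completing the neighbourhood
  of a vertex whose neighbourhood is connected neither creates claws nor, in the absence of a Hamilton
  cycle, a Hamilton cycle, and such completions lead to the closure. In the closure every edge lies
  in a unique maximal clique.

  In a non-hamiltonian 2-connected closed graph take a longest cycle \<open>C\<close> and a path leaving \<open>C\<close> at
  \<open>u\<close> and returning at \<open>v\<close>. The cycle neighbours of \<open>u\<close> are adjacent, so they span a maximal
  clique with \<open>u\<close>, and likewise for \<open>v\<close>; the two cliques are disjoint, since otherwise \<open>C\<close> and the path
  could be merged. Each of them contains the triangle of a net, unless a pair of twin vertices can be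
  deleted, in which case induction applies. A net of the closure yields a net of the original graph
  whose triangle lies in the same clique, and the \<open>q\<close>-heavy ones are ruled out by the longest cycle.
  Hence both cliques contain a heavy adjacent pair. Counting neighbours, the two cliques and the
  neighbours of one heavy pair then make up the whole graph, which therefore has a Hamilton cycle after all.
\<close>

section \<open>Local completion\<close>

text \<open>Heaviness does not pass to the closure directly: a net of the closure need not be a net
  of the graph, and nothing is assumed about the degrees of its vertices. What passes is weaker but
  sufficient: the clique that holds its triangle also holds the triangle of some net of the graph,
  and degrees only grow. Hence the final count uses only the clique of a heavy pair and its degree
  sum.

  Deleting twins would spoil every degree bound. The induction is therefore confined to a structural
  statement, two good nets in disjoint cliques; the relation \<open>E\<close> stays fixed and only
  the vertex set \<open>W\<close> shrinks. Degrees enter afterwards, on the full vertex set.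

  Two disjoint cliques are wanted because each heavy pair bounds the size of the other clique; the
  sizes then agree, and the count has no slack left.\<close>

definition cyc :: "('a \<Rightarrow> 'a \<Rightarrow> bool) \<Rightarrow> 'a list \<Rightarrow> bool" where
  "cyc E xs \<longleftrightarrow> distinct xs \<and> 3 \<le> length xs \<and> successively E xs \<and> E (last xs) (hd xs)"

definition spanned_by_cycle :: "('a \<Rightarrow> 'a \<Rightarrow> bool) \<Rightarrow> 'a set \<Rightarrow> bool" where
  "spanned_by_cycle E W \<longleftrightarrow> (\<exists>xs. cyc E xs \<and> set xs = W)"

text \<open>Reflexive at every point of the type, also outside \<open>S\<close>; extracting a path
  from a walk therefore asks for \<open>a \<in> S\<close> separately.\<close>

definition walk_in :: "('a \<Rightarrow> 'a \<Rightarrow> bool) \<Rightarrow> 'a set \<Rightarrow> 'a \<Rightarrow> 'a \<Rightarrow> bool" where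
  "walk_in E S = (\<lambda>x y. E x y \<and> x \<in> S \<and> y \<in> S)\<^sup>*\<^sup>*"

definition conn :: "('a \<Rightarrow> 'a \<Rightarrow> bool) \<Rightarrow> 'a set \<Rightarrow> bool" where
  "conn E S \<longleftrightarrow> (\<forall>a\<in>S. \<forall>b\<in>S. walk_in E S a b)"

text \<open>\<open>z\<close> ranges over the whole type. If \<open>W\<close> is the whole type,
  connectedness of \<open>W\<close> itself is not an instance and has to be derived.\<close>

definition two_conn :: "('a \<Rightarrow> 'a \<Rightarrow> bool) \<Rightarrow> 'a set \<Rightarrow> bool" where
  "two_conn E W \<longleftrightarrow> 3 \<le> card W \<and> (\<forall>z. conn E (W - {z}))"

text \<open>In a diamond-free graph this is the unique maximal clique through the edge \<open>xy\<close>.\<close>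

definition clq :: "('a \<Rightarrow> 'a \<Rightarrow> bool) \<Rightarrow> 'a \<Rightarrow> 'a \<Rightarrow> 'a set" where
  "clq E x y = {a. (a = x \<or> E a x) \<and> (a = y \<or> E a y)}"

section \<open>Walks and cyclic sequences of a relation\<close>

lemma walk_in_refl [simp]: "walk_in E S a a"
  by (simp add: walk_in_def)

lemma walk_in_trans: "walk_in E S a b \<Longrightarrow> walk_in E S b c \<Longrightarrow> walk_in E S a c"
  by (auto simp: walk_in_def)

lemma walk_in_edge: "E a b \<Longrightarrow> a \<in> S \<Longrightarrow> b \<in> S \<Longrightarrow> walk_in E S a b"
  by (auto simp: walk_in_def)

lemma walk_in_mono: "walk_in E S a b \<Longrightarrow> S \<subseteq> T \<Longrightarrow> walk_in E T a b"
  unfolding walk_in_def by (erule rtranclp_mono[THEN predicate2D, rotated]) blast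

lemma walk_in_induct [consumes 1, case_names refl step]:
  assumes "walk_in E S a b" and "P a"
    and "\<And>x y. walk_in E S a x \<Longrightarrow> E x y \<Longrightarrow> x \<in> S \<Longrightarrow> y \<in> S \<Longrightarrow> P x \<Longrightarrow> P y"
  shows "P b"
  using assms unfolding walk_in_def by (induction rule: rtranclp_induct) blast+

lemma walk_in_converse_induct [consumes 1, case_names refl step]:
  assumes "walk_in E S a b" and "P b"
    and "\<And>x y. E x y \<Longrightarrow> x \<in> S \<Longrightarrow> y \<in> S \<Longrightarrow> walk_in E S y b \<Longrightarrow> P y \<Longrightarrow> P x"
  shows "P a"
  using assms unfolding walk_in_def by (induction rule: converse_rtranclp_induct) blast+

lemma walk_in_path:
  assumes "walk_in E S a b" and "a \<in> S"
  obtains xs where "successively E (a # xs)" "distinct (a # xs)" "set (a # xs) \<subseteq> S" "last (a # xs) = b"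
proof -
  from assms(1) have "a \<in> S \<longrightarrow> (\<exists>xs. successively E (a # xs) \<and> distinct (a # xs) \<and> set (a # xs) \<subseteq> S \<and> last (a # xs) = b)"
  proof (induction rule: walk_in_converse_induct)
    case refl
    show ?case by (rule impI, rule exI[of _ "[]"]) auto
  next
    case (step x y)
    then obtain xs where xs: "successively E (y # xs)" "distinct (y # xs)" "set (y # xs) \<subseteq> S" "last (y # xs) = b"
      by auto
    show ?case
    proof (cases "x \<in> set (y # xs)")
      case False
      then show ?thesis using xs step.hyps by (intro impI exI[of _ "y # xs"]) auto
    next
      case True
      then obtain ys zs where "y # xs = ys @ x # zs" by (meson split_list)
      then show ?thesis using xs by (intro impI exI[of _ "zs"]) (auto simp: successively_append_iff)
    qed
  qed
  then show thesis using assms(2) that by blast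
qed

lemma successively_walk_in:
  "successively E xs \<Longrightarrow> set xs \<subseteq> S \<Longrightarrow> xs \<noteq> [] \<Longrightarrow> walk_in E S (hd xs) (last xs)"
proof (induction xs rule: induct_list012)
  case (3 x y zs)
  then have "walk_in E S y (last (y # zs))" "walk_in E S x y" by (auto intro: walk_in_edge)
  then show ?case by (auto intro: walk_in_trans)
qed auto

lemma distinct_ends:
  assumes "distinct (P @ z # S)" "P \<noteq> []" "S \<noteq> []"
  shows "last P \<noteq> hd S" "hd P \<noteq> last S"
proof -
  have "last P \<in> set P" "hd P \<in> set P" "last S \<in> set S" "hd S \<in> set S" using assms by auto
  then show "last P \<noteq> hd S" "hd P \<noteq> last S" using assms(1) by auto
qed

locale simple_graph =
  fixes E :: "'a \<Rightarrow> 'a \<Rightarrow> bool"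
  assumes sym: "E x y \<Longrightarrow> E y x" and irrefl [simp]: "\<not> E x x"
begin

lemma sym_iff: "E x y \<longleftrightarrow> E y x"
  using sym by blast

lemma successively_rev_sym [simp]: "successively (\<lambda>x y. E y x) xs \<longleftrightarrow> successively E xs"
  by (rule successively_cong) (auto simp: sym_iff)

lemma walk_in_sym: "walk_in E S a b \<Longrightarrow> walk_in E S b a"
  by (induction rule: walk_in_induct) (auto intro: walk_in_trans walk_in_edge sym)

lemma cyc_rotate: "cyc E (xs @ ys) \<longleftrightarrow> cyc E (ys @ xs)"
  by (cases "xs = []"; cases "ys = []") (auto simp: cyc_def successively_append_iff)

lemma cyc_rev: "cyc E (rev xs) \<longleftrightarrow> cyc E xs"
  by (cases "xs = []") (auto simp: cyc_def hd_rev last_rev sym_iff)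

end

section \<open>Merging paths with ends in one neighbourhood\<close>

locale claw_free_graph = simple_graph +
  assumes claw: "E x a \<Longrightarrow> E x b \<Longrightarrow> E x c \<Longrightarrow> a \<noteq> b \<Longrightarrow> b \<noteq> c \<Longrightarrow> a \<noteq> c \<Longrightarrow> E a b \<or> E b c \<or> E a c"
begin

text \<open>Paths covering everything but \<open>x\<close>, with both ends in the neighbourhood of \<open>x\<close>, are merged two by
  two until a single one remains, which \<open>x\<close> closes to a cycle.\<close>

definition end_path :: "'a \<Rightarrow> 'a list \<Rightarrow> bool" where
  "end_path x L \<longleftrightarrow> L \<noteq> [] \<and> distinct L \<and> successively E L \<and> E x (hd L) \<and> E x (last L)"

lemma end_path_rev: "end_path x L \<Longrightarrow> end_path x (rev L)"
  by (auto simp: end_path_def hd_rev last_rev)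

lemma end_path_join:
  assumes "end_path x L" "end_path x M" "set L \<inter> set M = {}" "E (last L) (hd M)"
  shows "end_path x (L @ M)"
  using assms by (auto simp: end_path_def successively_append_iff)

text \<open>The induction follows a walk inside the neighbourhood of \<open>x\<close> from the head
  of \<open>L\<close> to the head of \<open>M\<close>; a step rearranges the two paths, keeping
  their union, so that \<open>L\<close> starts at the next vertex \<open>z\<close> of the walk. If
  no end of \<open>L\<close> is adjacent to an end of \<open>M\<close>, a claw at \<open>x\<close>
  makes the two ends of each path adjacent. An inner vertex \<open>z\<close> can then be turned into
  an end, in three ways according to which two of \<open>x\<close> and the path neighbours of
  \<open>z\<close> are adjacent.\<close>

lemma join_two_end_paths:
  assumes "walk_in E {y. E x y} a b"
    and "end_path x L" "end_path x M" "set L \<inter> set M = {}" "x \<notin> set L \<union> set M"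
    and "hd L = a" "hd M = b" "\<And>y. E x y \<Longrightarrow> y \<in> set L \<union> set M"
  shows "\<exists>K. end_path x K \<and> set K = set L \<union> set M"
  using assms
proof (induction arbitrary: L M rule: walk_in_converse_induct)
  case refl
  then have "hd L \<in> set L \<inter> set M" by (metis IntI end_path_def hd_in_set)
  then show ?case using refl by auto
next
  case (step a z)
  note L = step.prems(1) and M = step.prems(2) and dj = step.prems(3) and x = step.prems(4)
  have az: "E a z" and xz: "E x z" using step.hyps by auto
  \<comment> \<open>After suitable reversals the adjacent ends meet, so any edge between an end of
    \<open>L\<close> and an end of \<open>M\<close> finishes the proof.\<close>
  have merge: ?case if pq: "E p q" "p = hd L \<or> p = last L" "q = hd M \<or> q = last M" for p q
  proof -
    have "\<exists>L'. (L' = L \<or> L' = rev L) \<and> last L' = p"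
      using pq(2) L by (metis end_path_def last_rev)
    moreover have "\<exists>M'. (M' = M \<or> M' = rev M) \<and> hd M' = q"
      using pq(3) M by (metis end_path_def hd_rev)
    ultimately obtain L' M' where "L' = L \<or> L' = rev L" "last L' = p" "M' = M \<or> M' = rev M" "hd M' = q"
      by blast
    then show ?thesis using L M dj pq(1)
      by (intro exI[of _ "L' @ M'"] conjI end_path_join) (auto simp: end_path_rev)
  qed
  show ?case
  proof (cases "\<exists>p q. E p q \<and> (p = hd L \<or> p = last L) \<and> (q = hd M \<or> q = last M)")
    case True
    then show ?thesis using merge by blast
  next
    case False
    have Lends: "E (last L) (hd L)" if "hd L \<noteq> last L"
      using claw[of x "last L" "hd L" "hd M"] False L M dj that
      by (metis IntI empty_iff end_path_def hd_in_set last_in_set)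
    have Mends: "E (last M) (hd M)" if "hd M \<noteq> last M"
      using claw[of x "last M" "hd M" "hd L"] False L M dj that
      by (metis IntI empty_iff end_path_def hd_in_set last_in_set sym)
    have IH: "\<exists>K. end_path x K \<and> set K = set L' \<union> set M'"
      if "end_path x L'" "end_path x M'" "set L' \<inter> set M' = {}" "set L' \<union> set M' = set L \<union> set M"
         "hd L' = z" "hd M' = b" for L' M'
      using step.IH[of L' M'] that x step.prems(7) by auto
    consider "z = hd L \<or> z = last L" | "z = hd M \<or> z = last M"
      | P S where "L = P @ z # S" "P \<noteq> []" "S \<noteq> []" | P S where "M = P @ z # S" "P \<noteq> []" "S \<noteq> []"
    proof -
      have "(\<exists>P S. N = P @ z # S \<and> P \<noteq> [] \<and> S \<noteq> []) \<or> z = hd N \<or> z = last N" if "z \<in> set N" for N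
        using that by (metis append_is_Nil_conv hd_append2 last_snoc list.sel(1) self_append_conv2 split_list)
      then show thesis using that step.prems(7)[OF xz] by (metis UnE)
    qed
    then show ?thesis
    proof cases
      case 1
      then have "z = last L" using az step.prems by auto
      then show ?thesis using IH[of "rev L" M] L M dj step.prems by (auto simp: hd_rev last_rev end_path_rev end_path_def)
    next
      case 2
      then show ?thesis using merge az step.prems by blast
    next
      case (3 P S)
      have aP: "a = hd P" using 3 step.prems by auto
      have PS: "E (last S) (hd P)" using Lends 3 L distinct_ends[of P z S] by (auto simp: end_path_def)
      have sub: "\<exists>K. end_path x K \<and> set K = set L \<union> set M" if "end_path x L'" "set L' = set L" "hd L' = z" for L'
        using IH[of L' M] that M dj step.prems 3 by auto
      have "x \<notin> set P" "x \<notin> set S" using x 3 by auto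
      then have "last P \<noteq> x" "hd S \<noteq> x" using 3 by (metis last_in_set, metis hd_in_set)
      then have "E (last P) (hd S) \<or> E x (last P) \<or> E x (hd S)"
        using claw[of z "last P" "hd S" x] L 3 xz x distinct_ends[of P z S]
        by (auto simp: end_path_def successively_append_iff successively_Cons sym_iff)
      then show ?thesis
      proof (elim disjE)
        assume "E (last P) (hd S)"
        then have "end_path x (z # P @ S)" using L 3 xz az aP
          by (auto simp: end_path_def successively_append_iff successively_Cons sym_iff)
        then show ?thesis by (rule sub) (use 3 in auto)
      next
        assume "E x (last P)"
        then have "end_path x (z # S @ P)" using L 3 xz PS
          by (auto simp: end_path_def successively_append_iff successively_Cons sym_iff)
        then show ?thesis by (rule sub) (use 3 in auto)
      next
        assume "E x (hd S)"
        then have "end_path x (z # rev P @ rev S)" using L 3 xz PS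
          by (auto simp: end_path_def successively_append_iff successively_Cons sym_iff hd_rev last_rev)
        then show ?thesis by (rule sub) (use 3 in auto)
      qed
    next
      \<comment> \<open>Here \<open>z\<close> lies on the other path: it either moves from
        \<open>M\<close> to the front of \<open>L\<close>, or becomes the head of \<open>M\<close>
        and is joined to \<open>a\<close> by the edge \<open>az\<close>.\<close>
      case (4 P S)
      have PS: "E (last S) (hd P)" using Mends 4 M distinct_ends[of P z S] by (auto simp: end_path_def)
      have zL: "z \<notin> set L" using dj 4 by auto
      have join: "\<exists>K. end_path x K \<and> set K = set L \<union> set M" if "end_path x M'" "set M' = set M" "hd M' = z" for M'
        using end_path_join[OF end_path_rev[OF L] that(1)] that L dj az step.prems
        by (intro exI[of _ "rev L @ M'"]) (auto simp: last_rev end_path_def)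
      have "x \<notin> set P" "x \<notin> set S" using x 4 by auto
      then have "last P \<noteq> x" "hd S \<noteq> x" using 4 by (metis last_in_set, metis hd_in_set)
      then have "E (last P) (hd S) \<or> E x (last P) \<or> E x (hd S)"
        using claw[of z "last P" "hd S" x] M 4 xz x distinct_ends[of P z S]
        by (auto simp: end_path_def successively_append_iff successively_Cons sym_iff)
      then show ?thesis
      proof (elim disjE)
        assume "E (last P) (hd S)"
        then have "end_path x (P @ S)" using M 4
          by (auto simp: end_path_def successively_append_iff successively_Cons sym_iff)
        moreover have "end_path x (z # L)" using L zL az xz step.prems
          by (auto simp: end_path_def successively_Cons sym_iff)
        ultimately show ?thesis using IH[of "z # L" "P @ S"] 4 M dj step.prems by (auto simp: end_path_def)
      next
        assume "E x (last P)"
        then have "end_path x (z # S @ P)" using M 4 xz PS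
          by (auto simp: end_path_def successively_append_iff successively_Cons sym_iff)
        then show ?thesis by (rule join) (use 4 in auto)
      next
        assume "E x (hd S)"
        then have "end_path x (z # rev P @ rev S)" using M 4 xz PS
          by (auto simp: end_path_def successively_append_iff successively_Cons sym_iff hd_rev last_rev)
        then show ?thesis by (rule join) (use 4 in auto)
      qed
    qed
  qed
qed

text \<open>Of three heads two are adjacent, since \<open>x\<close> is not the centre of a claw, so
  the number of paths drops. Connectedness of the neighbourhood enters when two paths are
  left.\<close>

lemma join_end_paths:
  assumes "\<forall>L\<in>set Ls. end_path x L" "distinct (concat Ls)" "Ls \<noteq> []" "x \<notin> set (concat Ls)"
    and "conn E {y. E x y}" "\<And>y. E x y \<Longrightarrow> y \<in> set (concat Ls)"
  shows "\<exists>K. end_path x K \<and> set K = set (concat Ls)"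
  using assms
proof (induction "length Ls" arbitrary: Ls rule: less_induct)
  case less
  have join: "\<exists>K. end_path x K \<and> set K = set (concat Ls)"
    if "end_path x N" "set (concat Ls) = set (concat (N # Ms))" "distinct (N @ concat Ms)" "\<forall>L\<in>set Ms. end_path x L" "length Ms + 1 < length Ls" for N Ms
    using less.hyps[of "N # Ms"] that less.prems by (auto simp: end_path_def)
  consider L where "Ls = [L]" | L M where "Ls = [L, M]" | L M N Ms where "Ls = L # M # N # Ms"
    using less.prems(3) by (metis list.exhaust)
  then show ?case
  proof cases
    case (1 L)
    then show ?thesis using less.prems by auto
  next
    case (2 L M)
    then have "walk_in E {y. E x y} (hd L) (hd M)"
      using less.prems by (auto simp: conn_def end_path_def)
    then show ?thesis using join_two_end_paths[of x "hd L" "hd M" L M] less.prems 2 by auto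
  next
    case (3 L M N Ms)
    have ends: "end_path x L" "end_path x M" "end_path x N" using less.prems(1) 3 by auto
    have dj: "distinct (L @ M @ N @ concat Ms)" using less.prems(2) 3 by simp
    have "hd L \<in> set L" "hd M \<in> set M" "hd N \<in> set N" using ends by (auto simp: end_path_def)
    then have "hd L \<noteq> hd M \<and> hd M \<noteq> hd N \<and> hd L \<noteq> hd N" using dj by auto
    then have "E (hd L) (hd M) \<or> E (hd M) (hd N) \<or> E (hd L) (hd N)"
      using claw[of x "hd L" "hd M" "hd N"] ends by (auto simp: end_path_def)
    then show ?thesis
    proof (elim disjE)
      assume "E (hd L) (hd M)"
      then have "end_path x (rev L @ M)" using ends dj
        by (intro end_path_join) (auto simp: end_path_rev last_rev)
      moreover have "distinct ((rev L @ M) @ concat (N # Ms))" using dj by (simp; blast)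
      ultimately show ?thesis using less.prems(1) 3 by (intro join[of "rev L @ M" "N # Ms"]) auto
    next
      assume "E (hd M) (hd N)"
      then have "end_path x (rev M @ N)" using ends dj
        by (intro end_path_join) (auto simp: end_path_rev last_rev)
      moreover have "distinct ((rev M @ N) @ concat (L # Ms))" using dj by (simp; blast)
      ultimately show ?thesis using less.prems(1) 3 by (intro join[of "rev M @ N" "L # Ms"]) auto
    next
      assume "E (hd L) (hd N)"
      then have "end_path x (rev L @ N)" using ends dj
        by (intro end_path_join) (auto simp: end_path_rev last_rev)
      moreover have "distinct ((rev L @ N) @ concat (M # Ms))" using dj by (simp; blast)
      ultimately show ?thesis using less.prems(1) 3 by (intro join[of "rev L @ N" "M # Ms"]) auto
    qed
  qed
qed

definition local_completion :: "'a \<Rightarrow> 'a \<Rightarrow> 'a \<Rightarrow> bool" where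
  "local_completion x y z \<longleftrightarrow> E y z \<or> (E x y \<and> E x z \<and> y \<noteq> z)"

text \<open>After the completion the neighbours of a vertex \<open>y\<close> adjacent to
  \<open>x\<close> split into two cliques: those in the closed neighbourhood of \<open>x\<close>,
  and the others, which are pairwise adjacent because with \<open>x\<close> they must not form a
  claw at \<open>y\<close>. Elsewhere no neighbour is new and edges are only gained.\<close>

lemma claw_free_local_completion: "claw_free_graph (local_completion x)"
proof
  fix y a b c
  assume y: "local_completion x y a" "local_completion x y b" "local_completion x y c"
    and d: "a \<noteq> b" "b \<noteq> c" "a \<noteq> c"
  show "local_completion x a b \<or> local_completion x b c \<or> local_completion x a c"
    using y d claw[of y a b c] claw[of y x b c] claw[of y x a c] claw[of y x a b]
    unfolding local_completion_def by (metis sym)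
qed (auto simp: local_completion_def sym)

text \<open>Cut at every edge that is not in \<open>E\<close>: both ends of such an edge lie in the
  neighbourhood of \<open>x\<close>.\<close>

lemma split_into_end_paths:
  assumes "successively (local_completion x) zs" "distinct zs" "zs \<noteq> []" "E x (hd zs)" "E x (last zs)"
  shows "\<exists>Ls. concat Ls = zs \<and> Ls \<noteq> [] \<and> (\<forall>L\<in>set Ls. end_path x L)"
  using assms
proof (induction "length zs" arbitrary: zs rule: less_induct)
  case less
  show ?case
  proof (cases "successively E zs")
    case True
    then show ?thesis using less.prems by (intro exI[of _ "[zs]"]) (auto simp: end_path_def)
  next
    case False
    then obtain i where i: "Suc i < length zs" "\<not> E (zs ! i) (zs ! Suc i)"
      by (auto simp: successively_conv_nth)
    define P S where "P = take (Suc i) zs" and "S = drop (Suc i) zs"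
    have PS: "zs = P @ S" "P \<noteq> []" "S \<noteq> []" unfolding P_def S_def using i by auto
    have nth: "last P = zs ! i" "hd S = zs ! Suc i"
      unfolding P_def S_def using i by (auto simp: take_Suc_conv_app_nth hd_drop_conv_nth)
    have "local_completion x (last P) (hd S)"
      using less.prems(1) PS by (auto simp: successively_append_iff)
    then have "E x (last P)" "E x (hd S)" using i nth by (auto simp: local_completion_def)
    then have "\<exists>Ls. concat Ls = P \<and> Ls \<noteq> [] \<and> (\<forall>L\<in>set Ls. end_path x L)"
      and "\<exists>Ls. concat Ls = S \<and> Ls \<noteq> [] \<and> (\<forall>L\<in>set Ls. end_path x L)"
      using less.hyps[of P] less.hyps[of S] less.prems PS(2,3) unfolding PS(1)
      by (auto simp: successively_append_iff)
    then obtain Ls Ms where "concat Ls = P" "Ls \<noteq> []" "\<forall>L\<in>set Ls. end_path x L"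
      "concat Ms = S" "\<forall>L\<in>set Ms. end_path x L" by blast
    then show ?thesis using PS by (intro exI[of _ "Ls @ Ms"]) auto
  qed
qed

text \<open>The completion leaves the edges at \<open>x\<close> alone. Removing \<open>x\<close>
  from the cycle gives a path between two neighbours of \<open>x\<close>; its pieces are merged and
  closed through \<open>x\<close> again.\<close>

theorem spanned_by_cycle_local_completion:
  assumes "spanned_by_cycle (local_completion x) V" "x \<in> V" "conn E {y. E x y}" "\<And>y. E x y \<Longrightarrow> y \<in> V"
  shows "spanned_by_cycle E V"
proof -
  interpret L: claw_free_graph "local_completion x" by (rule claw_free_local_completion)
  obtain xs where xs: "cyc (local_completion x) xs" "set xs = V"
    using assms(1) by (auto simp: spanned_by_cycle_def)
  then obtain ys zs where "xs = ys @ x # zs" using assms(2) by (meson split_list)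
  then obtain zs where zs: "cyc (local_completion x) (x # zs)" "set (x # zs) = V"
    using xs L.cyc_rotate[of ys "x # zs"] by (metis append_Cons set_append sup_commute)
  then have n: "2 \<le> length zs" "2 \<le> card (set zs)" by (auto simp: cyc_def distinct_card)
  then have "zs \<noteq> []" "E x (hd zs)" "E x (last zs)"
    using zs by (auto simp: cyc_def local_completion_def successively_Cons sym_iff split: if_splits)
  then obtain Ls where Ls: "concat Ls = zs" "Ls \<noteq> []" "\<forall>L\<in>set Ls. end_path x L"
    using split_into_end_paths[of x zs] zs by (auto simp: cyc_def successively_Cons)
  have "\<exists>K. end_path x K \<and> set K = set zs"
    using join_end_paths[of Ls x] Ls zs assms by (force simp: cyc_def)
  then obtain K where K: "end_path x K" "set K = set zs" by blast
  then have "2 \<le> length K" using n distinct_card[of K] by (auto simp: end_path_def)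
  then have "cyc E (x # K)" "set (x # K) = V" using K zs
    by (auto simp: cyc_def end_path_def successively_Cons sym_iff)
  then show ?thesis by (auto simp: spanned_by_cycle_def)
qed

end

section \<open>The closure\<close>

locale diamond_free_graph = simple_graph +
  assumes diamond: "E a b \<Longrightarrow> E a c \<Longrightarrow> E b c \<Longrightarrow> E a d \<Longrightarrow> E b d \<Longrightarrow> c \<noteq> d \<Longrightarrow> E c d"
begin

lemma clq_clique:
  assumes "E x y" "a \<in> clq E x y" "b \<in> clq E x y" "a \<noteq> b"
  shows "E a b"
  using assms diamond[of x y a b] unfolding clq_def by (auto simp: sym_iff)

text \<open>\<open>clq E p q\<close> is a clique, so it is contained in \<open>clq E r s\<close> for
  any two of its members; this is used in both directions.\<close>

lemma clq_eq:
  assumes "E x y" "a \<in> clq E x y" "b \<in> clq E x y" "a \<noteq> b"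
  shows "clq E a b = clq E x y"
proof -
  have sub: "clq E p q \<subseteq> clq E r s" if "E p q" "r \<in> clq E p q" "s \<in> clq E p q" for p q r s
    using clq_clique[OF that(1)] that unfolding clq_def[of E r s] by blast
  have "x \<in> clq E x y" "y \<in> clq E x y" using assms(1) by (auto simp: clq_def sym_iff)
  moreover have "clq E x y \<subseteq> clq E a b" using sub assms by blast
  moreover have "E a b" by (rule clq_clique[OF assms])
  ultimately show ?thesis using sub by blast
qed

lemma in_clq: "E x y \<Longrightarrow> x \<in> clq E x y" "E x y \<Longrightarrow> y \<in> clq E x y"
  by (auto simp: clq_def sym_iff)

end

locale closed_graph = claw_free_graph + diamond_free_graph

text \<open>For claw-free graphs this is Ryjacek's closure, reached there by successive local completions.\<close>

inductive dcl :: "('a \<Rightarrow> 'a \<Rightarrow> bool) \<Rightarrow> 'a \<Rightarrow> 'a \<Rightarrow> bool" for E where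
  base: "E x y \<Longrightarrow> dcl E x y"
| step: "dcl E a b \<Longrightarrow> dcl E a c \<Longrightarrow> dcl E b c \<Longrightarrow> dcl E a d \<Longrightarrow> dcl E b d \<Longrightarrow> c \<noteq> d \<Longrightarrow> dcl E c d"

context simple_graph
begin

lemma dcl_sym: "dcl E x y \<Longrightarrow> dcl E y x"
  by (induction rule: dcl.induct) (auto intro: dcl.base sym dcl.step)

lemma dcl_irrefl: "dcl E x y \<Longrightarrow> x \<noteq> y"
  by (induction rule: dcl.induct) auto

lemma diamond_free_dcl: "diamond_free_graph (dcl E)"
  by unfold_locales (auto intro: dcl_sym dcl.step dest: dcl_irrefl)

lemma dcl_field: "dcl E x y \<Longrightarrow> (\<And>x y. E x y \<Longrightarrow> x \<in> V) \<Longrightarrow> x \<in> V \<and> y \<in> V"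
  by (induction rule: dcl.induct) (auto dest: sym)

lemma dcl_least: "dcl E x y \<Longrightarrow> diamond_free_graph F \<Longrightarrow> E \<le> F \<Longrightarrow> F x y"
  by (induction rule: dcl.induct) (auto intro: diamond_free_graph.diamond)

text \<open>The link from the closure back to \<open>E\<close>: its maximal cliques are connected in
  \<open>E\<close>. In a closure step the common neighbour \<open>a\<close> lies in the clique of
  the new edge \<open>cd\<close>, so the walks for \<open>ac\<close> and \<open>ad\<close> stay in
  that clique and can be concatenated.\<close>

lemma dcl_walk_in:
  assumes "dcl E x y"
  shows "walk_in E (clq (dcl E) x y) x y"
  using assms
proof (induction rule: dcl.induct)
  case (base x y)
  then show ?case by (intro walk_in_edge) (auto simp: clq_def intro: dcl.base dcl_sym)
next
  case (step a b c d)
  interpret D: diamond_free_graph "dcl E" by (rule diamond_free_dcl)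
  have cd: "dcl E c d" using step.hyps by (rule dcl.step)
  have "a \<in> clq (dcl E) c d" using step.hyps by (auto simp: clq_def)
  then have "clq (dcl E) a c = clq (dcl E) c d" "clq (dcl E) a d = clq (dcl E) c d"
    using D.clq_eq[OF cd] D.in_clq[OF cd] dcl_irrefl step.hyps by blast+
  then show ?case using step.IH walk_in_sym walk_in_trans by metis
qed

end

context claw_free_graph
begin

text \<open>Among the claw-free graphs between \<open>E\<close> and \<open>dcl E\<close> without a
  spanning cycle take one with most edges. If it contained a diamond, completing at \<open>a\<close>
  would give a larger one.\<close>

theorem closed_graph_dcl:
  assumes "finite V" "\<And>x y. E x y \<Longrightarrow> x \<in> V" "\<not> spanned_by_cycle E V"
  shows "closed_graph (dcl E) \<and> \<not> spanned_by_cycle (dcl E) V"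
proof -
  define ok where "ok F \<longleftrightarrow> E \<le> F \<and> F \<le> dcl E \<and> claw_free_graph F \<and> \<not> spanned_by_cycle F V" for F
  define edges where "edges F = {(x, y). F x y}" for F :: "'a \<Rightarrow> 'a \<Rightarrow> bool"
  have inV: "F x y \<Longrightarrow> x \<in> V \<and> y \<in> V" if "ok F" for F x y
    using that dcl_field[of x y V] assms(2) unfolding ok_def by blast
  have sub: "edges F \<subseteq> V \<times> V" if "ok F" for F
    using inV[OF that] by (auto simp: edges_def)
  have "ok E" using assms(3) by (auto simp: ok_def intro: dcl.base claw_free_graph_axioms)
  moreover have "\<forall>F. ok F \<longrightarrow> card (edges F) < Suc (card (V \<times> V))"
    using sub card_mono[of "V \<times> V"] assms(1) by (simp add: less_Suc_eq_le del: card_cartesian_product)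
  ultimately obtain F where F: "ok F" and max: "\<And>F'. ok F' \<Longrightarrow> card (edges F') \<le> card (edges F)"
    using ex_has_greatest_nat[of ok E "\<lambda>F. card (edges F)"] by blast
  interpret F: claw_free_graph F using F by (simp add: ok_def)
  interpret D: diamond_free_graph "dcl E" by (rule diamond_free_dcl)
  have FD: "dcl E x y" if "F x y" for x y using that F by (auto simp: ok_def)
  have "diamond_free_graph F"
  proof (unfold_locales, rule ccontr)
    fix a b c d assume ab: "F a b" "F a c" "F b c" "F a d" "F b d" "c \<noteq> d" and no: "\<not> F c d"
    define F' where "F' = F.local_completion a"
    \<comment> \<open>\<open>c\<close> and \<open>d\<close> are not adjacent, so a neighbour of
      \<open>a\<close> adjacent to neither would give a claw. Together with the path
      \<open>c b d\<close> this connects the neighbourhood of \<open>a\<close>.\<close>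
    have near: "y = c \<or> y = d \<or> F y c \<or> F y d" if "F a y" for y
      using F.claw[of a y c d] ab no that by blast
    have "walk_in F {y. F a y} c y" if "F a y" for y
    proof -
      have "walk_in F {y. F a y} c d"
        using walk_in_edge[of F c b "{y. F a y}"] walk_in_edge[of F b d "{y. F a y}"] ab
        by (auto intro: walk_in_trans F.sym)
      then show ?thesis using near[OF that] that ab
        by (auto intro: walk_in_trans walk_in_edge F.sym)
    qed
    then have "conn F {y. F a y}"
      unfolding conn_def using F.walk_in_sym walk_in_trans by (metis mem_Collect_eq)
    then have "\<not> spanned_by_cycle F' V"
      using F.spanned_by_cycle_local_completion[of a V] F inV[OF F] ab(1) by (auto simp: F'_def ok_def)
    moreover have "F' \<le> dcl E"
    proof -
      \<comment> \<open>In \<open>dcl E\<close> the edges \<open>ac\<close> and \<open>ad\<close>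
        span the same clique, and it contains every neighbour of \<open>a\<close> in
        \<open>F\<close>; hence the completion stays inside \<open>dcl E\<close>.\<close>
      have "dcl E c d" using dcl.step[of E a b c d] ab FD by blast
      then have "y \<in> clq (dcl E) a c" if "F a y" for y
      proof -
        have ac: "dcl E a c" "a \<noteq> c" using FD ab by (auto dest: dcl_irrefl)
        have "d \<in> clq (dcl E) a c" using \<open>dcl E c d\<close> FD ab by (auto simp: clq_def D.sym_iff)
        then have "clq (dcl E) a d = clq (dcl E) a c"
          using D.clq_eq[OF ac(1)] D.in_clq[OF ac(1)] dcl_irrefl FD ab by blast
        moreover have "y \<in> clq (dcl E) a c \<or> y \<in> clq (dcl E) a d"
          using near[OF that] FD[of y c] FD[of y d] FD[OF that] FD[OF ab(2)] FD[OF ab(4)] D.sym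
          unfolding clq_def by blast
        ultimately show ?thesis by blast
      qed
      then show ?thesis
        using D.clq_clique[of a c] FD ab(2) unfolding F'_def F.local_completion_def by blast
    qed
    moreover have "claw_free_graph F'" unfolding F'_def by (rule F.claw_free_local_completion)
    moreover have "E \<le> F'" using F unfolding F'_def F.local_completion_def ok_def by blast
    ultimately have "ok F'" by (simp add: ok_def)
    moreover have "edges F \<subset> edges F'"
      using ab no by (auto simp: edges_def F'_def F.local_completion_def)
    ultimately show False
      using max[of F'] sub[of F'] assms(1) psubset_card_mono[of "edges F'" "edges F"]
      by (meson finite_SigmaI finite_subset leD)
  qed
  then have "dcl E \<le> F" using dcl_least F by (auto simp: ok_def)
  then have "dcl E = F" using F by (auto simp: ok_def)
  then show ?thesis using F \<open>diamond_free_graph F\<close> by (simp add: ok_def closed_graph_def)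
qed

end

section \<open>Nets around a longest cycle\<close>

definition longest_cycle :: "('a \<Rightarrow> 'a \<Rightarrow> bool) \<Rightarrow> 'a set \<Rightarrow> 'a list \<Rightarrow> bool" where
  "longest_cycle E W C \<longleftrightarrow> cyc E C \<and> set C \<subseteq> W \<and> (\<forall>D. cyc E D \<and> set D \<subseteq> W \<longrightarrow> length D \<le> length C)"

text \<open>That the six vertices are distinct follows from the listed adjacencies and
  non-adjacencies.\<close>

definition net :: "('a \<Rightarrow> 'a \<Rightarrow> bool) \<Rightarrow> 'a \<Rightarrow> 'a \<Rightarrow> 'a \<Rightarrow> 'a \<Rightarrow> 'a \<Rightarrow> 'a \<Rightarrow> bool" where
  "net E a1 a2 a3 b1 b2 b3 \<longleftrightarrow>
     E a1 a2 \<and> E a2 a3 \<and> E a1 a3 \<and> E a1 b1 \<and> E a2 b2 \<and> E a3 b3 \<and>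
     \<not> E a1 b2 \<and> \<not> E a1 b3 \<and> \<not> E a2 b1 \<and> \<not> E a2 b3 \<and> \<not> E a3 b1 \<and> \<not> E a3 b2 \<and>
     \<not> E b1 b2 \<and> \<not> E b1 b3 \<and> \<not> E b2 b3"

text \<open>The trace that a \<open>q\<close>-heavy net with distinguished index 1 leaves in the closure.\<close>

definition q_type :: "('a \<Rightarrow> 'a \<Rightarrow> bool) \<Rightarrow> 'a set \<Rightarrow> 'a \<Rightarrow> 'a \<Rightarrow> 'a \<Rightarrow> bool" where
  "q_type E W t1 t2 t3 \<longleftrightarrow> (\<exists>b2 b3 z2 z3. {b2, b3, z2, z3} \<subseteq> W \<and> z2 \<noteq> t2 \<and> z3 \<noteq> t3 \<and>
     (\<forall>x\<in>W. E x t2 \<longleftrightarrow> x \<in> {t1, t3, b2}) \<and> (\<forall>x\<in>W. E x t3 \<longleftrightarrow> x \<in> {t1, t2, b3}) \<and>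
     (\<forall>x\<in>W. E x b2 \<longleftrightarrow> x \<in> {t2, z2}) \<and> (\<forall>x\<in>W. E x b3 \<longleftrightarrow> x \<in> {t3, z3}) \<and>
     E t1 z2 \<and> E t1 z3 \<and> E z2 z3)"

text \<open>\<open>q_type\<close> is symmetric in its last two vertices, so three exclusions cover
  every order of the triangle. Its adjacency lists are relative to \<open>W\<close>, so the notion
  changes with \<open>W\<close>.\<close>

definition good_net :: "('a \<Rightarrow> 'a \<Rightarrow> bool) \<Rightarrow> 'a set \<Rightarrow> 'a \<Rightarrow> 'a \<Rightarrow> 'a \<Rightarrow> bool" where
  "good_net E W a1 a2 a3 \<longleftrightarrow>
     (\<exists>b1 b2 b3. net E a1 a2 a3 b1 b2 b3 \<and> {a1, a2, a3, b1, b2, b3} \<subseteq> W) \<and>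
     \<not> q_type E W a1 a2 a3 \<and> \<not> q_type E W a2 a1 a3 \<and> \<not> q_type E W a3 a1 a2"

text \<open>The edges \<open>eg\<close> and \<open>e'g'\<close> are maximal cliques joining the same two larger cliques, so one of them is
  redundant for Hamilton cycles; the walk from \<open>u\<close> to \<open>p\<close> keeps the graph 2-connected without it.\<close>

definition twin_square :: "('a \<Rightarrow> 'a \<Rightarrow> bool) \<Rightarrow> 'a set \<Rightarrow> 'a \<Rightarrow> 'a \<Rightarrow> 'a \<Rightarrow> 'a \<Rightarrow> 'a \<Rightarrow> 'a \<Rightarrow> bool" where
  "twin_square E W e e' g g' u p \<longleftrightarrow>
     {e, e', g, g', u, p} \<subseteq> W \<and> distinct [e, e', g, g'] \<and> u \<notin> {e, e', g, g'} \<and> p \<notin> {e, e', g, g'} \<and>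
     E e e' \<and> E g g' \<and> E e g \<and> E e' g' \<and> \<not> E e g' \<and> \<not> E e' g \<and>
     (\<forall>x\<in>W - {e, e', g, g'}. (E x e \<longleftrightarrow> E x e') \<and> (E x g \<longleftrightarrow> E x g')) \<and>
     E u e \<and> E p g \<and> walk_in E (W - {e, e', g, g'}) u p"

context simple_graph
begin

lemma longest_cycle_rotate: "longest_cycle E W (xs @ ys) \<Longrightarrow> longest_cycle E W (ys @ xs)"
  using cyc_rotate[of xs ys] unfolding longest_cycle_def by auto

lemma longest_cycle_rev: "longest_cycle E W xs \<Longrightarrow> longest_cycle E W (rev xs)"
  unfolding longest_cycle_def by (auto simp: cyc_rev)

end

text \<open>\<open>Y @ X\<close> is the cycle read from the successor of \<open>b\<close>. The
  outside vertex \<open>r\<close> is adjacent to neither cycle neighbour of \<open>b\<close>, else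
  it could be inserted; so claw-freeness makes these two adjacent, and the cycle can bypass
  \<open>b\<close>.\<close>

lemma (in claw_free_graph) attachment:
  assumes "longest_cycle E W (X @ b # Y)" "r \<in> W" "r \<notin> set (X @ b # Y)" "E b r"
  shows "E (last (Y @ X)) (hd (Y @ X))"
proof -
  define Z where "Z = Y @ X"
  have C: "longest_cycle E W (b # Z)" using longest_cycle_rotate[OF assms(1)] by (simp add: Z_def)
  then have Z: "cyc E (b # Z)" "set (b # Z) \<subseteq> W" and len: "2 \<le> length Z"
    and max: "\<And>D. cyc E D \<Longrightarrow> set D \<subseteq> W \<Longrightarrow> length D \<le> Suc (length Z)"
    by (auto simp: longest_cycle_def cyc_def)
  have ne: "Z \<noteq> []" using len by auto
  have r: "r \<notin> set (b # Z)" using assms(3) by (auto simp: Z_def)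
  have "\<not> E r (hd Z)"
    using max[of "b # r # Z"] Z r ne assms(2,4) by (auto simp: cyc_def successively_Cons)
  moreover have "\<not> E r (last Z)"
    using max[of "r # b # Z"] Z r ne assms(2,4) by (auto simp: cyc_def successively_Cons sym_iff)
  moreover have "E b (hd Z)" "E b (last Z)" using Z ne by (auto simp: cyc_def successively_Cons sym_iff)
  moreover have "hd Z \<noteq> last Z"
  proof (cases Z)
    case (Cons z Z')
    then have "Z' \<noteq> []" "z \<notin> set Z'" using Z len by (auto simp: cyc_def)
    then show ?thesis using Cons last_in_set[of Z'] by auto
  qed (use ne in simp)
  moreover have "r \<noteq> hd Z" "r \<noteq> last Z" using r hd_in_set[OF ne] last_in_set[OF ne] by auto
  ultimately show ?thesis using claw[of b "last Z" "hd Z" r] assms(4) unfolding Z_def by (auto simp: sym_iff)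
qed

section \<open>Two hubs of a longest cycle\<close>

text \<open>\<open>R\<close> is the interior of the detour, nonempty and off the cycle. Reversing
  the cycle (\<open>mirrored\<close>) and exchanging the ends (\<open>swapped\<close>) save proving
  each fact for both directions and both ends.\<close>

locale attached_path = closed_graph +
  fixes W :: "'a set" and u v :: 'a and A B R :: "'a list"
  assumes longest: "longest_cycle E W (u # A @ v # B)"
    and R: "R \<noteq> []" "distinct R" "set R \<subseteq> W" "set R \<inter> set (u # A @ v # B) = {}" "successively E (u # R @ [v])"
begin

lemma mirrored: "attached_path E W u v (rev B) (rev A) R"
proof
  show "longest_cycle E W (u # rev B @ v # rev A)"
    using longest_cycle_rev[OF longest_cycle_rotate[of W "[u]" "A @ v # B"]] longest by simp
qed (use R in auto)

lemma swapped: "attached_path E W v u B A (rev R)"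
proof
  show "longest_cycle E W (v # B @ u # A)"
    using longest_cycle_rotate[of W "u # A" "v # B"] longest by simp
  show "successively E (v # rev R @ [u])" using R(1,5)
    by (auto simp: successively_Cons successively_append_iff hd_rev last_rev sym_iff)
qed (use R in auto)

lemma C: "distinct (u # A @ v # B)" "successively E (u # A @ v # B)" "E (last (v # B)) u" "set (u # A @ v # B) \<subseteq> W"
  using longest by (auto simp: longest_cycle_def cyc_def)

lemma no_longer: "cyc E D \<Longrightarrow> set D \<subseteq> W \<Longrightarrow> length D \<le> 2 + length A + length B"
  using longest by (auto simp: longest_cycle_def)

lemma A_ne: "A \<noteq> []"
proof
  assume "A = []"
  then have "cyc E (u # R @ v # B)" using longest R C
    by (auto simp: longest_cycle_def cyc_def successively_Cons successively_append_iff)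
  then show False using no_longer[of "u # R @ v # B"] R C \<open>A = []\<close> by auto
qed

lemma B_ne: "B \<noteq> []"
  using attached_path.A_ne[OF swapped] .

lemma ends: "hd R \<in> W" "hd R \<notin> set (u # A @ v # B)" "last B \<noteq> v" "last B \<noteq> u"
proof -
  have "hd R \<in> set R" "last B \<in> set B" using R(1) B_ne by auto
  then show "hd R \<in> W" "hd R \<notin> set (u # A @ v # B)" "last B \<noteq> v" "last B \<noteq> u"
    using R(3,4) C(1) by auto
qed

lemma u_nbrs: "E (last B) (hd A)"
  using attachment[of W "[]" u "A @ v # B" "hd R"] longest R A_ne B_ne ends(1,2)
  by (auto simp: successively_Cons hd_append)

lemma v_nbrs: "E (last A) (hd B)"
  using attached_path.u_nbrs[OF swapped] .

lemma u_hd: "E u (hd A)" and u_last: "E u (last B)" and v_hd: "E v (hd B)" and v_last: "E v (last A)"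
  using C A_ne B_ne by (auto simp: successively_Cons successively_append_iff sym_iff)

definition Q :: "'a set" where "Q = clq E u (hd A)"

lemma Q_mem: "u \<in> Q" "hd A \<in> Q" "last B \<in> Q"
  using u_hd u_last u_nbrs by (auto simp: Q_def clq_def sym_iff)

lemma Q_clique: "x \<in> Q \<Longrightarrow> y \<in> Q \<Longrightarrow> x \<noteq> y \<Longrightarrow> E x y"
  using clq_clique[OF u_hd] unfolding Q_def by blast

lemma in_Q: "x \<in> Q \<Longrightarrow> y \<in> Q \<Longrightarrow> x \<noteq> y \<Longrightarrow> E z x \<Longrightarrow> E z y \<Longrightarrow> z \<in> Q"
  using clq_eq[OF u_hd, of x y] unfolding Q_def by (auto simp: clq_def)

lemma Q_subset: "Q \<inter> W \<subseteq> set (u # A @ v # B)"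
proof (rule subsetI, rule ccontr)
  fix x assume x: "x \<in> Q \<inter> W" "x \<notin> set (u # A @ v # B)"
  then have "last B \<noteq> x" using B_ne by auto
  then have "E (last B) x" "E x u" using x Q_clique Q_mem by auto
  then have "cyc E (x # u # A @ v # B)" using C x B_ne by (auto simp: cyc_def)
  then show False using no_longer[of "x # u # A @ v # B"] C x by auto
qed

text \<open>Since \<open>last A\<close> and \<open>hd B\<close> are adjacent, \<open>v\<close> can
  be moved behind \<open>last B\<close> if it is in the hub; the reversed detour then closes a
  longer cycle.\<close>

lemma v_notin_Q: "v \<notin> Q"
proof
  assume "v \<in> Q"
  then have "E (last B) v" using Q_clique[of "last B" v] Q_mem ends by auto
  then have "cyc E (u # A @ B @ v # rev R)" using C R v_nbrs A_ne B_ne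
    by (auto simp: Suc_le_eq cyc_def successively_Cons successively_append_iff hd_rev last_rev sym_iff)
  then show False using no_longer[of "u # A @ B @ v # rev R"] C R by auto
qed

text \<open>The cycle neighbours of \<open>u\<close> are adjacent, as are those of \<open>v\<close>,
  so the cycle can bypass both; \<open>u\<close>, the detour and \<open>v\<close> are then inserted
  next to \<open>a\<close>. The result covers the old cycle and \<open>R\<close>.\<close>

lemma hubs_disjoint_aux:
  assumes "A = A1 @ a # A2" "a \<in> clq E u (hd A)" "a \<in> clq E v (hd B)"
  shows False
proof -
  have a: "a \<noteq> u" "a \<noteq> v" "E a u" "E a v"
    using assms C by (auto simp: clq_def)
  \<comment> \<open>As \<open>u\<close> and \<open>v\<close> are not adjacent, every other neighbour
    of \<open>a\<close> is adjacent to one of them, in particular the cycle neighbours of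
    \<open>a\<close>.\<close>
  have "\<not> E u v"
    using in_Q[of u a v] a assms(2) v_notin_Q Q_mem by (auto simp: Q_def sym_iff)
  then have uv: "E x u \<or> E x v" if "E a x" "x \<noteq> u" "x \<noteq> v" for x
    using claw[of a u v x] a that C by (auto simp: sym_iff)
  have hdA: "hd A = hd (A1 @ [a])" and lastA: "last A = last (a # A2)" using assms(1) by (auto simp: hd_append)
  have len: False if "cyc E D" "set D = set (u # A @ v # B) \<union> set R" for D
  proof -
    have d: "distinct ((u # A @ v # B) @ R)" using C R by auto
    have "length D = length ((u # A @ v # B) @ R)"
      using that d by (metis cyc_def distinct_card set_append)
    moreover have "length D \<le> 2 + length A + length B" using that C R by (intro no_longer) auto
    ultimately show False using R(1) by simp
  qed
  note simps = Suc_le_eq cyc_def successively_Cons successively_append_iff hd_rev last_rev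
  have hdB: "E (last B) (hd (A1 @ [a]))" "E (last (a # A2)) (hd B)" using u_nbrs v_nbrs hdA lastA by auto
  consider "A2 = [] \<or> E v (hd A2)" | "A1 = [] \<or> E u (last A1)"
    | "A1 \<noteq> []" "A2 \<noteq> []" "E u (hd A2)" "E v (last A1)"
  proof -
    have out: "u \<notin> set A1" "v \<notin> set A1" "u \<notin> set A2" "v \<notin> set A2" using C(1) assms(1) by auto
    have "E u (hd A2) \<or> E v (hd A2)" if ne: "A2 \<noteq> []"
    proof -
      have "hd A2 \<noteq> u" "hd A2 \<noteq> v" using out ne by (metis hd_in_set)+
      moreover have "E a (hd A2)" using C(2) assms(1) ne by (auto simp: simps)
      ultimately show ?thesis using uv[of "hd A2"] by (auto simp: sym_iff)
    qed
    moreover have "E u (last A1) \<or> E v (last A1)" if ne: "A1 \<noteq> []"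
    proof -
      have "last A1 \<noteq> u" "last A1 \<noteq> v" using out ne by (metis last_in_set)+
      moreover have "E a (last A1)" using C(2) assms(1) ne by (auto simp: simps sym_iff)
      ultimately show ?thesis using uv[of "last A1"] by (auto simp: sym_iff)
    qed
    ultimately show thesis using that by blast
  qed
  then show False
  proof cases
    case 1
    then have "cyc E (A1 @ [a, u] @ R @ [v] @ A2 @ B)" using C R assms(1) a B_ne hdB v_hd
      by (cases "A1 = []"; cases "A2 = []") (auto simp: simps sym_iff)
    then show False by (rule len) (use assms(1) in auto)
  next
    case 2
    then have "cyc E (A1 @ [u] @ R @ [v, a] @ A2 @ B)" using C R assms(1) a B_ne hdB u_last
      by (cases "A1 = []"; cases "A2 = []") (auto simp: simps sym_iff)
    then show False by (rule len) (use assms(1) in auto)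
  next
    case 3
    then have "cyc E (A1 @ [a, v] @ rev R @ [u] @ A2 @ B)" using C R assms(1) a B_ne hdB
      by (auto simp: simps sym_iff)
    then show False by (rule len) (use assms(1) in auto)
  qed
qed

lemma Q_eq_last: "clq E u (last B) = clq E u (hd A)"
  using clq_eq[OF u_hd, of u "last B"] Q_mem ends(4) by (simp add: Q_def)

lemma hubs_disjoint: "clq E u (hd A) \<inter> clq E v (hd B) \<inter> W = {}"
proof (rule ccontr)
  assume "\<not> ?thesis"
  then obtain a where a: "a \<in> clq E u (hd A)" "a \<in> clq E v (hd B)" "a \<in> W" by auto
  interpret M: attached_path E W u v "rev B" "rev A" R by (rule mirrored)
  interpret S: attached_path E W v u B A "rev R" by (rule swapped)
  have "a \<noteq> v" "a \<noteq> u" using a v_notin_Q S.v_notin_Q by (auto simp: Q_def S.Q_def)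
  then consider "a \<in> set A" | "a \<in> set B" using Q_subset a by (auto simp: Q_def)
  then show False
  proof cases
    case 1
    then show False using hubs_disjoint_aux a by (meson split_list)
  next
    case 2
    then obtain A1 A2 where "rev B = A1 @ a # A2" using split_list[of a "rev B"] by auto
    then show False using M.hubs_disjoint_aux[of A1 a A2] a A_ne B_ne Q_eq_last S.Q_eq_last by (metis hd_rev)
  qed
qed

end

section \<open>The run through a hub and its exits\<close>

text \<open>The cycle runs through the clique of \<open>u\<close> along \<open>B\<close>, \<open>u\<close>, \<open>A\<close> and leaves it at both ends; inside the
  run its vertices may be reordered freely.\<close>

locale hub_run = closed_graph +
  fixes W :: "'a set" and u v :: 'a and A M B R :: "'a list"
  assumes longest: "longest_cycle E W (u # A @ M @ B)"
    and ne: "A \<noteq> []" "M \<noteq> []" "B \<noteq> []"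
    and run: "set A \<union> set B \<subseteq> clq E u (hd A)" "hd M \<notin> clq E u (hd A)" "last M \<notin> clq E u (hd A)"
    and v: "v \<in> set M"
    and R: "R \<noteq> []" "set R \<subseteq> W" "set R \<inter> set (u # A @ M @ B) = {}" "successively E (u # R @ [v])"
begin

definition Q :: "'a set" where "Q = clq E u (hd A)"

lemma C: "distinct (u # A @ M @ B)" "successively E (u # A @ M @ B)" "E (last B) u" "set (u # A @ M @ B) \<subseteq> W"
  using longest ne by (auto simp: longest_cycle_def cyc_def)

lemma no_longer: "cyc E D \<Longrightarrow> set D \<subseteq> W \<Longrightarrow> length D \<le> 1 + length A + length M + length B"
  using longest by (auto simp: longest_cycle_def)

lemma u_hd: "E u (hd A)"
  using C ne by (auto simp: successively_Cons)

lemma Q_run: "insert u (set A \<union> set B) \<subseteq> Q"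
  using run(1) u_hd by (auto simp: Q_def clq_def)

lemma Q_clique: "x \<in> Q \<Longrightarrow> y \<in> Q \<Longrightarrow> x \<noteq> y \<Longrightarrow> E x y"
  using clq_clique[OF u_hd] unfolding Q_def by blast

lemma Q_eq: "x \<in> Q \<Longrightarrow> y \<in> Q \<Longrightarrow> x \<noteq> y \<Longrightarrow> clq E x y = Q"
  using clq_eq[OF u_hd] unfolding Q_def by blast

lemma in_Q: "x \<in> Q \<Longrightarrow> y \<in> Q \<Longrightarrow> x \<noteq> y \<Longrightarrow> E z x \<Longrightarrow> E z y \<Longrightarrow> z \<in> Q"
  using Q_eq[of x y] by (auto simp: clq_def)

text \<open>\<open>e\<close> and \<open>e'\<close> are the exits of the run, \<open>g\<close> and
  \<open>g'\<close> the cycle vertices just beyond them, and \<open>r\<close> is the first vertex of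
  the detour.\<close>

definition e where "e = last A"
definition e' where "e' = hd B"
definition g where "g = hd M"
definition g' where "g' = last M"
definition r where "r = hd R"

lemmas parts = e_def e'_def g_def g'_def r_def

lemma mem: "e \<in> set A" "e' \<in> set B" "g \<in> set M" "g' \<in> set M" "r \<in> set R"
  using ne R(1) by (auto simp: parts)

lemma inW: "u \<in> W" "e \<in> W" "e' \<in> W" "g \<in> W" "g' \<in> W" "r \<in> W"
  using mem C(4) R(2) by auto

lemma neqs: "u \<noteq> e" "u \<noteq> e'" "e \<noteq> e'"
  using mem C(1) by auto

lemma inQ: "u \<in> Q" "e \<in> Q" "e' \<in> Q" "g \<notin> Q" "g' \<notin> Q"
  using mem Q_run run by (auto simp: Q_def parts)

lemma neqs': "e \<noteq> g" "e \<noteq> g'" "e' \<noteq> g" "e' \<noteq> g'" "u \<noteq> g" "u \<noteq> g'"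
  using inQ by metis+

lemma edges: "E e g" "E e' g'" "E u e" "E u e'" "E e e'" "E u r"
proof -
  show "E e g" "E e' g'" using C(2) ne by (auto simp: parts successively_Cons successively_append_iff sym_iff)
  show "E u e" "E u e'" "E e e'" using Q_clique inQ neqs by auto
  show "E u r" using R(1,4) by (auto simp: parts successively_Cons)
qed

lemma clq_last: "clq E u (hd (rev B)) = Q"
  using Q_run ne C(1) last_in_set[of B] by (intro Q_eq) (auto simp: hd_rev)

lemma mirrored: "hub_run E W u v (rev B) (rev M) (rev A) R"
proof
  show "longest_cycle E W (u # rev B @ rev M @ rev A)"
    using longest_cycle_rev[OF longest_cycle_rotate[of W "[u]" "A @ M @ B"]] longest by simp
  show "set (rev B) \<union> set (rev A) \<subseteq> clq E u (hd (rev B))" "hd (rev M) \<notin> clq E u (hd (rev B))"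
    "last (rev M) \<notin> clq E u (hd (rev B))"
    using Q_run inQ ne unfolding clq_last by (auto simp: parts hd_rev last_rev)
qed (use ne v R in auto)

text \<open>Claw at \<open>e\<close> with leaves \<open>u\<close>, \<open>b\<close>,
  \<open>g\<close>: a vertex outside the hub that is adjacent to \<open>e\<close> cannot be adjacent
  to \<open>u\<close> as well.\<close>

lemma exit_nbr:
  assumes "E b e" "b \<notin> Q"
  shows "b = g \<or> E b g"
proof -
  have "\<not> E b u" using in_Q[of u e b] assms inQ neqs by auto
  moreover have "\<not> E u g" using in_Q[of u e g] inQ neqs edges by (auto simp: sym_iff)
  moreover have "b \<noteq> u" "u \<noteq> g" using assms inQ by auto
  ultimately show ?thesis using claw[of e b u g] assms edges by (auto simp: sym_iff)
qed

text \<open>A common neighbour \<open>b\<close> of \<open>e\<close> and \<open>r\<close> outside the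
  hub allows a longer cycle. Off the cycle it fits between \<open>e\<close> and \<open>g\<close>; on
  the cycle, \<open>r\<close> forces the cycle neighbours of \<open>b\<close> to be adjacent, so
  \<open>b\<close> can be moved.\<close>

lemma no_conflict:
  assumes "b \<in> W" "E b e" "b \<notin> Q"
  shows "\<not> E b r"
proof
  assume br: "E b r"
  have rC: "r \<notin> set (u # A @ M @ B)" using mem R(3) by auto
  have "b \<in> set M"
  proof (rule ccontr)
    assume "b \<notin> set M"
    then have b: "b \<notin> set (u # A @ M @ B)" using Q_run assms(3) by auto
    then have "E b g" using exit_nbr[OF assms(2,3)] mem by auto
    then have "cyc E (u # A @ b # M @ B)" using C ne b assms(2)
      by (auto simp: Suc_le_eq cyc_def parts successively_Cons successively_append_iff sym_iff)
    then show False using no_longer[of "u # A @ b # M @ B"] C assms(1) by auto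
  qed
  then obtain M1 M2 where M: "M = M1 @ b # M2" by (meson split_list)
  have nb: "E (last (u # A @ M1)) (hd (M2 @ B))"
    using attachment[of W "u # A @ M1" b "M2 @ B" r] longest M rC inW br ne by (auto simp: hd_append)
  obtain A' where A: "A = A' @ [e]" using ne(1) by (metis append_butlast_last_id e_def)
  have AM: "A @ M @ B = A' @ e # M1 @ b # M2 @ B" using A M by (metis append.assoc append_Cons append_Nil)
  have setA: "set A = insert e (set A')" using arg_cong[OF A, of set] by auto
  note C' = C[unfolded AM]
  \<comment> \<open>The new cycle leaves \<open>u\<close> by \<open>r\<close>, \<open>b\<close>,
    \<open>e\<close>, runs through the outer part without \<open>b\<close>, and returns through
    \<open>B\<close> and \<open>A'\<close>, whose order is free inside the hub. It gains
    \<open>r\<close>.\<close>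
  have "cyc E ([u, r, b, e] @ M1 @ M2 @ B @ A')"
  proof -
    have "distinct ([u, r, b, e] @ M1 @ M2 @ B @ A')" using C'(1) rC[unfolded AM] by auto
    moreover have "E (last (M1 @ M2 @ B @ A')) u"
    proof -
      have "last (M1 @ M2 @ B @ A') = last (B @ A')" using ne by auto
      moreover have "last (B @ A') \<in> set (B @ A')" using ne by (intro last_in_set) auto
      moreover have "set (B @ A') \<subseteq> Q - {u}" using Q_run C'(1) setA by auto
      ultimately show ?thesis using Q_clique[of "last (B @ A')" u] inQ by auto
    qed
    moreover have "A' \<noteq> [] \<Longrightarrow> E (last B) (hd A')"
    proof -
      assume "A' \<noteq> []"
      then have "hd A' \<in> set A'" "last B \<in> set B" using ne by auto
      then have "last B \<noteq> hd A'" "hd A' \<in> Q" "last B \<in> Q" using Q_run C'(1) setA by auto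
      then show "E (last B) (hd A')" using Q_clique by blast
    qed
    moreover have "E u r" "E r b" "E b e" using edges br assms(2) by (auto simp: sym_iff)
    moreover have "successively E (e # M1 @ M2 @ B)"
    proof -
      have "last (u # A @ M1) = last (e # M1)" using ne by (auto simp: e_def)
      then show ?thesis using C'(2) nb ne
        by (cases "M1 = []"; cases "M2 = []") (auto simp: successively_Cons successively_append_iff)
    qed
    moreover have "successively E A'" using C'(2) by (auto simp: successively_Cons successively_append_iff)
    ultimately have "successively E ([u, r, b] @ (e # M1 @ M2 @ B) @ A')" and "E (last (M1 @ M2 @ B @ A')) u"
      and "distinct ([u, r, b, e] @ M1 @ M2 @ B @ A')"
      using ne by (simp_all only: successively_append_iff) auto
    then show ?thesis using ne by (simp add: cyc_def)
  qed
  moreover have "length A = Suc (length A')" "length M = Suc (length M1 + length M2)"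
    using arg_cong[OF A, of length] arg_cong[OF M, of length] by auto
  ultimately show False using no_longer[of "[u, r, b, e] @ M1 @ M2 @ B @ A'"] C'(4) inW by auto
qed

text \<open>The third pendant is the start of the detour. It lies outside the hub, else it could be
  inserted before \<open>u\<close>, and \<open>no_conflict\<close> at both exits keeps it apart from
  the other two.\<close>

lemma net_at_hub:
  assumes "b \<in> W" "E b e" "b \<notin> Q" "b' \<in> W" "E b' e'" "b' \<notin> Q" "\<not> E b b'"
  shows "net E u e e' r b b'"
proof -
  interpret M: hub_run E W u v "rev B" "rev M" "rev A" R by (rule mirrored)
  have eq: "M.e = e'" "M.r = r" "M.Q = Q"
    using ne clq_last by (auto simp: M.parts parts last_rev M.Q_def)
  have "r \<notin> Q"
  proof
    assume "r \<in> Q"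
    moreover have "last B \<in> Q" "u \<noteq> last B" "r \<noteq> last B" "r \<noteq> u" using Q_run ne C(1) mem R(3) last_in_set[OF ne(3)] by auto
    ultimately have "E (last B) r" "E r u" using Q_clique inQ by auto
    then have "cyc E (r # u # A @ M @ B)" using C mem R(3) ne by (auto simp: Suc_le_eq cyc_def)
    then show False using no_longer[of "r # u # A @ M @ B"] C inW by auto
  qed
  then have "\<not> E e r" "\<not> E e' r" using in_Q[of u e r] in_Q[of u e' r] inQ neqs edges by (auto simp: sym_iff)
  moreover have "\<not> E u b" "\<not> E u b'" "\<not> E e b'" "\<not> E e' b"
    using in_Q[of u e b] in_Q[of u e' b'] in_Q[of e e' b] in_Q[of e e' b'] inQ neqs assms by (auto simp: sym_iff)
  moreover have "\<not> E r b" "\<not> E r b'" using no_conflict[of b] M.no_conflict[of b'] assms eq by (auto simp: sym_iff)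
  ultimately show ?thesis using edges assms by (auto simp: net_def sym_iff)
qed

text \<open>The pendant of \<open>u\<close> would be \<open>r\<close>, and its second neighbour
  \<open>z2\<close> would be adjacent to \<open>e\<close>. Outside the hub
  \<open>no_conflict\<close> excludes this; inside, \<open>z2\<close> is \<open>e'\<close>, and
  \<open>r\<close> would belong to the hub with \<open>e\<close> as a third neighbour.\<close>

lemma not_q_type_exit: "\<not> q_type E W e u e'"
proof
  assume "q_type E W e u e'"
  then obtain b2 z2 where q: "z2 \<in> W" "z2 \<noteq> u" "\<And>x. x \<in> W \<Longrightarrow> E x u \<longleftrightarrow> x \<in> {e, e', b2}"
    "\<And>x. x \<in> W \<Longrightarrow> E x b2 \<longleftrightarrow> x \<in> {u, z2}" "E e z2"
    by (auto simp: q_type_def)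
  have rC: "r \<noteq> e" "r \<noteq> e'" using mem R(3) by auto
  then have b2: "b2 = r" using q(3)[of r] inW edges by (auto simp: sym_iff)
  then have zr: "E z2 r" using q(4)[of z2] q(1) by auto
  have "z2 \<notin> Q"
  proof
    assume "z2 \<in> Q"
    then have "E z2 u" using Q_clique inQ q(2) by auto
    then have "z2 = e'" using q(1,3,5) b2 zr by auto
    then have "r \<in> Q" using in_Q[of u e' r] zr inQ neqs edges by (auto simp: sym_iff)
    then have "E r e" using Q_clique inQ rC by auto
    then have "e \<in> {u, z2}" using q(4)[of e] b2 inW by (auto simp: sym_iff)
    then show False using neqs \<open>z2 = e'\<close> by auto
  qed
  then show False using no_conflict[of z2] q zr by (auto simp: sym_iff)
qed

text \<open>The pendant of \<open>e\<close> would be \<open>g\<close>, with neighbours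
  \<open>e\<close> and \<open>z2\<close> only, so \<open>z2\<close> follows \<open>g\<close> on the
  cycle. A claw at \<open>u\<close> with leaves \<open>e\<close>, \<open>r\<close>,
  \<open>z2\<close> yields an edge from \<open>z2\<close> to \<open>r\<close>; by
  \<open>attachment\<close> \<open>g\<close> is then adjacent to the vertex after \<open>z2\<close>,
  a third neighbour.\<close>

lemma not_q_type_u: "\<not> q_type E W u e e'"
proof
  assume "q_type E W u e e'"
  then obtain b2 z2 where q: "z2 \<in> W" "z2 \<noteq> e" "\<And>x. x \<in> W \<Longrightarrow> E x e \<longleftrightarrow> x \<in> {u, e', b2}"
    "\<And>x. x \<in> W \<Longrightarrow> E x b2 \<longleftrightarrow> x \<in> {e, z2}" "E u z2"
    by (auto simp: q_type_def)
  have "g \<noteq> u" "g \<noteq> e'" using inQ by auto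
  then have b2: "b2 = g" using q(3)[of g] inW edges by (auto simp: sym_iff)
  have zg: "E z2 g" using q(4)[of z2] b2 q(1) by auto
  have ze': "z2 \<noteq> e'" using in_Q[of e e' g] zg inQ neqs edges by (auto simp: sym_iff)
  have ze: "\<not> E z2 e" using q(1,3,5) b2 ze' zg by auto
  obtain M' where M: "M = g # M'" using ne by (metis g_def list.collapse)
  then have MB: "M @ B = g # M' @ B" by (metis append_Cons)
  note C' = C[unfolded MB] and L' = longest[unfolded MB] and R' = R[unfolded MB]
  have out: "hd (M' @ B) \<in> set (M' @ B)" using ne by (intro hd_in_set) auto
  have "E g (hd (M' @ B))" using C'(2) ne by (auto simp: successively_Cons successively_append_iff)
  moreover have "hd (M' @ B) \<notin> set A" "hd (M' @ B) \<in> W" using out C'(1,4) by auto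
  moreover from this have "hd (M' @ B) \<noteq> e" using mem(1) by auto
  ultimately have "hd (M' @ B) = z2"
    using q(4)[of "hd (M' @ B)"] b2 by (auto simp: sym_iff)
  then obtain M'' where M': "M' = z2 # M''" using ze' by (cases M') (auto simp: e'_def)
  have rC: "r \<notin> set (u # A @ g # M' @ B)" using mem(5) R'(3) by auto
  have re: "\<not> E r e"
    using q(3)[of r] b2 inW mem R(3) by auto
  have "r \<noteq> z2" "r \<noteq> e" using M' mem R'(3) by auto
  then have "E z2 r" using claw[of u e r z2] re ze edges q by (auto simp: sym_iff)
  then have "E (last (u # A @ [g])) (hd (M'' @ B))"
    using attachment[of W "u # A @ [g]" z2 "M'' @ B" r] L' rC inW ne unfolding M' by (auto simp: hd_append)
  moreover have "hd (M'' @ B) \<in> set (M'' @ B)" using ne by (intro hd_in_set) auto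
  moreover from this have "hd (M'' @ B) \<notin> set A" "hd (M'' @ B) \<in> W" "hd (M'' @ B) \<noteq> z2"
    using C'(1,4) M' by auto
  moreover from this have "hd (M'' @ B) \<noteq> e" using mem(1) by auto
  ultimately show False
    using q(4)[of "hd (M'' @ B)"] b2 by (auto simp: sym_iff)
qed

lemma good_net_at_hub:
  assumes "b \<in> W" "E b e" "b \<notin> Q" "b' \<in> W" "E b' e'" "b' \<notin> Q" "\<not> E b b'"
  shows "good_net E W u e e'"
proof -
  interpret M: hub_run E W u v "rev B" "rev M" "rev A" R by (rule mirrored)
  have "M.e = e'" "M.e' = e" using ne by (auto simp: M.parts parts last_rev hd_rev)
  then show ?thesis
    using net_at_hub[OF assms] M.not_q_type_exit not_q_type_exit not_q_type_u assms inW
    unfolding good_net_def by auto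
qed

text \<open>The first assumption says that no choice of pendants gives a net. Two outer neighbours
  \<open>b\<close>, \<open>g\<close> of \<open>e\<close> would both be adjacent to
  \<open>g'\<close>; without diamonds \<open>e\<close> would be adjacent to \<open>g'\<close> too,
  pulling \<open>g'\<close> into the hub.\<close>

lemma exit_nbr_unique:
  assumes "\<forall>b\<in>W. \<forall>b'\<in>W. E b e \<and> b \<notin> Q \<and> E b' e' \<and> b' \<notin> Q \<longrightarrow> E b b'"
    and "b \<in> W" "E b e" "b \<notin> Q"
  shows "b = g"
proof (rule ccontr)
  assume "b \<noteq> g"
  then have "E b g" using exit_nbr assms by auto
  moreover have "E b g'" "E g g'" using assms inW inQ edges by (auto simp: sym_iff)
  ultimately have "E e g'" using diamond[of b g e g'] assms edges neqs' by (auto simp: sym_iff)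
  then show False using in_Q[of e e' g'] inQ neqs edges by (auto simp: sym_iff)
qed

text \<open>Claw at \<open>g\<close> with leaves \<open>e\<close>, \<open>g'\<close>,
  \<open>x\<close>; an edge from \<open>e\<close> to \<open>x\<close> would put \<open>x\<close>,
  and then \<open>g\<close>, into the hub.\<close>

lemma exit_g_nbr:
  assumes "\<forall>b\<in>W. \<forall>b'\<in>W. E b e \<and> b \<notin> Q \<and> E b' e' \<and> b' \<notin> Q \<longrightarrow> E b b'"
    and "x \<in> W" "E x g" "x \<noteq> e" "x \<noteq> g'"
  shows "E x g'"
proof -
  have gg: "E g g'" using assms(1) inW inQ edges by (auto simp: sym_iff)
  have "\<not> E e g'" using in_Q[of e e' g'] inQ neqs edges by (auto simp: sym_iff)
  moreover have "\<not> E e x"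
  proof
    assume ex: "E e x"
    moreover have "x \<noteq> g" using assms by auto
    ultimately have "x \<in> Q" using exit_nbr_unique[OF assms(1), of x] assms by (auto simp: sym_iff)
    then show False using in_Q[of e x g] inQ assms edges by (auto simp: sym_iff)
  qed
  moreover have "e \<noteq> g'" using inQ by metis
  ultimately show ?thesis using claw[of g e g' x] gg assms edges by (auto simp: sym_iff)
qed

text \<open>Lets the walk along the detour avoid the twin square. If the detour ended at
  \<open>g\<close>, bypassing \<open>g\<close> would make \<open>e\<close> adjacent to the next
  cycle vertex \<open>n\<close>; then \<open>n\<close>, and with it \<open>g\<close>, would be in
  the hub.\<close>

lemma v_neq_g:
  assumes "\<forall>b\<in>W. \<forall>b'\<in>W. E b e \<and> b \<notin> Q \<and> E b' e' \<and> b' \<notin> Q \<longrightarrow> E b b'"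
  shows "v \<noteq> g"
proof
  assume vg: "v = g"
  obtain M' where M: "M = g # M'" using ne by (metis g_def list.collapse)
  then have MB: "M @ B = g # M' @ B" by (metis append_Cons)
  note C' = C[unfolded MB] and L' = longest[unfolded MB] and R' = R[unfolded MB]
  define n where "n = hd (M' @ B)"
  have n: "n \<in> set (M' @ B)" unfolding n_def using ne by (intro hd_in_set) auto
  have "last R \<in> set R" using R(1) by simp
  then have "last R \<in> W" "last R \<notin> set (u # A @ g # M' @ B)" using R'(2,3) by auto
  moreover have "E g (last R)" using R(1,4) vg by (auto simp: successively_Cons successively_append_iff sym_iff)
  ultimately have "E (last (u # A)) n"
    using attachment[of W "u # A" g "M' @ B" "last R"] L' ne by (auto simp: hd_append n_def)
  then have en: "E n e" using ne by (auto simp: e_def sym_iff)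
  have "n \<in> Q" using exit_nbr_unique[OF assms, of n] en n C'(1,4) by auto
  moreover have "E g n" using C'(2) ne by (auto simp: n_def successively_Cons successively_append_iff)
  moreover have "e \<noteq> n" using en by auto
  ultimately show False using in_Q[of e n g] inQ edges en by (auto simp: sym_iff)
qed

lemma hub_cases:
  "good_net E W u e e' \<or> (\<exists>p. twin_square E W e e' g g' u p)"
proof (cases "\<forall>b\<in>W. \<forall>b'\<in>W. E b e \<and> b \<notin> Q \<and> E b' e' \<and> b' \<notin> Q \<longrightarrow> E b b'")
  case False
  then show ?thesis using good_net_at_hub by blast
next
  case all: True
  interpret M: hub_run E W u v "rev B" "rev M" "rev A" R by (rule mirrored)
  have eq: "M.e = e'" "M.e' = e" "M.g = g'" "M.g' = g" "M.Q = Q"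
    using ne clq_last by (auto simp: M.parts parts last_rev hd_rev M.Q_def)
  have all': "\<forall>b\<in>W. \<forall>b'\<in>W. E b M.e \<and> b \<notin> M.Q \<and> E b' M.e' \<and> b' \<notin> M.Q \<longrightarrow> E b b'"
    using all unfolding eq by (metis sym)
  have gg: "E g g'" using all inW inQ edges by (auto simp: sym_iff)
  then have "g \<noteq> g'" by auto
  obtain M1 where "M = g # M1" using ne by (metis g_def list.collapse)
  then have "g' = last (g # M1)" by (metis g'_def)
  then have "M1 \<noteq> []" "last M1 = g'" using \<open>g \<noteq> g'\<close> by (auto split: if_splits)
  then have "M1 = butlast M1 @ [g']" using append_butlast_last_id by metis
  then obtain N where "M1 = N @ [g']" by blast
  then have M: "M = g # N @ [g']" using \<open>M = g # M1\<close> by metis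
  then have MB: "M @ B = g # N @ g' # B" by (metis append.assoc append_Cons append_Nil)
  note C' = C[unfolded MB]
  have setM: "set M = insert g (insert g' (set N))" using arg_cong[OF M, of set] by auto
  have "v \<noteq> g" "v \<noteq> g'" using v_neq_g[OF all] M.v_neq_g[OF all'] eq by auto
  then have vN: "v \<in> set N" using v setM by auto
  then obtain N1 N2 where N: "N = N1 @ v # N2" by (meson split_list)
  \<comment> \<open>\<open>p\<close> is the cycle vertex after \<open>g\<close>. The detour from
    \<open>u\<close> to \<open>v\<close>, followed back along the cycle from \<open>v\<close> to
    \<open>p\<close>, avoids the square.\<close>
  define p where "p = hd N"
  have pN: "p \<in> set N" using vN by (metis p_def empty_iff empty_set hd_in_set)
  let ?S = "W - {e, e', g, g'}"
  have N_S: "set N \<subseteq> ?S" using C'(1,4) mem(1,2) by auto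
  have uS: "u \<in> ?S" using inW neqs inQ by auto
  have "set R \<subseteq> ?S" using R(2,3) mem by auto
  then have "walk_in E ?S u v"
    using successively_walk_in[OF R(4), of ?S] N_S vN uS by auto
  moreover have "walk_in E ?S p v"
  proof -
    have "successively E (N1 @ [v])" using C'(2)[unfolded N] by (auto simp: successively_Cons successively_append_iff)
    then show ?thesis
      using successively_walk_in[of E "N1 @ [v]" ?S] N_S N by (auto simp: p_def hd_append split: if_splits)
  qed
  ultimately have walk: "walk_in E ?S u p" by (rule walk_in_trans[OF _ walk_in_sym])
  have pg: "E p g" using C'(2) vN
    by (cases N) (auto simp: p_def successively_Cons successively_append_iff sym_iff)
  have twin_e: "E x e'" if "x \<in> W" "x \<notin> {e, e', g}" "E x e" for x
  proof -
    have "x \<in> Q" using exit_nbr_unique[OF all, of x] that by auto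
    then show ?thesis using Q_clique inQ that by auto
  qed
  have twin_e': "E x e" if "x \<in> W" "x \<notin> {e, e', g'}" "E x e'" for x
  proof -
    have "x \<in> Q" using M.exit_nbr_unique[OF all', of x] that eq by auto
    then show ?thesis using Q_clique inQ that by auto
  qed
  have twin_g: "E x g'" if "x \<in> W" "x \<notin> {e, g'}" "E x g" for x
    using exit_g_nbr[OF all, of x] that by auto
  have twin_g': "E x g" if "x \<in> W" "x \<notin> {e', g}" "E x g'" for x
    using M.exit_g_nbr[OF all', of x] that eq by auto
  have "\<not> E e g'" "\<not> E e' g"
    using in_Q[of e e' g'] in_Q[of e e' g] inQ neqs edges by (auto simp: sym_iff)
  moreover have "distinct [e, e', g, g']" using neqs inQ \<open>g \<noteq> g'\<close> by auto
  moreover have "\<forall>x\<in>?S. (E x e \<longleftrightarrow> E x e') \<and> (E x g \<longleftrightarrow> E x g')"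
    using twin_e twin_e' twin_g twin_g' by blast
  moreover have "{e, e', g, g', u, p} \<subseteq> W" "u \<notin> {e, e', g, g'}" "p \<notin> {e, e', g, g'}"
    using inW uS pN N_S by auto
  ultimately have "twin_square E W e e' g g' u p"
    unfolding twin_square_def using walk pg gg edges by blast
  then show ?thesis by blast
qed

end

context attached_path
begin

lemma hub_cases:
  "(\<exists>e e'. good_net E W u e e' \<and> clq E u e = clq E u (hd A)) \<or> (\<exists>e e' g g' w p. twin_square E W e e' g g' w p)"
proof -
  \<comment> \<open>The maximal stretches inside the hub on both sides of \<open>u\<close>. If one
    exhausts \<open>A\<close> or \<open>B\<close>, the outer part begins or ends with
    \<open>v\<close>, which is not in the hub.\<close>
  define A1 where "A1 = takeWhile (\<lambda>x. x \<in> Q) A"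
  define A2 where "A2 = dropWhile (\<lambda>x. x \<in> Q) A"
  define B1 where "B1 = takeWhile (\<lambda>x. x \<in> Q) (rev B)"
  define B2 where "B2 = dropWhile (\<lambda>x. x \<in> Q) (rev B)"
  have AB: "A = A1 @ A2" "B = rev B2 @ rev B1"
    by (simp_all add: A1_def A2_def B1_def B2_def flip: rev_append)
  have "A1 \<noteq> []" using A_ne Q_mem by (cases A) (auto simp: A1_def)
  have "hd (rev B) \<in> Q" using Q_mem B_ne by (simp add: hd_rev)
  then have "B1 \<noteq> []" using B_ne by (cases "rev B") (auto simp: B1_def)
  have hdA: "hd A1 = hd A" using AB \<open>A1 \<noteq> []\<close> by auto
  let ?M = "A2 @ v # rev B2"
  have "A2 \<noteq> [] \<Longrightarrow> hd A2 \<notin> Q" "B2 \<noteq> [] \<Longrightarrow> hd B2 \<notin> Q"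
    using hd_dropWhile[of "\<lambda>x. x \<in> Q"] by (auto simp: A2_def B2_def)
  then have ends: "hd ?M \<notin> Q" "last ?M \<notin> Q"
    using v_notin_Q by (cases "A2 = []"; cases "B2 = []"; auto simp: last_rev)+
  have "hub_run E W u v A1 ?M (rev B1) R"
  proof
    show "longest_cycle E W (u # A1 @ ?M @ rev B1)" using longest AB by simp
    show "set A1 \<union> set (rev B1) \<subseteq> clq E u (hd A1)"
      unfolding hdA using set_takeWhileD by (fastforce simp: A1_def B1_def Q_def)
    show "hd ?M \<notin> clq E u (hd A1)"
      unfolding hdA using ends by (simp add: Q_def)
    show "last ?M \<notin> clq E u (hd A1)"
      unfolding hdA using ends by (simp add: Q_def)
    show "set R \<inter> set (u # A1 @ ?M @ rev B1) = {}" using R AB by auto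
  qed (use R \<open>A1 \<noteq> []\<close> \<open>B1 \<noteq> []\<close> in auto)
  then interpret H: hub_run E W u v A1 ?M "rev B1" R .
  have "clq E u H.e = clq E u (hd A)"
    using H.Q_eq[of u H.e] H.inQ H.neqs hdA by (simp add: H.Q_def)
  then show ?thesis using H.hub_cases by blast
qed

end

section \<open>Deleting vertices and restoring them\<close>

context simple_graph
begin

text \<open>A map that fixes \<open>T\<close> and sends edges to walks carries every walk in
  \<open>S\<close> to one in \<open>T\<close>; it assigns substitutes to deleted vertices.\<close>

lemma conn_retract:
  assumes "conn E S" "T \<subseteq> S" "\<And>x. x \<in> T \<Longrightarrow> f x = x"
    and "\<And>x y. x \<in> S \<Longrightarrow> y \<in> S \<Longrightarrow> E x y \<Longrightarrow> walk_in E T (f x) (f y)"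
  shows "conn E T"
  unfolding conn_def
proof (intro ballI)
  fix a b assume ab: "a \<in> T" "b \<in> T"
  then have "walk_in E S a b" using assms by (auto simp: conn_def)
  then have "walk_in E T (f a) (f b)"
    by (induction rule: walk_in_induct) (auto intro: walk_in_trans assms)
  then show "walk_in E T a b" using ab assms by simp
qed

lemma ex_third:
  assumes "two_conn E W" "finite W"
  shows "\<exists>c\<in>W. c \<noteq> a \<and> c \<noteq> b"
proof (rule ccontr)
  assume "\<not> ?thesis"
  then have "card W \<le> card {a, b}" by (intro card_mono) auto
  then show False using assms(1) by (auto simp: two_conn_def card_insert_if split: if_splits)
qed

lemma two_conn_nbr:
  assumes "two_conn E W" "finite W" "b \<in> W"
  shows "\<exists>y\<in>W. y \<noteq> t \<and> E b y"
proof -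
  have other: "\<exists>y\<in>W. y \<noteq> t \<and> E b y" if "b \<noteq> t" for t
  proof -
    obtain c where c: "c \<in> W" "c \<noteq> b" "c \<noteq> t" using ex_third[OF assms(1,2)] by metis
    have "walk_in E (W - {t}) b c" using assms that c by (auto simp: two_conn_def conn_def)
    then show ?thesis unfolding walk_in_def using c by (cases rule: converse_rtranclpE) auto
  qed
  show ?thesis
  proof (cases "b = t")
    case True
    obtain c where "c \<in> W" "c \<noteq> b" using ex_third[OF assms(1,2)] by metis
    then show ?thesis using other[of c] True by (metis irrefl)
  qed (rule other)
qed

text \<open>Contrapositively, a good net stays good when deleted vertices are restored. The vertices
  \<open>z2\<close> and \<open>z3\<close> are never among the deleted ones: each pendant has a
  second neighbour in the 2-connected \<open>W'\<close>, and it can be no other.\<close>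

lemma q_type_subset:
  assumes "q_type E W t1 t2 t3" "net E t1 t2 t3 p1 p2 p3" "{t1, t2, t3, p1, p2, p3} \<subseteq> W'"
    and "W' \<subseteq> W" "two_conn E W'" "finite W'"
  shows "q_type E W' t1 t2 t3"
proof -
  obtain b2 b3 z2 z3 where q: "z2 \<noteq> t2" "z3 \<noteq> t3"
    "\<forall>x\<in>W. E x t2 \<longleftrightarrow> x \<in> {t1, t3, b2}" "\<forall>x\<in>W. E x t3 \<longleftrightarrow> x \<in> {t1, t2, b3}"
    "\<forall>x\<in>W. E x b2 \<longleftrightarrow> x \<in> {t2, z2}" "\<forall>x\<in>W. E x b3 \<longleftrightarrow> x \<in> {t3, z3}"
    "E t1 z2" "E t1 z3" "E z2 z3"
    using assms(1) unfolding q_type_def by (elim exE conjE) (rule that)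
  have W: "p2 \<in> W" "p3 \<in> W" using assms by auto
  have "E t1 t2" "E t1 t3" "E t2 t3" "E t2 p2" "E t3 p3" "\<not> E t1 p2" "\<not> E t1 p3" "\<not> E t2 p3" "\<not> E t3 p2"
    using assms(2) by (simp_all add: net_def)
  then have "p2 \<noteq> t1" "p2 \<noteq> t3" "E p2 t2" "p3 \<noteq> t1" "p3 \<noteq> t2" "E p3 t3" by (metis sym)+
  then have b: "b2 = p2" "b3 = p3" using q(3,4) W by auto
  obtain y where y: "y \<in> W'" "y \<noteq> t2" "E y p2" using two_conn_nbr[of W' p2 t2] assms(3,5,6) sym by auto
  obtain y' where y': "y' \<in> W'" "y' \<noteq> t3" "E y' p3" using two_conn_nbr[of W' p3 t3] assms(3,5,6) sym by auto
  have "z2 \<in> W'" "z3 \<in> W'" using y y' q(5,6) b assms(4) by auto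
  then have "{p2, p3, z2, z3} \<subseteq> W'" using assms(3) by auto
  moreover have "\<forall>x\<in>W'. E x t2 \<longleftrightarrow> x \<in> {t1, t3, p2}" "\<forall>x\<in>W'. E x t3 \<longleftrightarrow> x \<in> {t1, t2, p3}"
    "\<forall>x\<in>W'. E x p2 \<longleftrightarrow> x \<in> {t2, z2}" "\<forall>x\<in>W'. E x p3 \<longleftrightarrow> x \<in> {t3, z3}"
    using q(3-6)[unfolded b] assms(4) by (simp_all add: subset_iff)
  ultimately show ?thesis unfolding q_type_def using q(1,2,7-9)
    by (intro exI[of _ p2] exI[of _ p3] exI[of _ z2] exI[of _ z3] conjI)
qed

lemma good_net_superset:
  assumes "good_net E W' a1 a2 a3" "W' \<subseteq> W" "two_conn E W'" "finite W'"
  shows "good_net E W a1 a2 a3"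
proof -
  obtain b1 b2 b3 where net: "net E a1 a2 a3 b1 b2 b3" "{a1, a2, a3, b1, b2, b3} \<subseteq> W'"
    using assms(1) by (auto simp: good_net_def)
  then have "net E a2 a1 a3 b2 b1 b3" "net E a3 a1 a2 b3 b1 b2" by (auto simp: net_def sym_iff)
  then have "\<not> q_type E W a1 a2 a3" "\<not> q_type E W a2 a1 a3" "\<not> q_type E W a3 a1 a2"
    using assms net q_type_subset[of W a1 a2 a3 b1 b2 b3 W'] q_type_subset[of W a2 a1 a3 b2 b1 b3 W']
      q_type_subset[of W a3 a1 a2 b3 b1 b2 W']
    by (auto simp: good_net_def)
  moreover have "{a1, a2, a3, b1, b2, b3} \<subseteq> W" using net assms(2) by blast
  ultimately show ?thesis using net(1) unfolding good_net_def by blast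
qed

text \<open>Of the two cycle neighbours of \<open>b\<close> at most one is \<open>c\<close>;
  \<open>b'\<close> goes between \<open>b\<close> and the other.\<close>

lemma insert_into_cycle:
  assumes "spanned_by_cycle E S" "b \<in> S" "b' \<notin> S" "E b b'"
    and nbrs: "\<And>x. x \<in> S \<Longrightarrow> E b x \<Longrightarrow> x \<noteq> c \<Longrightarrow> E b' x"
  shows "spanned_by_cycle E (insert b' S)"
proof -
  obtain xs where xs: "cyc E xs" "set xs = S" using assms(1) by (auto simp: spanned_by_cycle_def)
  obtain ys zs where "xs = ys @ b # zs" using assms(2) xs by (meson split_list)
  then have Z: "cyc E (b # zs @ ys)" "set (b # zs @ ys) = S"
    using xs cyc_rotate[of ys "b # zs"] by auto
  define Z where "Z = zs @ ys"
  have Z: "cyc E (b # Z)" "set (b # Z) = S" using Z by (simp_all add: Z_def)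
  then have len: "2 \<le> length Z" by (simp add: cyc_def)
  then have ne: "Z \<noteq> []" by auto
  have "hd Z \<noteq> last Z"
  proof (cases Z)
    case (Cons z Z')
    then have "Z' \<noteq> []" "z \<notin> set Z'" using Z len by (auto simp: cyc_def)
    then show ?thesis using Cons last_in_set[of Z'] by auto
  qed (use ne in simp)
  moreover have "hd Z \<in> S" "last Z \<in> S" "E b (hd Z)" "E b (last Z)"
    using Z ne by (auto simp: cyc_def successively_Cons sym_iff)
  ultimately consider "E b' (hd Z)" | "E b' (last Z)" using nbrs by metis
  then show ?thesis
  proof cases
    case 1
    then have "cyc E (b # b' # Z)" using Z ne assms(3,4) by (auto simp: cyc_def successively_Cons)
    then show ?thesis using Z unfolding spanned_by_cycle_def by (intro exI[of _ "b # b' # Z"]) auto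
  next
    case 2
    then have "cyc E (b' # b # Z)" using Z ne assms(3,4) by (auto simp: cyc_def successively_Cons sym_iff)
    then show ?thesis using Z unfolding spanned_by_cycle_def by (intro exI[of _ "b' # b # Z"]) auto
  qed
qed

end

context closed_graph
begin

text \<open>If \<open>z\<close> is neither \<open>e\<close> nor \<open>g\<close>, retract
  \<open>e'\<close> to \<open>e\<close> and \<open>g'\<close> to \<open>g\<close>. If
  \<open>z\<close> is one of them, its deleted twin is retracted to \<open>u\<close> or
  \<open>p\<close> instead, and the walk from \<open>u\<close> to \<open>p\<close> replaces the lost
  connection.\<close>

lemma twin_square_two_conn:
  assumes ts: "twin_square E W e e' g g' u p" and W: "two_conn E W" "finite W"
  shows "two_conn E (W - {e', g'})"
proof -
  have d: "distinct [e, e', g, g']" "u \<notin> {e, e', g, g'}" "p \<notin> {e, e', g, g'}" "{e, e', g, g', u, p} \<subseteq> W"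
    and no: "\<not> E e g'" "\<not> E e' g" and ed: "E e e'" "E g g'" "E e g" "E e' g'" "E u e" "E p g"
    and walk: "walk_in E (W - {e, e', g, g'}) u p"
    using ts by (auto simp: twin_square_def)
  have twin: "E x e \<longleftrightarrow> E x e'" "E x g \<longleftrightarrow> E x g'" if "x \<in> W" "x \<notin> {e, e', g, g'}" for x
    using ts that by (auto simp: twin_square_def)
  have ue': "E u e'" and pg': "E p g'" using twin[of u] twin[of p] d ed by auto
  have "conn E (W - {e', g'} - {z})" for z
  proof -
    let ?S = "W - {z}" and ?T = "W - {e', g'} - {z}"
    have S: "conn E ?S" using W by (auto simp: two_conn_def)
    \<comment> \<open>\<open>x\<close> and \<open>w\<close> are the images of the deleted vertices
      \<open>e'\<close> and \<open>g'\<close>.\<close>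
    have retract: "conn E ?T" if e': "\<And>y. y \<in> ?T \<Longrightarrow> E y e' \<Longrightarrow> walk_in E ?T x y"
      and g': "\<And>y. y \<in> ?T \<Longrightarrow> E y g' \<Longrightarrow> walk_in E ?T w y"
      and e'g': "walk_in E ?T x w" for x w
    proof (rule conn_retract[OF S, where f = "\<lambda>y. if y = e' then x else if y = g' then w else y"])
      fix a b assume ab: "a \<in> ?S" "b \<in> ?S" "E a b"
      have to_e': "walk_in E ?T y x" if "y \<in> ?T" "E y e'" for y by (rule walk_in_sym[OF e'[OF that]])
      have to_g': "walk_in E ?T y w" if "y \<in> ?T" "E y g'" for y by (rule walk_in_sym[OF g'[OF that]])
      have g'e': "walk_in E ?T w x" by (rule walk_in_sym[OF e'g'])
      show "walk_in E ?T (if a = e' then x else if a = g' then w else a)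
          (if b = e' then x else if b = g' then w else b)"
        using ab d(1) e'[of b] g'[of b] to_e'[of a] to_g'[of a] e'g' g'e' sym[of a b] walk_in_edge[of E a b ?T]
        by auto
    qed auto
    have walkT: "walk_in E ?T u p" if "z \<in> {e, g}" by (rule walk_in_mono[OF walk]) (use that in auto)
    consider "z = e" | "z = g" | "z \<noteq> e" "z \<noteq> g" by blast
    then show ?thesis
    proof cases
      case 1
      show ?thesis
      proof (rule retract)
        fix y assume y: "y \<in> ?T" "E y e'"
        then have "y \<notin> {e, e', g, g'}" using 1 no by (auto simp: sym_iff)
        then have "E y e" using twin y by auto
        then show "walk_in E ?T u y"
          using diamond[of e e' u y] y ed ue' d 1 by (cases "u = y") (auto simp: sym_iff intro: walk_in_edge)
      next
        fix y assume y: "y \<in> ?T" "E y g'"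
        then show "walk_in E ?T g y"
          using twin[of y] d 1 by (cases "y = g") (auto simp: sym_iff intro: walk_in_edge)
      next
        have "walk_in E ?T p g" using ed d 1 by (intro walk_in_edge) auto
        then show "walk_in E ?T u g" using walkT 1 by (auto intro: walk_in_trans)
      qed
    next
      case 2
      show ?thesis
      proof (rule retract)
        fix y assume y: "y \<in> ?T" "E y e'"
        then show "walk_in E ?T e y"
          using twin[of y] d 2 by (cases "y = e") (auto simp: sym_iff intro: walk_in_edge)
      next
        fix y assume y: "y \<in> ?T" "E y g'"
        then have "y \<notin> {e, e', g, g'}" using 2 no by (auto simp: sym_iff)
        then have "E y g" using twin y by auto
        then show "walk_in E ?T p y"
          using diamond[of g g' p y] y ed pg' d 2 by (cases "p = y") (auto simp: sym_iff intro: walk_in_edge)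
      next
        have "walk_in E ?T e u" using ed d 2 by (intro walk_in_edge) (auto simp: sym_iff)
        then show "walk_in E ?T e p" using walkT 2 by (auto intro: walk_in_trans)
      qed
    next
      case 3
      show ?thesis
      proof (rule retract)
        fix y assume y: "y \<in> ?T" "E y e'"
        then show "walk_in E ?T e y"
          using twin[of y] d no 3 by (cases "y = e"; cases "y = g") (auto simp: sym_iff intro: walk_in_edge)
      next
        fix y assume y: "y \<in> ?T" "E y g'"
        then show "walk_in E ?T g y"
          using twin[of y] d no 3 by (cases "y = g"; cases "y = e") (auto simp: sym_iff intro: walk_in_edge)
      next
        show "walk_in E ?T e g" using ed d 3 by (intro walk_in_edge) auto
      qed
    qed
  qed
  moreover have "3 \<le> card (W - {e', g'})"
  proof -
    have "card {e, g, u} \<le> card (W - {e', g'})" using d W(2) by (intro card_mono) auto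
    then show ?thesis using d by auto
  qed
  ultimately show ?thesis by (simp add: two_conn_def)
qed

text \<open>Insert \<open>e'\<close> next to \<open>e\<close>, then \<open>g'\<close> next to
  \<open>g\<close>. After the first insertion \<open>e\<close> is still the only exceptional
  neighbour of \<open>g\<close>, as \<open>e'\<close> and \<open>g\<close> are not adjacent.\<close>

lemma twin_square_cycle:
  assumes ts: "twin_square E W e e' g g' u p" and "spanned_by_cycle E (W - {e', g'})"
  shows "spanned_by_cycle E W"
proof -
  have d: "distinct [e, e', g, g']" "{e, e', g, g'} \<subseteq> W"
    and no: "\<not> E e g'" "\<not> E e' g" and ed: "E e e'" "E g g'" "E e g" "E e' g'"
    using ts by (auto simp: twin_square_def)
  have twin: "E x e \<longleftrightarrow> E x e'" "E x g \<longleftrightarrow> E x g'" if "x \<in> W" "x \<notin> {e, e', g, g'}" for x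
    using ts that by (auto simp: twin_square_def)
  have "spanned_by_cycle E (insert e' (W - {e', g'}))"
  proof (rule insert_into_cycle[OF assms(2), of e e' g])
    fix x assume "x \<in> W - {e', g'}" "E e x" "x \<noteq> g"
    moreover from this have "x \<noteq> e" by auto
    ultimately show "E e' x" using twin(1)[of x] by (auto simp: sym_iff)
  qed (use d ed in auto)
  then have "spanned_by_cycle E (insert g' (insert e' (W - {e', g'})))"
  proof (rule insert_into_cycle[of _ g g' e])
    fix x assume "x \<in> insert e' (W - {e', g'})" "E g x" "x \<noteq> e"
    moreover from this have "x \<noteq> g" "x \<noteq> e'" using no by (auto simp: sym_iff)
    ultimately show "E g' x" using twin(2)[of x] by (auto simp: sym_iff)
  qed (use d ed in auto)
  moreover have "insert g' (insert e' (W - {e', g'})) = W" using d by auto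
  ultimately show ?thesis by simp
qed

text \<open>The neighbours concerned all lie, with \<open>a\<close> and its twin, in one clique. So
  a restored vertex cannot lie in two cliques that are disjoint within the smaller set.\<close>

lemma twin_square_nbrs:
  assumes ts: "twin_square E W e e' g g' u p" and "a \<in> {e', g'}"
    and xy: "x \<in> W - {e', g'}" "y \<in> W - {e', g'}" "E a x" "E a y" "x \<noteq> y"
  shows "E x y"
proof -
  have d: "distinct [e, e', g, g']" "{e, e', g, g'} \<subseteq> W"
    and no: "\<not> E e g'" "\<not> E e' g" and ed: "E e e'" "E g g'"
    using ts by (auto simp: twin_square_def)
  have twin: "E x e \<longleftrightarrow> E x e'" "E x g \<longleftrightarrow> E x g'" if "x \<in> W" "x \<notin> {e, e', g, g'}" for x
    using ts that by (auto simp: twin_square_def)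
  consider "a = e'" | "a = g'" using assms(2) by auto
  then show ?thesis
  proof cases
    case 1
    have "x \<noteq> g" "y \<noteq> g" using xy 1 no by auto
    then have "x = e \<or> E x e" "y = e \<or> E y e" using twin(1)[of x] twin(1)[of y] xy 1 by (auto simp: sym_iff)
    then show ?thesis using diamond[of e e' x y] xy 1 ed by (auto simp: sym_iff)
  next
    case 2
    have "x \<noteq> e" "y \<noteq> e" using xy 2 no by (auto simp: sym_iff)
    then have "x = g \<or> E x g" "y = g \<or> E y g" using twin(2)[of x] twin(2)[of y] xy 2 by (auto simp: sym_iff)
    then show ?thesis using diamond[of g g' x y] xy 2 ed by (auto simp: sym_iff)
  qed
qed

section \<open>From 2-connectedness to two good nets\<close>

lemma ex_cycle:
  assumes "two_conn E W" "finite W"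
  shows "\<exists>C. cyc E C \<and> set C \<subseteq> W"
proof -
  obtain x where x: "x \<in> W" using ex_third[OF assms] by blast
  obtain a where a: "a \<in> W" "E x a" using two_conn_nbr[OF assms x] by blast
  obtain b where b: "b \<in> W" "b \<noteq> a" "E x b" using two_conn_nbr[OF assms x] by blast
  have "a \<in> W - {x}" "b \<in> W - {x}" using a b by auto
  then have "walk_in E (W - {x}) a b" using assms(1) by (auto simp: two_conn_def conn_def)
  then obtain xs where xs: "successively E (a # xs)" "distinct (a # xs)" "set (a # xs) \<subseteq> W - {x}" "last (a # xs) = b"
    using a by (auto elim!: walk_in_path)
  then have "xs \<noteq> []" using b by auto
  then have "cyc E (x # a # xs)" using xs a b by (auto simp: cyc_def Suc_le_eq sym_iff)
  then show ?thesis using xs x by (intro exI[of _ "x # a # xs"]) auto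
qed

lemma ex_longest_cycle:
  assumes "two_conn E W" "finite W"
  shows "\<exists>C. longest_cycle E W C"
proof -
  obtain C where C: "cyc E C \<and> set C \<subseteq> W" using ex_cycle[OF assms] by blast
  have "\<forall>D. cyc E D \<and> set D \<subseteq> W \<longrightarrow> length D < Suc (card W)"
    using assms(2) by (metis card_mono cyc_def distinct_card less_Suc_eq_le)
  then show ?thesis
    using ex_has_greatest_nat[of "\<lambda>D. cyc E D \<and> set D \<subseteq> W" C length "Suc (card W)"] C
    by (auto simp: longest_cycle_def)
qed

lemma ex_attached_path:
  assumes "two_conn E W" "finite W" "\<not> spanned_by_cycle E W"
  shows "\<exists>u v A B R. attached_path E W u v A B R"
proof -
  obtain C where C: "longest_cycle E W C" using ex_longest_cycle assms by blast
  then have CW: "cyc E C" "set C \<subseteq> W" by (auto simp: longest_cycle_def)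
  then have "set C \<noteq> W" using assms(3) by (auto simp: spanned_by_cycle_def)
  then obtain x where x: "x \<in> W" "x \<notin> set C" using CW by auto
  obtain c0 c1 where c: "c0 \<in> set C" "c1 \<in> set C" "c0 \<noteq> c1"
  proof -
    obtain a b zs where "C = a # b # zs"
      using CW by (cases C; cases "tl C") (auto simp: cyc_def)
    then show thesis using that[of a b] CW by (auto simp: cyc_def)
  qed
  \<comment> \<open>A vertex other than \<open>c1\<close> reaches \<open>c0\<close> without using
    \<open>c1\<close>; \<open>c1\<close> itself reaches \<open>c0\<close> without using
    \<open>x\<close>.\<close>
  have "conn E W"
  proof -
    have "conn E (W - {c1})" "walk_in E (W - {x}) c1 c0"
      using assms(1) c x CW by (auto simp: two_conn_def conn_def)
    then have "walk_in E W a c0" if "a \<in> W" for a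
      using that c CW(2) walk_in_mono[of E _ a c0 W] walk_in_mono[of E _ c1 c0 W]
      by (cases "a = c1") (auto simp: conn_def)
    then show ?thesis unfolding conn_def by (metis walk_in_sym walk_in_trans)
  qed
  then have "walk_in E W c0 x" using c x CW by (auto simp: conn_def)
  then have "x \<notin> set C \<longrightarrow> (\<exists>u r. u \<in> set C \<and> r \<in> W - set C \<and> E u r)"
    by (induction rule: walk_in_induct) (use c in auto)
  then obtain u r where ur: "u \<in> set C" "r \<in> W - set C" "E u r" using x by blast
  obtain c where c: "c \<in> set C" "c \<noteq> u" using c by blast
  have "walk_in E (W - {u}) r c" using assms(1) ur c CW(2) by (auto simp: two_conn_def conn_def)
  then obtain xs where xs: "successively E (r # xs)" "distinct (r # xs)" "set (r # xs) \<subseteq> W - {u}" "last (r # xs) = c"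
    using ur by (auto elim!: walk_in_path)
  \<comment> \<open>\<open>R\<close> stops before the first return to the cycle; the return vertex
    differs from \<open>u\<close>, which the walk avoids.\<close>
  define R where "R = takeWhile (\<lambda>y. y \<notin> set C) (r # xs)"
  define S where "S = dropWhile (\<lambda>y. y \<notin> set C) (r # xs)"
  have RS: "r # xs = R @ S" by (simp add: R_def S_def)
  have "\<exists>y\<in>set (r # xs). y \<in> set C" using xs(4) c last_in_set[of "r # xs"] by fastforce
  then have "S \<noteq> []" by (auto simp: S_def dropWhile_eq_Nil_conv)
  define v where "v = hd S"
  have "v \<in> set C" using hd_dropWhile[of "\<lambda>y. y \<notin> set C" "r # xs"] \<open>S \<noteq> []\<close> by (auto simp: S_def v_def)
  have "R \<noteq> []" "hd R = r" using ur by (auto simp: R_def)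
  have RC: "set R \<inter> set C = {}" using set_takeWhileD by (fastforce simp: R_def)
  have succ: "successively E (u # R @ [v])"
  proof -
    obtain S' where "S = v # S'" using \<open>S \<noteq> []\<close> by (metis list.collapse v_def)
    then have "successively E ((R @ [v]) @ S')" using xs(1) RS by simp
    then have "successively E (R @ [v])" by (simp only: successively_append_iff)
    then show ?thesis using \<open>R \<noteq> []\<close> \<open>hd R = r\<close> ur(3) by (auto simp: successively_Cons)
  qed
  have vu: "v \<noteq> u" using xs(3) RS hd_in_set[OF \<open>S \<noteq> []\<close>] unfolding v_def by auto
  obtain X Y where "C = X @ u # Y" using ur(1) by (meson split_list)
  then have L: "longest_cycle E W (u # Y @ X)" and "set C = set (u # Y @ X)"
    using C longest_cycle_rotate[of W X "u # Y"] by auto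
  then have "v \<in> set (Y @ X)" using \<open>v \<in> set C\<close> vu by auto
  then obtain A B where "Y @ X = A @ v # B" by (meson split_list)
  have "attached_path E W u v A B R"
  proof
    show "longest_cycle E W (u # A @ v # B)" using L \<open>Y @ X = A @ v # B\<close> by simp
    show "set R \<inter> set (u # A @ v # B) = {}"
      using RC \<open>set C = set (u # Y @ X)\<close> unfolding \<open>Y @ X = A @ v # B\<close> by simp
    show "set R \<subseteq> W" "distinct R" using xs(2,3) RS by (metis Diff_subset le_supE set_append subset_trans, metis distinct_append)
  qed (use succ \<open>R \<noteq> []\<close> in auto)
  then show ?thesis by blast
qed

theorem two_good_nets:
  assumes "two_conn E W" "finite W" "\<not> spanned_by_cycle E W"
  shows "\<exists>x1 x2 x3 y1 y2 y3. good_net E W x1 x2 x3 \<and> good_net E W y1 y2 y3 \<and> clq E x1 x2 \<inter> clq E y1 y2 \<inter> W = {}"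
  using assms
proof (induction "card W" arbitrary: W rule: less_induct)
  case less
  show ?case
  proof (cases "\<exists>e e' g g' w p. twin_square E W e e' g g' w p")
    case True
    then obtain e e' g g' w p where ts: "twin_square E W e e' g g' w p" by blast
    let ?W = "W - {e', g'}"
    have "e' \<in> W" using ts by (auto simp: twin_square_def)
    then have card: "card ?W < card W" using less.prems(2) by (intro psubset_card_mono) auto
    have W': "two_conn E ?W" "finite ?W" "\<not> spanned_by_cycle E ?W"
      using twin_square_two_conn[OF ts] twin_square_cycle[OF ts] less.prems by auto
    obtain x1 x2 x3 y1 y2 y3 where IH: "good_net E ?W x1 x2 x3" "good_net E ?W y1 y2 y3"
      "clq E x1 x2 \<inter> clq E y1 y2 \<inter> ?W = {}" 
      using less.hyps[OF card W'] by (elim exE conjE) (rule that)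
    have good: "good_net E W x1 x2 x3" "good_net E W y1 y2 y3"
      using good_net_superset[OF IH(1) _ W'(1,2)] good_net_superset[OF IH(2) _ W'(1,2)] by auto
    \<comment> \<open>The induction hypothesis gives disjointness only within the smaller set, so
      the two restored vertices are treated separately.\<close>
    have del: "a \<notin> clq E x1 x2 \<inter> clq E y1 y2" if a: "a \<in> {e', g'}" for a
    proof
      have xy: "x1 \<in> ?W" "x2 \<in> ?W" "y1 \<in> ?W" "y2 \<in> ?W" "E x1 x2"
        using IH(1,2) by (auto simp: good_net_def net_def)
      assume "a \<in> clq E x1 x2 \<inter> clq E y1 y2"
      then have "E a x1" "E a x2" "E a y1" "E a y2" using xy a unfolding clq_def by auto
      then have "x1 \<in> clq E x1 x2" "x1 \<in> clq E y1 y2"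
        using twin_square_nbrs[OF ts a, of x1 y1] twin_square_nbrs[OF ts a, of x1 y2] xy by (auto simp: clq_def)
      then show False using IH(3) xy by blast
    qed
    have "clq E x1 x2 \<inter> clq E y1 y2 \<inter> W = {}" using IH(3) del by blast
    with good show ?thesis by (intro exI conjI)
  next
    case False
    obtain u v A B R where "attached_path E W u v A B R" using ex_attached_path less.prems by blast
    then interpret P: attached_path E W u v A B R .
    interpret S: attached_path E W v u B A "rev R" by (rule P.swapped)
    have "\<exists>e e'. good_net E W u e e' \<and> clq E u e = clq E u (hd A)"
      using P.hub_cases by (simp only: False simp_thms)
    moreover have "\<exists>f f'. good_net E W v f f' \<and> clq E v f = clq E v (hd B)"
      using S.hub_cases by (simp only: False simp_thms)
    ultimately obtain e e' f f' where hubs: "good_net E W u e e'" "good_net E W v f f'"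
      "clq E u e \<inter> clq E v f \<inter> W = {}"
      using P.hubs_disjoint by auto
    then show ?thesis by (intro exI conjI)
  qed
qed

end

section \<open>From the closure back to the graph\<close>

lemma walk_in_induced_path:
  assumes "walk_in E S a b" "a \<in> S"
  obtains xs where "xs \<noteq> []" "hd xs = a" "last xs = b" "set xs \<subseteq> S" "successively E xs" "distinct xs"
    "\<And>i j. Suc i < j \<Longrightarrow> j < length xs \<Longrightarrow> \<not> E (xs ! i) (xs ! j)"
proof -
  define P where "P xs \<longleftrightarrow> xs \<noteq> [] \<and> hd xs = a \<and> last xs = b \<and> set xs \<subseteq> S \<and> successively E xs \<and> distinct xs" for xs
  obtain ys where "successively E (a # ys)" "distinct (a # ys)" "set (a # ys) \<subseteq> S" "last (a # ys) = b"
    using walk_in_path[OF assms] by blast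
  then have "P (a # ys)" by (simp add: P_def)
  then obtain xs where xs: "P xs" and min: "\<And>zs. P zs \<Longrightarrow> length xs \<le> length zs"
    using ex_has_least_nat[of P "a # ys" length] by blast
  have ind: "\<not> E (xs ! i) (xs ! j)" if ij: "Suc i < j" "j < length xs" for i j
  proof
    assume e: "E (xs ! i) (xs ! j)"
    let ?zs = "take (Suc i) xs @ drop j xs"
    have ne: "take (Suc i) xs \<noteq> []" "drop j xs \<noteq> []" using ij by auto
    have "successively E (take (Suc i) xs)" "successively E (drop j xs)"
      using xs ij by (auto simp: P_def successively_conv_nth)
    moreover have "last (take (Suc i) xs) = xs ! i" "hd (drop j xs) = xs ! j"
      using ij by (auto simp: take_Suc_conv_app_nth hd_drop_conv_nth)
    ultimately have "successively E ?zs" using e by (simp add: successively_append_iff)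
    moreover have "distinct ?zs"
      using xs set_take_disj_set_drop_if_distinct[of xs "Suc i" j] ij by (auto simp: P_def)
    moreover have "set ?zs \<subseteq> S" using xs set_take_subset[of "Suc i" xs] set_drop_subset[of j xs] by (auto simp: P_def)
    moreover have "hd ?zs = a" "last ?zs = b" using xs ne ij by (auto simp: P_def)
    ultimately have "P ?zs" using ne by (simp add: P_def)
    then show False using min[of ?zs] ij by auto
  qed
  show thesis by (rule that[of xs]) (use xs ind in \<open>auto simp: P_def\<close>)
qed

section \<open>Nets of the closure rebuilt with edges of the graph\<close>

locale closure_pair = claw_free_graph + D: closed_graph "dcl E"
begin

abbreviation D :: "'a \<Rightarrow> 'a \<Rightarrow> bool" where "D \<equiv> dcl E"

text \<open>The cliques of \<open>bc\<close> and \<open>ep\<close> share only \<open>b\<close>, so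
  the first edge of a walk of \<open>E\<close> inside the former leaves the latter.\<close>

lemma ex_nbr_outside:
  assumes "D e p" "b \<in> clq D e p" "D b c" "c \<notin> clq D e p"
  shows "\<exists>c'. E b c' \<and> c' \<notin> clq D e p"
proof -
  have "walk_in E (clq D b c) b c" using assms(3) by (rule dcl_walk_in)
  then obtain c' where c': "E b c'" "c' \<in> clq D b c"
    unfolding walk_in_def using dcl_irrefl[OF assms(3)] by (cases rule: converse_rtranclpE) auto
  moreover have "c' \<notin> clq D e p"
  proof
    assume "c' \<in> clq D e p"
    moreover have "b \<noteq> c'" using c' by auto
    ultimately have "clq D b c' = clq D e p" using D.clq_eq[OF assms(1,2)] by blast
    moreover have "clq D b c' = clq D b c" using D.clq_eq[OF assms(3)] D.in_clq[OF assms(3)] c' \<open>b \<noteq> c'\<close> by blast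
    ultimately show False using D.in_clq(2)[OF assms(3)] assms(4) by blast
  qed
  ultimately show ?thesis by blast
qed

text \<open>Suppose every neighbour of \<open>e\<close> in the clique reaches outside it. For an
  edge \<open>xy\<close> of the walk with \<open>x\<close> adjacent to \<open>e\<close>, a claw at
  \<open>x\<close> with an outer leaf makes \<open>y\<close> adjacent to \<open>e\<close>. So
  adjacency to \<open>e\<close> spreads along the walk up to \<open>p\<close>, and \<open>p\<close>
  itself will do.\<close>

lemma ex_pendant:
  assumes "D e p"
  shows "\<exists>b. E e b \<and> b \<in> clq D e p \<and> (b = p \<or> (\<forall>x. D b x \<longrightarrow> x \<in> clq D e p))"
proof (rule ccontr)
  assume no: "\<not> ?thesis"
  have "walk_in E (clq D e p) e p" using assms by (rule dcl_walk_in)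
  then have "p = e \<or> E e p"
  proof (induction rule: walk_in_induct)
    case (step x y)
    show ?case
    proof (rule ccontr)
      assume y: "\<not> (y = e \<or> E e y)"
      then have "E e x" using step by auto
      then have "\<exists>c. D x c \<and> c \<notin> clq D e p" using no step.hyps(3) by blast
      then obtain c where "D x c" "c \<notin> clq D e p" by blast
      then obtain c' where c': "E x c'" "c' \<notin> clq D e p" using ex_nbr_outside[OF assms] step.hyps by blast
      have e: "e \<in> clq D e p" using D.in_clq[OF assms] by blast
      have off: "\<not> E c' q" if "q \<in> clq D e p" "q \<noteq> x" for q
      proof
        assume "E c' q"
        then have "D c' q" "D c' x" using sym[OF c'(1)] by (auto intro: dcl.base)
        then have "c' \<in> clq D q x" by (simp add: clq_def)
        then show False using D.clq_eq[OF assms that(1) step.hyps(3) that(2)] c'(2) by simp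
      qed
      have "e \<noteq> x" "y \<noteq> x" using \<open>E e x\<close> step.hyps(2) by auto
      then have "\<not> E c' e" "\<not> E c' y" using off[OF e] off[OF step.hyps(4)] by simp_all
      moreover have "c' \<noteq> e" "c' \<noteq> y" using e step.hyps c' by auto
      ultimately show False using claw[of x e y c'] y step.hyps(2) sym[OF \<open>E e x\<close>] c'(1) sym[of y c'] sym[of e c'] by auto
    qed
  qed simp
  then have "E e p" using dcl_irrefl[OF assms] by auto
  then show False using no D.in_clq(2)[OF assms] by blast
qed

text \<open>A new pendant is either the old one or has no neighbours outside the clique of its edge,
  and so none elsewhere in the net.\<close>

lemma ex_pendants:
  assumes "net D a1 a2 a3 p1 p2 p3"
  shows "\<exists>b1 b2 b3. net D a1 a2 a3 b1 b2 b3 \<and> E a1 b1 \<and> E a2 b2 \<and> E a3 b3"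
proof -
  have pend: "\<exists>b. E a b \<and> b \<in> clq D a p \<and> (b = p \<or> (\<forall>x. D b x \<longrightarrow> x \<in> clq D a p))" if "D a p" for a p
    using that by (rule ex_pendant)
  have outside: "\<not> D c b" if "D a c" "D a p" "\<not> D c p" "E a b" "b \<in> clq D a p" "c \<noteq> p" for a c p b
  proof
    assume "D c b"
    have ab: "D a b" "a \<noteq> b" using that(4) by (auto intro: dcl.base)
    have "clq D a b = clq D a p"
      using D.clq_eq[OF that(2) D.in_clq(1)[OF that(2)] that(5) ab(2)] .
    moreover have "c \<in> clq D a b" using \<open>D c b\<close> that(1) by (auto simp: clq_def D.sym_iff)
    ultimately show False using that(3,6) by (auto simp: clq_def)
  qed
  have nonadj: "\<not> D b b'" if "\<forall>x. D b x \<longrightarrow> x \<in> clq D a p" "\<not> D a b'" "b' \<noteq> a" for a p b b'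
    using that by (auto simp: clq_def D.sym_iff)
  obtain b1 where b1: "E a1 b1" "b1 \<in> clq D a1 p1" "b1 = p1 \<or> (\<forall>x. D b1 x \<longrightarrow> x \<in> clq D a1 p1)"
    using pend[of a1 p1] assms by (auto simp: net_def)
  obtain b2 where b2: "E a2 b2" "b2 \<in> clq D a2 p2" "b2 = p2 \<or> (\<forall>x. D b2 x \<longrightarrow> x \<in> clq D a2 p2)"
    using pend[of a2 p2] assms by (auto simp: net_def)
  obtain b3 where b3: "E a3 b3" "b3 \<in> clq D a3 p3" "b3 = p3 \<or> (\<forall>x. D b3 x \<longrightarrow> x \<in> clq D a3 p3)"
    using pend[of a3 p3] assms by (auto simp: net_def)
  have a: "D a1 a2" "D a2 a3" "D a1 a3" "D a1 p1" "D a2 p2" "D a3 p3" using assms by (auto simp: net_def)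
  then have a': "D a2 a1" "D a3 a2" "D a3 a1" by (auto simp: D.sym_iff)
  have np: "\<not> D a1 p2" "\<not> D a1 p3" "\<not> D a2 p1" "\<not> D a2 p3" "\<not> D a3 p1" "\<not> D a3 p2"
    "\<not> D p1 p2" "\<not> D p1 p3" "\<not> D p2 p3" using assms by (auto simp: net_def)
  have ne: "a2 \<noteq> p1" "a3 \<noteq> p1" "a1 \<noteq> p2" "a3 \<noteq> p2" "a1 \<noteq> p3" "a2 \<noteq> p3"
    using a(1-3) a' np by auto
  have nb: "\<not> D a2 b1" "\<not> D a3 b1" "\<not> D a1 b2" "\<not> D a3 b2" "\<not> D a1 b3" "\<not> D a2 b3"
    using outside[OF a(1) a(4) np(3) b1(1,2) ne(1)] outside[OF a(3) a(4) np(5) b1(1,2) ne(2)]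
      outside[OF a'(1) a(5) np(1) b2(1,2) ne(3)] outside[OF a(2) a(5) np(6) b2(1,2) ne(4)]
      outside[OF a'(3) a(6) np(2) b3(1,2) ne(5)] outside[OF a'(2) a(6) np(4) b3(1,2) ne(6)] by auto
  have ne': "b1 \<noteq> a2" "b1 \<noteq> a3" "b2 \<noteq> a1" "b2 \<noteq> a3" "b3 \<noteq> a1" "b3 \<noteq> a2"
    using a(1-3) a' nb by auto
  have "\<not> D b1 b2"
    using b1(3) b2(3) np(7) nonadj[OF _ nb(3) ne'(3)] nonadj[OF _ nb(1) ne'(1)] D.sym[of b1 b2] by auto
  moreover have "\<not> D b1 b3"
    using b1(3) b3(3) np(8) nonadj[OF _ nb(5) ne'(5)] nonadj[OF _ nb(2) ne'(2)] D.sym[of b1 b3] by auto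
  moreover have "\<not> D b2 b3"
    using b2(3) b3(3) np(9) nonadj[OF _ nb(6) ne'(6)] nonadj[OF _ nb(4) ne'(4)] D.sym[of b2 b3] by auto
  moreover have "D a1 b1" "D a2 b2" "D a3 b3" using b1(1) b2(1) b3(1) by (auto intro: dcl.base)
  ultimately have "net D a1 a2 a3 b1 b2 b3" using a nb by (simp add: net_def)
  then show ?thesis using b1(1) b2(1) b3(1) by blast
qed

text \<open>A chordless path \<open>X\<close> of \<open>E\<close> through the clique links two
  pendants. The third pendant is not near \<open>X\<close>, so on a walk from it to \<open>X\<close>
  some \<open>y\<close> outside \<open>X\<close> is adjacent to \<open>X\<close> and to a vertex
  \<open>w\<close> that is not near. Then \<open>y\<close> and two consecutive vertices of
  \<open>X\<close> form the triangle; \<open>w\<close> and the next vertices of \<open>X\<close> on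
  both sides are the pendants.\<close>

lemma ex_net_in_clq_aux:
  assumes net: "net D a1 a2 a3 b1 b2 b3" and pend: "E a1 b1" "E a2 b2" "E a3 b3"
  shows "\<exists>t1 t2 t3 c1 c2 c3. net E t1 t2 t3 c1 c2 c3 \<and> {t1, t2, t3} \<subseteq> clq D a1 a2"
proof -
  define Q where "Q = clq D a1 a2"
  have a: "D a1 a2" "D a2 a3" "D a1 a3" and nb: "\<not> D a1 b2" "\<not> D a1 b3" "\<not> D a2 b1" "\<not> D a2 b3" "\<not> D a3 b1"
    "\<not> D a3 b2" "\<not> D b1 b2" "\<not> D b1 b3" "\<not> D b2 b3" using net by (auto simp: net_def)
  have aQ: "a1 \<in> Q" "a2 \<in> Q" "a3 \<in> Q" using a by (auto simp: Q_def clq_def D.sym_iff)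
  have ane: "a1 \<noteq> a2" "a2 \<noteq> a3" "a1 \<noteq> a3" using a by auto
  have clqQ: "x \<in> Q \<Longrightarrow> y \<in> Q \<Longrightarrow> x \<noteq> y \<Longrightarrow> D x y" for x y
    using D.clq_clique[OF a(1)] by (simp add: Q_def)
  have inQ: "z \<in> Q" if "x \<in> Q" "y \<in> Q" "x \<noteq> y" "D z x" "D z y" for x y z
    using D.clq_eq[OF a(1), of x y] that unfolding Q_def by (auto simp: clq_def)
  have bQ: "b1 \<notin> Q" "b2 \<notin> Q" "b3 \<notin> Q"
    using clqQ[of a2 b1] clqQ[of a3 b1] clqQ[of a1 b2] clqQ[of a3 b2] clqQ[of a1 b3] clqQ[of a2 b3] aQ ane nb by auto
  have only: "x = a'" if "E b' x" "x \<in> Q" "E a' b'" "a' \<in> Q" "b' \<notin> Q" for x a' b'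
    using inQ[of x a' b'] that dcl.base[of E b' x] dcl.base[of E b' a'] sym[of a' b'] by auto
  note only1 = only[OF _ _ pend(1) aQ(1) bQ(1)] and only2 = only[OF _ _ pend(2) aQ(2) bQ(2)]
    and only3 = only[OF _ _ pend(3) aQ(3) bQ(3)]
  have nbE: "\<not> E b1 b2" "\<not> E b1 b3" "\<not> E b2 b3" using nb by (auto intro: dcl.base)
  have bne: "b1 \<noteq> b2" "b1 \<noteq> b3" "b2 \<noteq> b3" using nb pend by (auto dest: dcl.base)
  define S where "S = Q \<union> {b1, b2}"
  have "walk_in E S a1 a2" using dcl_walk_in[OF a(1)] by (rule walk_in_mono) (auto simp: Q_def S_def)
  moreover have "walk_in E S b1 a1" "walk_in E S a2 b2"
    using pend aQ by (auto simp: S_def sym_iff intro!: walk_in_edge)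
  ultimately have "walk_in E S b1 b2" by (blast intro: walk_in_trans)
  then obtain X where X: "X \<noteq> []" "hd X = b1" "last X = b2" "set X \<subseteq> S" "successively E X" "distinct X"
    and ind: "\<And>i j. Suc i < j \<Longrightarrow> j < length X \<Longrightarrow> \<not> E (X ! i) (X ! j)"
    by (rule walk_in_induced_path) (auto simp: S_def)
  define n where "n = length X"
  have nth: "X ! i \<in> S" if "i < n" for i using that X(4) nth_mem by (auto simp: n_def)
  have step: "E (X ! i) (X ! Suc i)" if "Suc i < n" for i using that X(5) by (auto simp: n_def successively_conv_nth)
  have inj: "X ! i = X ! j \<longleftrightarrow> i = j" if "i < n" "j < n" for i j
    using that X(6) by (auto simp: n_def nth_eq_iff_index_eq)
  have X0: "X ! 0 = b1" and Xn: "X ! (n - 1) = b2" using X by (auto simp: n_def hd_conv_nth last_conv_nth)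
  have "n \<noteq> 0" "n \<noteq> 1" using X(1) X0 Xn bne by (auto simp: n_def)
  then have n2: "2 \<le> n" by simp
  have a1X: "a1 \<in> set X"
  proof -
    have "E b1 (X ! 1)" "X ! 1 \<in> S" using step[of 0] nth[of 1] X0 n2 by auto
    then have "X ! 1 = a1" using only1[of "X ! 1"] nbE by (auto simp: S_def)
    then show ?thesis using n2 nth_mem[of 1 X] by (auto simp: n_def)
  qed
  have a2X: "a2 \<in> set X"
  proof -
    have "Suc (n - 2) = n - 1" "Suc (n - 2) < n" using n2 by auto
    then have "E b2 (X ! (n - 2))" "X ! (n - 2) \<in> S" using step[of "n - 2"] nth[of "n - 2"] Xn n2
      by (auto simp: sym_iff)
    then have "X ! (n - 2) = a2" using only2[of "X ! (n - 2)"] nbE by (auto simp: S_def sym_iff)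
    then show ?thesis using n2 nth_mem[of "n - 2" X] by (auto simp: n_def)
  qed
  have mid: "0 < i \<and> Suc i < n" if "i < n" "X ! i \<noteq> b1" "X ! i \<noteq> b2" for i
    using that X0 Xn by (cases "i = 0"; cases "i = n - 1") auto
  \<comment> \<open>As an inner vertex of \<open>X\<close>, \<open>a3\<close> would be the centre of
    a claw with its two path neighbours and \<open>b3\<close>.\<close>
  have a3X: "a3 \<notin> set X"
  proof
    assume "a3 \<in> set X"
    then obtain i where i: "i < n" "X ! i = a3" by (auto simp: n_def in_set_conv_nth)
    then have m: "0 < i" "Suc i < n" using mid[of i] aQ bQ by auto
    have "E a3 (X ! (i - 1))" "E a3 (X ! Suc i)" using step[of "i - 1"] step[of i] i m by (auto simp: sym_iff)
    moreover have "\<not> E (X ! (i - 1)) (X ! Suc i)" using ind[of "i - 1" "Suc i"] m by (auto simp: n_def)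
    moreover have "X ! (i - 1) \<in> S" "X ! Suc i \<in> S" "X ! (i - 1) \<noteq> a3" "X ! Suc i \<noteq> a3" "X ! (i - 1) \<noteq> X ! Suc i"
      using nth[of "i - 1"] nth[of "Suc i"] inj[of "i - 1" i] inj[of "Suc i" i] inj[of "i - 1" "Suc i"] i m by auto
    moreover have "\<not> E x b3 \<and> x \<noteq> b3" if "x \<in> S" "x \<noteq> a3" for x
      using only3[of x] that nbE bne bQ by (auto simp: S_def sym_iff)
    ultimately show False using claw[of a3 "X ! (i - 1)" "X ! Suc i" b3] pend(3) by blast
  qed
  define near where "near z \<longleftrightarrow> z \<in> set X \<or> (\<exists>x\<in>set X. E z x)" for z
  have b3: "\<not> near b3"
    using X(4) a3X only3 bQ nbE bne by (auto simp: near_def S_def sym_iff)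
  define T where "T = Q \<union> {b3}"
  have "walk_in E T b3 a3" using pend(3) aQ by (auto simp: T_def sym_iff intro!: walk_in_edge)
  moreover have "walk_in E T a3 a1"
  proof -
    have "clq D a1 a3 = Q" using D.clq_eq[OF a(1), of a1 a3] aQ ane by (simp add: Q_def)
    then have "walk_in E T a1 a3" using dcl_walk_in[OF a(3)] walk_in_mono[of E Q a1 a3 T] by (auto simp: T_def)
    then show ?thesis by (rule walk_in_sym)
  qed
  ultimately have "walk_in E T b3 a1" by (rule walk_in_trans)
  then have "near a1 \<longrightarrow> (\<exists>w y. w \<in> T \<and> y \<in> T \<and> E w y \<and> \<not> near w \<and> near y)"
    by (induction rule: walk_in_induct) (use b3 in auto)
  then obtain w y where wy: "w \<in> T" "y \<in> T" "E w y" "\<not> near w" "near y" using a1X by (auto simp: near_def)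
  have yX: "y \<notin> set X" using wy by (auto simp: near_def)
  have yQ: "y \<in> Q" using wy b3 by (auto simp: T_def)
  have yb: "\<not> E y b1" "\<not> E y b2" using only1[of y] only2[of y] yQ yX a1X a2X by (auto simp: sym_iff)
  have wX: "\<not> E w (X ! i)" "w \<noteq> X ! i" if "i < n" for i using wy that by (auto simp: near_def n_def)
  obtain i where i: "i < n" "E y (X ! i)" using wy yX by (auto simp: near_def n_def in_set_conv_nth)
  then have m: "0 < i" "Suc i < n" using mid[of i] yb by auto
  have "E (X ! i) (X ! (i - 1))" "E (X ! i) (X ! Suc i)" using step[of "i - 1"] step[of i] m by (auto simp: sym_iff)
  moreover have "\<not> E (X ! (i - 1)) (X ! Suc i)" using ind[of "i - 1" "Suc i"] m by (auto simp: n_def)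
  moreover have "X ! (i - 1) \<noteq> y" "X ! Suc i \<noteq> y" "X ! (i - 1) \<noteq> X ! Suc i"
    using yX nth_mem[of "i - 1" X] nth_mem[of "Suc i" X] inj[of "i - 1" "Suc i"] m by (auto simp: n_def)
  ultimately have "E y (X ! (i - 1)) \<or> E y (X ! Suc i)"
    using claw[of "X ! i" "X ! (i - 1)" "X ! Suc i" y] i by (auto simp: sym_iff)
  \<comment> \<open>Without two consecutive neighbours of \<open>y\<close> on \<open>X\<close> there
    would be a claw at \<open>X ! i\<close>.\<close>
  then obtain j where j: "Suc j < n" "E y (X ! j)" "E y (X ! Suc j)"
  proof
    assume "E y (X ! (i - 1))"
    then show thesis using that[of "i - 1"] i m by auto
  next
    assume "E y (X ! Suc i)"
    then show thesis using that[of i] i m by auto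
  qed
  have "X ! j \<noteq> b1" "X ! j \<noteq> b2" "X ! Suc j \<noteq> b1" "X ! Suc j \<noteq> b2" using j yb by auto
  then have jj: "0 < j" "Suc (Suc j) < n" and tQ: "X ! j \<in> Q" "X ! Suc j \<in> Q"
    using mid[of j] mid[of "Suc j"] nth[of j] nth[of "Suc j"] j by (auto simp: S_def)
  have "j - 1 \<noteq> Suc j" "j - 1 < n" "j < n" using jj by auto
  then have Xne: "X ! (j - 1) \<noteq> X ! Suc j" "X ! j \<noteq> X ! Suc (Suc j)"
    using inj[of "j - 1" "Suc j"] inj[of j "Suc (Suc j)"] jj by auto
  have "\<not> E (X ! (j - 1)) (X ! Suc j)" "\<not> E (X ! j) (X ! Suc (Suc j))" "\<not> E (X ! (j - 1)) (X ! Suc (Suc j))"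
    using ind jj by (auto simp: n_def)
  \<comment> \<open>A claw at \<open>y\<close> with leaf \<open>w\<close> excludes two non-adjacent
    neighbours of \<open>y\<close> on \<open>X\<close>.\<close>
  moreover have "\<not> E y (X ! (j - 1))"
    using claw[of y w "X ! (j - 1)" "X ! Suc j"] wy wX calculation j jj Xne by (auto simp: sym_iff)
  moreover have "\<not> E y (X ! Suc (Suc j))"
    using claw[of y w "X ! j" "X ! Suc (Suc j)"] wy wX calculation j jj Xne by (auto simp: sym_iff)
  moreover have "\<not> E (X ! j) w" "\<not> E (X ! Suc j) w" "\<not> E w (X ! (j - 1))" "\<not> E w (X ! Suc (Suc j))"
    using wX jj by (auto simp: sym_iff)
  moreover have "E (X ! j) (X ! Suc j)" "E (X ! j) (X ! (j - 1))" "E (X ! Suc j) (X ! Suc (Suc j))" "E y w"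
    using step[of j] step[of "j - 1"] step[of "Suc j"] jj wy by (auto simp: sym_iff)
  ultimately have "net E y (X ! j) (X ! Suc j) w (X ! (j - 1)) (X ! Suc (Suc j))"
    using j unfolding net_def by (simp add: sym_iff)
  then show ?thesis using yQ tQ unfolding Q_def by blast
qed

lemma ex_net_in_clq:
  assumes "net D a1 a2 a3 p1 p2 p3"
  shows "\<exists>t1 t2 t3 c1 c2 c3. net E t1 t2 t3 c1 c2 c3 \<and> {t1, t2, t3} \<subseteq> clq D a1 a2"
  using ex_pendants[OF assms] ex_net_in_clq_aux by blast

text \<open>A closure step creating an edge at \<open>c\<close> uses an edge \<open>ab\<close> among
  the neighbours of \<open>c\<close> and a second common neighbour of \<open>a\<close> and
  \<open>b\<close>. For \<open>b2\<close> and \<open>b3\<close> there is no such edge; for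
  \<open>t2\<close> it can only be \<open>t1 t3\<close>, whose ends have no further common
  neighbour, and similarly for \<open>t3\<close>.\<close>

lemma dcl_nbr_q_heavy:
  assumes net: "net E t1 t2 t3 b1 b2 b3"
    and t2: "\<And>x. E t2 x \<longleftrightarrow> x \<in> {t1, t3, b2}" and t3: "\<And>x. E t3 x \<longleftrightarrow> x \<in> {t1, t2, b3}"
    and b2: "\<And>x. E b2 x \<longleftrightarrow> x \<in> {t2, z2}" and b3: "\<And>x. E b3 x \<longleftrightarrow> x \<in> {t3, z3}"
    and D: "D x y" and Z: "x \<in> {t2, t3, b2, b3} \<or> y \<in> {t2, t3, b2, b3}"
  shows "E x y"
  using D Z
proof (induction rule: dcl.induct)
  case (step a b c d)
  let ?Z = "{t2, t3, b2, b3}"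
  have b2': "b2 \<notin> {t1, t2, t3, b1, b3}" and b3': "b3 \<notin> {t1, t2, t3, b1, b2}"
    and non: "\<not> E b2 t1" "\<not> E b2 t3" "\<not> E b3 t1" "\<not> E b3 t2" "\<not> E b2 b3"
    using net by (auto simp: net_def sym_iff)
  have z: "\<not> E t2 z2" "\<not> E t3 z3" using t2[of z2] t3[of z3] b2[of z2] b3[of z3] non by auto
  \<comment> \<open>The edges \<open>ab\<close> and \<open>cd\<close> are those of the closure step;
    the assumptions record that edges at the four vertices already belong to
    \<open>E\<close>.\<close>
  have key: False if c: "c \<in> ?Z" and ab: "a \<noteq> b" and e: "E c a" "E c b"
    "a \<in> ?Z \<or> b \<in> ?Z \<Longrightarrow> E a b" "a \<in> ?Z \<Longrightarrow> E d a" "b \<in> ?Z \<Longrightarrow> E d b" "d \<in> ?Z \<Longrightarrow> E d a \<and> E d b"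
    "c \<noteq> d" "d \<noteq> a" "d \<noteq> b" for a b c d
  proof -
    have Dab: "E a b" if "a \<in> ?Z \<or> b \<in> ?Z" using e(3) that .
    consider "c = t2" | "c = t3" | "c = b2" | "c = b3" using c by auto
    then show False
    proof cases
      case 1
      then have "a \<in> {t1, t3, b2}" "b \<in> {t1, t3, b2}" using e t2 by auto
      moreover have "a \<noteq> b2" "b \<noteq> b2" using Dab calculation ab non by (auto simp: sym_iff)
      ultimately have "(a = t1 \<and> b = t3) \<or> (a = t3 \<and> b = t1)" using ab by auto
      then have "E d t3" "d \<in> ?Z \<Longrightarrow> E d t1" "d \<noteq> t1" using e by auto
      then show False using t3[of d] e(7) 1 non by (auto simp: sym_iff)
    next
      case 2
      then have "a \<in> {t1, t2, b3}" "b \<in> {t1, t2, b3}" using e t3 by auto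
      moreover have "a \<noteq> b3" "b \<noteq> b3" using Dab calculation ab non by (auto simp: sym_iff)
      ultimately have "(a = t1 \<and> b = t2) \<or> (a = t2 \<and> b = t1)" using ab by auto
      then have "E d t2" "d \<in> ?Z \<Longrightarrow> E d t1" "d \<noteq> t1" using e by auto
      then show False using t2[of d] e(7) 2 non by (auto simp: sym_iff)
    next
      case 3
      then have "(a = t2 \<and> b = z2) \<or> (a = z2 \<and> b = t2)" using e b2 ab by auto
      then show False using Dab z by (auto simp: sym_iff)
    next
      case 4
      then have "(a = t3 \<and> b = z3) \<or> (a = z3 \<and> b = t3)" using e b3 ab by auto
      then show False using Dab z by (auto simp: sym_iff)
    qed
  qed
  have ne: "a \<noteq> b" "a \<noteq> c" "b \<noteq> c" "a \<noteq> d" "b \<noteq> d" using step.hyps by (auto dest: dcl_irrefl)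
  have IH: "a \<in> ?Z \<or> b \<in> ?Z \<Longrightarrow> E a b" "a \<in> ?Z \<or> c \<in> ?Z \<Longrightarrow> E c a" "b \<in> ?Z \<or> c \<in> ?Z \<Longrightarrow> E c b"
    "a \<in> ?Z \<or> d \<in> ?Z \<Longrightarrow> E d a" "b \<in> ?Z \<or> d \<in> ?Z \<Longrightarrow> E d b"
    using step.IH sym by blast+
  have False using step.prems
  proof
    assume "c \<in> ?Z"
    then show False using IH ne step.hyps(6) by (intro key[of c a b d]) auto
  next
    assume "d \<in> ?Z"
    then show False using IH ne step.hyps(6) by (intro key[of d a b c]) auto
  qed
  then show ?case ..
qed

end

section \<open>Heavy pairs\<close>

lemma successively_clique:
  assumes "distinct xs" "\<And>x y. x \<in> set xs \<Longrightarrow> y \<in> set xs \<Longrightarrow> x \<noteq> y \<Longrightarrow> E x y"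
  shows "successively E xs"
  using assms by (induction xs rule: induct_list012) auto

context closed_graph
begin

text \<open>If \<open>t1\<close> and \<open>z2\<close> were not adjacent, then the cliques formed by their neighbours would share at
  most one vertex and together with \<open>t2, t3, b2, b3\<close> exceed the number of vertices.\<close>

lemma q_heavy_adjacent:
  assumes net: "net E t1 t2 t3 b1 b2 b3"
    and t2: "\<And>x. E t2 x \<longleftrightarrow> x \<in> {t1, t3, b2}" and t3: "\<And>x. E t3 x \<longleftrightarrow> x \<in> {t1, t2, b3}"
    and b2: "\<And>x. E b2 x \<longleftrightarrow> x \<in> {t2, z2}" and b3: "\<And>x. E b3 x \<longleftrightarrow> x \<in> {t3, z3}"
    and z: "z2 \<noteq> t2" "z3 \<noteq> t3"
    and V: "finite V" "\<forall>x y. E x y \<longrightarrow> x \<in> V"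
    and deg: "card V \<le> 2 * card {x. E t1 x}" "card V \<le> 2 * card {x. E z2 x}"
  shows "z2 \<noteq> z3" "E t1 z2"
proof -
  have nt: "\<not> E b2 t1" "\<not> E b2 t3" "\<not> E b3 t1" "\<not> E b3 t2" "\<not> E b2 b1" "\<not> E b3 b1" "\<not> E b2 b3" "E t1 t2" "E t1 t3" "E t1 b1"
    using net by (simp_all add: net_def sym_iff)
  have d: "distinct [t1, t2, t3, b1, b2, b3]" using net by (auto simp: net_def sym_iff)
  have DV: "x \<in> V" "y \<in> V" if "E x y" for x y using V(2) that sym[OF that] by auto
  have fin: "finite {x. E y x}" for y by (rule finite_subset[OF _ V(1)]) (auto intro: DV)
  have z2: "E b2 z2" "z2 \<notin> {t1, t2, t3, b1, b2, b3}"
    using b2[of z2] z nt by auto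
  have z3: "E b3 z3" "z3 \<notin> {t1, t2, t3, b1, b2, b3}"
    using b3[of z3] z nt by (auto simp: sym_iff)
  have nz: "\<not> E z2 t2" "\<not> E z2 t3" using t2[of z2] t3[of z2] z2 by (auto simp: sym_iff)
  have inV: "{t1, t2, t3, b1, b2, b3} \<subseteq> V" using net by (auto simp: net_def intro: DV)
  have n6: "6 \<le> card V" using card_mono[OF V(1) inV] d by simp
  show z23: "z2 \<noteq> z3"
  proof
    assume eq: "z2 = z3"
    \<comment> \<open>A further neighbour of \<open>z2\<close> would form a claw with
      \<open>b2\<close> and \<open>b3\<close>; so \<open>z2\<close> has degree at most 2, too small
      to be heavy among six or more vertices.\<close>
    have "{x. E z2 x} \<subseteq> {b2, b3}"
    proof
      fix x assume x: "x \<in> {x. E z2 x}"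
      have "\<not> E b2 x" "\<not> E b3 x" using b2[of x] b3[of x] x eq nz by auto
      then show "x \<in> {b2, b3}" using claw[of z2 b2 b3 x] x d z2 z3 eq nt by (auto simp: sym_iff)
    qed
    then have "card {x. E z2 x} \<le> card {b2, b3}" by (intro card_mono) auto
    moreover have "card {b2, b3} \<le> 2" by (simp add: card_insert_if)
    ultimately show False using deg(2) n6 by linarith
  qed
  show "E t1 z2"
  proof (rule ccontr)
    assume no: "\<not> E t1 z2"
    define O1 where "O1 = {x. E t1 x} - {t2, t3}"
    define O2 where "O2 = {x. E z2 x} - {b2}"
    have fO: "finite O1" "finite O2" using fin by (auto simp: O1_def O2_def)
    have O1: "E x y" if "x \<in> O1" "y \<in> O1" "x \<noteq> y" for x y
    proof -
      have "\<not> E t2 x" "\<not> E t2 y" using t2[of x] t2[of y] that nt by (auto simp: O1_def sym_iff)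
      then show ?thesis using claw[of t1 t2 x y] that nt by (auto simp: O1_def)
    qed
    have O2: "E x y" if "x \<in> O2" "y \<in> O2" "x \<noteq> y" for x y
    proof -
      have "\<not> E b2 x" "\<not> E b2 y" using b2[of x] b2[of y] that nz by (auto simp: O2_def)
      then show ?thesis using claw[of z2 b2 x y] that z2 by (auto simp: O2_def sym_iff)
    qed
    \<comment> \<open>\<open>t1\<close> has at most |K1| + 1 neighbours and \<open>z2\<close> at
      most |K2|. The two cliques cover at most |V| - 4 vertices and share at most one, so the
      degrees add up to at most |V| - 2.\<close>
    define K1 where "K1 = insert t1 O1"
    define K2 where "K2 = insert z2 O2"
    have fK: "finite (K1 \<inter> K2)" using fO by (simp add: K1_def K2_def)
    have eq: "c = c'" if "c \<in> K1 \<inter> K2" "c' \<in> K1 \<inter> K2" for c c'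
    proof (rule ccontr)
      assume "c \<noteq> c'"
      have "c \<in> O1" "c \<in> O2" "c' \<in> O1" "c' \<in> O2" using that no z2 by (auto simp: K1_def K2_def O1_def O2_def sym_iff)
      then have "E t1 c" "E t1 c'" "E z2 c" "E z2 c'" "E c c'" using O1[of c c'] \<open>c \<noteq> c'\<close> by (auto simp: O1_def O2_def)
      then show False using diamond[of c c' t1 z2] z2 no by (auto simp: sym_iff)
    qed
    have "card (K1 \<inter> K2) \<le> 1" unfolding One_nat_def card_le_Suc0_iff_eq[OF fK] using eq by blast
    moreover have "card K1 + card K2 = card (K1 \<union> K2) + card (K1 \<inter> K2)"
      using fO by (intro card_Un_Int) (auto simp: K1_def K2_def)
    moreover have "card K1 = card O1 + 1" "card K2 = card O2 + 1"
      using fO by (auto simp: K1_def K2_def O1_def O2_def)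
    moreover have "card (K1 \<union> K2) + 4 \<le> card V"
    proof -
      have "(K1 \<union> K2) \<inter> {t2, t3, b2, b3} = {}"
        using z2 nz nt d b3[of z2] z23 by (auto simp: K1_def K2_def O1_def O2_def sym_iff)
      then have "card ((K1 \<union> K2) \<union> {t2, t3, b2, b3}) = card (K1 \<union> K2) + card {t2, t3, b2, b3}"
        using fO by (intro card_Un_disjoint) (auto simp: K1_def K2_def)
      moreover have "card ((K1 \<union> K2) \<union> {t2, t3, b2, b3}) \<le> card V"
        using inV DV[OF z2(1)] DV V(1) by (intro card_mono) (auto simp: K1_def K2_def O1_def O2_def)
      ultimately show ?thesis using d by simp
    qed
    moreover have "card {x. E t1 x} \<le> card O1 + 2"
    proof -
      have "card {x. E t1 x} \<le> card (O1 \<union> {t2, t3})" using fO by (intro card_mono) (auto simp: O1_def)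
      also have "\<dots> \<le> card O1 + card {t2, t3}" by (rule card_Un_le)
      finally show ?thesis using d by simp
    qed
    moreover have "card {x. E z2 x} \<le> card O2 + 1"
    proof -
      have "card {x. E z2 x} \<le> card (O2 \<union> {b2})" using fO by (intro card_mono) (auto simp: O2_def)
      also have "\<dots> \<le> card O2 + card {b2}" by (rule card_Un_le)
      finally show ?thesis by simp
    qed
    ultimately show False using deg by linarith
  qed
qed

lemma q_heavy_q_type:
  assumes net: "net E t1 t2 t3 b1 b2 b3"
    and t2: "\<And>x. E t2 x \<longleftrightarrow> x \<in> {t1, t3, b2}" and t3: "\<And>x. E t3 x \<longleftrightarrow> x \<in> {t1, t2, b3}"
    and b2: "\<And>x. E b2 x \<longleftrightarrow> x \<in> {t2, z2}" and b3: "\<And>x. E b3 x \<longleftrightarrow> x \<in> {t3, z3}"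
    and z: "z2 \<noteq> t2" "z3 \<noteq> t3"
    and V: "finite V" "\<forall>x y. E x y \<longrightarrow> x \<in> V"
    and deg: "card V \<le> 2 * card {x. E t1 x}" "card V \<le> 2 * card {x. E z2 x}" "card V \<le> 2 * card {x. E z3 x}"
  shows "q_type E V t1 t2 t3"
proof -
  have net': "net E t1 t3 t2 b1 b3 b2" using net by (simp add: net_def sym_iff)
  have t2': "E t2 x \<longleftrightarrow> x \<in> {t1, t3, b2}" and t3': "E t3 x \<longleftrightarrow> x \<in> {t1, t2, b3}" for x
    using t2 t3 by auto
  note a2 = q_heavy_adjacent[OF net t2' t3' b2 b3 z V deg(1,2)]
  note a3 = q_heavy_adjacent(2)[OF net' t3' t2' b3 b2 z(2,1) V deg(1,3)]
  have "z2 \<notin> {t1, t3, b2}" using a2(2) b2[of z2] net by (auto simp: net_def sym_iff)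
  then have "\<not> E t2 z2" using t2 by blast
  moreover have "z3 \<notin> {t1, t3, b2}" using a3 b3[of z3] z(2) net by (auto simp: net_def sym_iff)
  then have "\<not> E t2 z3" using t2 by blast
  ultimately have "E z2 z3"
    using claw[of t1 t2 z2 z3] a2 a3 z \<open>z3 \<notin> {t1, t3, b2}\<close> b3[of z3] net t2[of t1] by (auto simp: net_def sym_iff)
  moreover have "{b2, b3, z2, z3} \<subseteq> V"
    using V(2) sym[OF a2(2)] sym[OF a3] b2[of t2] b3[of t3] by auto
  moreover have "E x t2 \<longleftrightarrow> x \<in> {t1, t3, b2}" "E x t3 \<longleftrightarrow> x \<in> {t1, t2, b3}"
    "E x b2 \<longleftrightarrow> x \<in> {t2, z2}" "E x b3 \<longleftrightarrow> x \<in> {t3, z3}" for x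
    unfolding t2[symmetric] t3[symmetric] b2[symmetric] b3[symmetric] by (rule sym_iff)+
  ultimately show ?thesis unfolding q_type_def using z a2(2) a3
    by (intro exI[of _ b2] exI[of _ b3] exI[of _ z2] exI[of _ z3] conjI ballI)
qed

section \<open>Counting with two heavy pairs\<close>

text \<open>\<open>P\<close> collects the vertices missed by \<open>Q\<close> and the outer
  neighbourhoods \<open>O1\<close>, \<open>O2\<close>, which are disjoint as \<open>Q\<close>
  contains all common neighbours. Heaviness gives |P| \<le> |Q| - 2, and \<open>Q'\<close> meets
  each outer neighbourhood at most once, since two members would put \<open>a1\<close> or
  \<open>a2\<close> into \<open>Q'\<close>. Equality of sizes forces \<open>Q'\<close> to contain
  \<open>P\<close>.\<close>

lemma heavy_pair_bound:
  assumes a: "E a1 a2" and c: "E c1 c2" and disj: "clq E a1 a2 \<inter> clq E c1 c2 = {}"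
    and V: "finite V" "\<forall>x y. E x y \<longrightarrow> x \<in> V"
    and deg: "card V \<le> card {x. E a1 x} + card {x. E a2 x}"
  shows "card (clq E c1 c2) \<le> card (clq E a1 a2)"
    and "card (clq E c1 c2) = card (clq E a1 a2) \<Longrightarrow>
      \<exists>o1 o2. clq E c1 c2 \<inter> ({x. E a1 x} - clq E a1 a2) = {o1} \<and> clq E c1 c2 \<inter> ({x. E a2 x} - clq E a1 a2) = {o2} \<and>
        V \<subseteq> clq E a1 a2 \<union> ({x. E a1 x} - clq E a1 a2) \<union> ({x. E a2 x} - clq E a1 a2) \<union> clq E c1 c2"
proof -
  define Q Q' where "Q = clq E a1 a2" and "Q' = clq E c1 c2"
  define O1 O2 where "O1 = {x. E a1 x} - Q" and "O2 = {x. E a2 x} - Q"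
  define P where "P = V - (Q \<union> O1 \<union> O2)"
  have DV: "x \<in> V" "y \<in> V" if "E x y" for x y using V(2) that sym[OF that] by auto
  have sub: "Q \<subseteq> V" "Q' \<subseteq> V" "O1 \<subseteq> V" "O2 \<subseteq> V"
    using DV[OF a] DV[OF c] DV unfolding Q_def Q'_def O1_def O2_def clq_def by blast+
  then have fin: "finite Q" "finite Q'" "finite O1" "finite O2" "finite P"
    using V(1) by (auto intro: finite_subset simp: P_def)
  have aQ: "a1 \<in> Q" "a2 \<in> Q" "a1 \<noteq> a2" using in_clq[OF a] a by (auto simp: Q_def)
  have O12: "O1 \<inter> O2 = {}" by (auto simp: O1_def O2_def Q_def clq_def sym_iff)
  have deg_eq: "card {x. E ai x} + 1 = card Q + card ({x. E ai x} - Q)" if "ai \<in> Q" for ai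
  proof -
    have "{x. E ai x} = (Q - {ai}) \<union> ({x. E ai x} - Q)"
      using clq_clique[OF a] that by (auto simp: Q_def)
    then have "card {x. E ai x} = card (Q - {ai}) + card ({x. E ai x} - Q)"
      using fin(1) V(1) DV by (subst card_Un_disjoint[symmetric]) (auto intro: finite_subset[of _ V])
    moreover have "card Q = Suc (card (Q - {ai}))" using that fin(1) by (metis card.remove)
    ultimately show ?thesis by simp
  qed
  have "card V = card Q + card O1 + card O2 + card P"
  proof -
    have "V = (Q \<union> O1 \<union> O2) \<union> P" using sub by (auto simp: P_def)
    then have "card V = card (Q \<union> O1 \<union> O2) + card P"
      using fin by (metis P_def Diff_disjoint card_Un_disjoint finite_Un)
    also have "card (Q \<union> O1 \<union> O2) = card (Q \<union> O1) + card O2"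
      using fin O12 by (intro card_Un_disjoint) (auto simp: O2_def)
    also have "card (Q \<union> O1) = card Q + card O1"
      using fin by (intro card_Un_disjoint) (auto simp: O1_def)
    finally show ?thesis by simp
  qed
  then have PQ: "card P + 2 \<le> card Q"
    using deg deg_eq[OF aQ(1)] deg_eq[OF aQ(2)] by (simp add: O1_def O2_def)
  have one: "card (Q' \<inter> ({x. E ai x} - Q)) \<le> 1" if "ai \<in> Q" for ai
  proof -
    have eq: "x = y" if "x \<in> Q' \<inter> ({x. E ai x} - Q)" "y \<in> Q' \<inter> ({x. E ai x} - Q)" for x y
    proof (rule ccontr)
      assume "x \<noteq> y"
      then have "clq E x y = Q'" using clq_eq[OF c] that by (auto simp: Q'_def)
      moreover have "ai \<in> clq E x y" using that by (auto simp: clq_def)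
      ultimately show False using disj \<open>ai \<in> Q\<close> by (auto simp: Q_def Q'_def)
    qed
    have f: "finite (Q' \<inter> ({x. E ai x} - Q))" using fin by simp
    show ?thesis unfolding One_nat_def card_le_Suc0_iff_eq[OF f] using eq by blast
  qed
  have split: "Q' = (Q' \<inter> O1) \<union> (Q' \<inter> O2) \<union> (Q' \<inter> P)"
    using sub disj by (auto simp: P_def Q_def Q'_def)
  have card_split: "card Q' = card (Q' \<inter> O1) + card (Q' \<inter> O2) + card (Q' \<inter> P)"
  proof -
    have "card Q' = card ((Q' \<inter> O1) \<union> (Q' \<inter> O2)) + card (Q' \<inter> P)"
      using fin by (subst split, intro card_Un_disjoint) (auto simp: P_def)
    also have "card ((Q' \<inter> O1) \<union> (Q' \<inter> O2)) = card (Q' \<inter> O1) + card (Q' \<inter> O2)"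
      using fin O12 by (intro card_Un_disjoint) auto
    finally show ?thesis .
  qed
  have le: "card (Q' \<inter> O1) \<le> 1" "card (Q' \<inter> O2) \<le> 1" "card (Q' \<inter> P) \<le> card P"
    using one[OF aQ(1)] one[OF aQ(2)] card_mono[of P "Q' \<inter> P"] fin by (auto simp: O1_def O2_def)
  show "card (clq E c1 c2) \<le> card (clq E a1 a2)"
    using card_split le PQ by (simp add: Q_def Q'_def)
  assume "card (clq E c1 c2) = card (clq E a1 a2)"
  then have "card (Q' \<inter> O1) = 1" "card (Q' \<inter> O2) = 1" "card (Q' \<inter> P) = card P"
    using card_split le PQ by (auto simp: Q_def Q'_def)
  then have "\<exists>o1. Q' \<inter> O1 = {o1}" "\<exists>o2. Q' \<inter> O2 = {o2}" "Q' \<inter> P = P"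
    using fin card_subset_eq[of P "Q' \<inter> P"] by (auto simp: card_1_singleton_iff)
  moreover from this(3) have "V \<subseteq> Q \<union> O1 \<union> O2 \<union> Q'" by (auto simp: P_def)
  ultimately show "\<exists>o1 o2. clq E c1 c2 \<inter> ({x. E a1 x} - clq E a1 a2) = {o1} \<and> clq E c1 c2 \<inter> ({x. E a2 x} - clq E a1 a2) = {o2} \<and>
        V \<subseteq> clq E a1 a2 \<union> ({x. E a1 x} - clq E a1 a2) \<union> ({x. E a2 x} - clq E a1 a2) \<union> clq E c1 c2"
    by (simp add: Q_def Q'_def O1_def O2_def)
qed

text \<open>The cycle passes through four cliques: \<open>Q\<close> from \<open>a2\<close> to
  \<open>a1\<close>, \<open>O1\<close> from there to \<open>o1\<close>, \<open>Q'\<close> from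
  \<open>o1\<close> to \<open>o2\<close>, and \<open>O2\<close> back to \<open>a2\<close>.\<close>

theorem spanned_by_cycle_two_heavy_pairs:
  assumes a: "E a1 a2" and c: "E c1 c2" and disj: "clq E a1 a2 \<inter> clq E c1 c2 = {}"
    and V: "finite V" "\<forall>x y. E x y \<longrightarrow> x \<in> V"
    and deg: "card V \<le> card {x. E a1 x} + card {x. E a2 x}" "card V \<le> card {x. E c1 x} + card {x. E c2 x}"
  shows "spanned_by_cycle E V"
proof -
  define Q Q' where "Q = clq E a1 a2" and "Q' = clq E c1 c2"
  define O1 O2 where "O1 = {x. E a1 x} - Q" and "O2 = {x. E a2 x} - Q"
  have "card (clq E c1 c2) = card (clq E a1 a2)"
    using heavy_pair_bound(1)[OF a c disj V deg(1)] heavy_pair_bound(1)[OF c a _ V deg(2)] disj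
    by (simp add: Int_commute)
  then obtain o1 o2 where o: "Q' \<inter> O1 = {o1}" "Q' \<inter> O2 = {o2}" and cover: "V \<subseteq> Q \<union> O1 \<union> O2 \<union> Q'"
    using heavy_pair_bound(2)[OF a c disj V deg(1)] unfolding Q_def Q'_def O1_def O2_def by blast
  have DV: "x \<in> V" "y \<in> V" if "E x y" for x y using V(2) that sym[OF that] by auto
  have sub: "Q \<subseteq> V" "Q' \<subseteq> V" "O1 \<subseteq> V" "O2 \<subseteq> V"
    using DV[OF a] DV[OF c] DV unfolding Q_def Q'_def O1_def O2_def clq_def by blast+
  then have fin: "finite Q" "finite Q'" "finite O1" "finite O2"
    using V(1) by (auto intro: finite_subset)
  have aQ: "a1 \<in> Q" "a2 \<in> Q" "a1 \<noteq> a2" using in_clq[OF a] a by (auto simp: Q_def)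
  have O12: "O1 \<inter> O2 = {}" by (auto simp: O1_def O2_def Q_def clq_def sym_iff)
  have QO: "Q \<inter> O1 = {}" "Q \<inter> O2 = {}" "Q \<inter> Q' = {}" using disj by (auto simp: O1_def O2_def Q_def Q'_def)
  have cl: "E x y" if "x \<in> Q" "y \<in> Q" "x \<noteq> y" for x y using clq_clique[OF a] that by (simp add: Q_def)
  have cl': "E x y" if "x \<in> Q'" "y \<in> Q'" "x \<noteq> y" for x y using clq_clique[OF c] that by (simp add: Q'_def)
  \<comment> \<open>Claw at \<open>ai\<close> with a leaf \<open>aj\<close> in \<open>Q\<close>,
    which is adjacent to no neighbour of \<open>ai\<close> outside \<open>Q\<close>.\<close>
  have clO: "E x y" if "x \<in> insert ai ({x. E ai x} - Q)" "y \<in> insert ai ({x. E ai x} - Q)" "x \<noteq> y" "ai \<in> Q" for x y ai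
  proof -
    obtain aj where aj: "aj \<in> Q" "aj \<noteq> ai" using aQ by metis
    have no: "\<not> E aj w" if "E ai w" "w \<notin> Q" for w
      using clq_eq[OF a, of ai aj] that aj \<open>ai \<in> Q\<close> by (auto simp: Q_def clq_def sym_iff)
    show ?thesis
      using that claw[of ai aj x y] no[of x] no[of y] cl[OF \<open>ai \<in> Q\<close> aj(1)] aj by (auto simp: sym_iff)
  qed
  have clO1: "E x y" if "x \<in> insert a1 O1" "y \<in> insert a1 O1" "x \<noteq> y" for x y
    using clO[of x a1 y] that aQ by (simp add: O1_def)
  have clO2: "E x y" if "x \<in> insert a2 O2" "y \<in> insert a2 O2" "x \<noteq> y" for x y
    using clO[of x a2 y] that aQ by (simp add: O2_def)
  obtain q where q: "set q = Q - {a1, a2}" "distinct q" using finite_distinct_list[of "Q - {a1, a2}"] fin by auto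
  obtain l1 where l1: "set l1 = O1 - {o1}" "distinct l1" using finite_distinct_list[of "O1 - {o1}"] fin by auto
  obtain l2 where l2: "set l2 = O2 - {o2}" "distinct l2" using finite_distinct_list[of "O2 - {o2}"] fin by auto
  obtain m where m: "set m = Q' - {o1, o2}" "distinct m" using finite_distinct_list[of "Q' - {o1, o2}"] fin by auto
  have os: "o1 \<in> O1" "o1 \<in> Q'" "o2 \<in> O2" "o2 \<in> Q'" "o1 \<noteq> o2" using o O12 by auto
  let ?xs = "(a2 # q) @ (a1 # l1) @ (o1 # m) @ (o2 # l2)"
  have a12: "a1 \<notin> O1" "a1 \<notin> O2" "a1 \<notin> Q'" using aQ QO by blast+
  have segs: "set (a2 # q) = Q - {a1}" "set (a1 # l1) = insert a1 (O1 - {o1})" "set (o1 # m) = Q' - {o2}"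
    "set (o2 # l2) = O2"
    using q(1) l1(1) m(1) l2(1) aQ os by auto
  have "distinct ?xs"
  proof -
    have "distinct (a2 # q)" "distinct (a1 # l1)" "distinct (o1 # m)" "distinct (o2 # l2)"
      using q l1 m l2 a12 by auto
    moreover have "(O2 \<inter> (Q' - {o2})) = {}" using o(2) by blast
    moreover have "insert a1 (O1 - {o1}) \<inter> ((Q' - {o2}) \<union> O2) = {}" using o(1) O12 a12 by blast
    moreover have "(Q - {a1}) \<inter> (insert a1 (O1 - {o1}) \<union> ((Q' - {o2}) \<union> O2)) = {}" using QO by blast
    ultimately show ?thesis
      unfolding distinct_append set_append segs by (simp only: Int_commute simp_thms)
  qed
  moreover have "successively E ?xs"
  proof -
    have clique: "successively E L" if "distinct L" "set L \<subseteq> K" "\<And>x y. x \<in> K \<Longrightarrow> y \<in> K \<Longrightarrow> x \<noteq> y \<Longrightarrow> E x y" for L K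
      using that by (intro successively_clique) (auto simp: subset_iff)
    have glue: "successively E (xs @ x # ys)" if "successively E (xs @ [x])" "successively E (x # ys)" for xs x ys
      using that by (auto simp: successively_append_iff successively_Cons)
    have s1: "successively E (a2 # q @ [a1])" by (rule clique[of _ Q]) (use q aQ in \<open>auto intro: cl\<close>)
    have s2: "successively E (a1 # l1 @ [o1])"
      by (rule clique[of _ "insert a1 O1"]) (use l1 os aQ QO clO1 in \<open>auto\<close>)
    have s3: "successively E (o1 # m @ [o2])" by (rule clique[of _ Q']) (use m os in \<open>auto intro: cl'\<close>)
    have s4: "successively E (o2 # l2)" by (rule clique[of _ "insert a2 O2"]) (use l2 os clO2 in \<open>auto\<close>)
    have "successively E (o1 # m @ o2 # l2)" using glue[of "o1 # m" o2 l2] s3 s4 by simp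
    then have "successively E (a1 # l1 @ o1 # m @ o2 # l2)" using glue[of "a1 # l1" o1 "m @ o2 # l2"] s2 by simp
    then show ?thesis using glue[of "a2 # q" a1 "l1 @ o1 # m @ o2 # l2"] s1 by simp
  qed
  moreover have "E (last ?xs) (hd ?xs)"
  proof -
    have l: "last ?xs = last (o2 # l2)" "hd ?xs = a2" by simp_all
    have "last (o2 # l2) \<in> O2" using last_in_set[of "o2 # l2"] unfolding segs by simp
    moreover have "a2 \<notin> O2" using QO(2) aQ(2) by blast
    ultimately have "E (last (o2 # l2)) a2" by (intro clO2) (blast | metis)+
    then show ?thesis unfolding l .
  qed
  moreover have "set ?xs = V"
  proof -
    have "(Q - {a1}) \<union> (insert a1 (O1 - {o1}) \<union> ((Q' - {o2}) \<union> O2)) = V"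
      using cover sub aQ(1) os by blast
    then show ?thesis unfolding set_append segs .
  qed
  ultimately show ?thesis unfolding spanned_by_cycle_def cyc_def by (intro exI[of _ ?xs]) auto
qed

end

section \<open>Heavy nets of the graph in a clique of the closure\<close>

definition deg :: "('a \<Rightarrow> 'a \<Rightarrow> bool) \<Rightarrow> 'a \<Rightarrow> nat" where
  "deg E x = card {y. E x y}"

text \<open>The distinguished index is 1; the other cases arise by permuting the arguments.
  Heaviness is stated without division.\<close>

definition q_heavy_at :: "('a \<Rightarrow> 'a \<Rightarrow> bool) \<Rightarrow> 'a set \<Rightarrow> 'a \<Rightarrow> 'a \<Rightarrow> 'a \<Rightarrow> 'a \<Rightarrow> 'a \<Rightarrow> bool" where
  "q_heavy_at E V t1 t2 t3 b2 b3 \<longleftrightarrow> card V \<le> 2 * deg E t1 \<and>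
     deg E t2 = 3 \<and> deg E b2 = 2 \<and> (\<forall>w. E b2 w \<and> w \<noteq> t2 \<longrightarrow> card V \<le> 2 * deg E w) \<and>
     deg E t3 = 3 \<and> deg E b3 = 2 \<and> (\<forall>w. E b3 w \<and> w \<noteq> t3 \<longrightarrow> card V \<le> 2 * deg E w)"

lemma (in simple_graph) q_type_commute: "q_type E W t1 t2 t3 \<Longrightarrow> q_type E W t1 t3 t2"
proof -
  assume "q_type E W t1 t2 t3"
  then obtain b2 b3 z2 z3 where "{b2, b3, z2, z3} \<subseteq> W" "z2 \<noteq> t2" "z3 \<noteq> t3"
    "\<forall>x\<in>W. E x t2 \<longleftrightarrow> x \<in> {t1, t3, b2}" "\<forall>x\<in>W. E x t3 \<longleftrightarrow> x \<in> {t1, t2, b3}"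
    "\<forall>x\<in>W. E x b2 \<longleftrightarrow> x \<in> {t2, z2}" "\<forall>x\<in>W. E x b3 \<longleftrightarrow> x \<in> {t3, z3}"
    "E t1 z2" "E t1 z3" "E z2 z3"
    unfolding q_type_def by (elim exE conjE) (rule that)
  moreover from this have "{b3, b2, z3, z2} \<subseteq> W" "E z3 z2" by (auto intro: sym)
  ultimately show "q_type E W t1 t3 t2" unfolding q_type_def
    by (intro exI[of _ b3] exI[of _ b2] exI[of _ z3] exI[of _ z2] conjI)
qed

context closure_pair
begin

text \<open>The degrees determine the neighbourhoods of \<open>t2\<close>, \<open>t3\<close>,
  \<open>b2\<close>, \<open>b3\<close>, and the closure keeps them. As \<open>t1\<close> is the only
  common neighbour of \<open>t2\<close> and \<open>t3\<close>, the clique is just this triangle, so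
  a good net there would have the same triangle, which is of excluded \<open>q_type\<close>.\<close>

lemma q_heavy_in_clq:
  assumes net: "net E t1 t2 t3 b1 b2 b3" and q: "q_heavy_at E V t1 t2 t3 b2 b3"
    and V: "finite V" "\<forall>x y. E x y \<longrightarrow> x \<in> V"
    and a: "good_net D V a1 a2 a3" "{t1, t2, t3} \<subseteq> clq D a1 a2"
  shows False
proof -
  have DV: "x \<in> V" "y \<in> V" if "D x y" for x y using dcl_field[OF that, of V] V(2) by auto
  have fin: "finite {y. E x y}" "finite {y. D x y}" for x
    by (rule finite_subset[OF _ V(1)]; auto intro: DV dcl.base)+
  have degD: "deg E x \<le> card {y. D x y}" for x
    unfolding deg_def by (rule card_mono[OF fin(2)]) (auto intro: dcl.base)
  have ed: "E t1 t2" "E t2 t3" "E t1 t3" "E t2 b2" "E t3 b3" "E t2 t1" "E t3 t1" "E t3 t2" "E b2 t2" "E b3 t3"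
    using net sym by (auto simp: net_def)
  have d: "distinct [t1, t2, t3, b1, b2, b3]" using net by (auto simp: net_def sym_iff)
  have t2': "{t1, t3, b2} = {x. E t2 x}"
    using q ed d by (intro card_subset_eq[OF fin(1)]) (auto simp: q_heavy_at_def deg_def)
  have t3': "{t1, t2, b3} = {x. E t3 x}"
    using q ed d by (intro card_subset_eq[OF fin(1)]) (auto simp: q_heavy_at_def deg_def)
  have other: "\<exists>z. z \<noteq> t \<and> {x. E b x} = {t, z}" if bt: "E b t" "deg E b = 2" for b t
  proof -
    obtain x y where xy: "{x. E b x} = {x, y}" "x \<noteq> y" using bt(2) by (auto simp: deg_def card_2_iff)
    then have "t = x \<or> t = y" using bt(1) by auto
    then show ?thesis using xy by (metis insert_commute)
  qed
  obtain z2 where z2: "z2 \<noteq> t2" "{x. E b2 x} = {t2, z2}" using other[of b2 t2] ed q by (auto simp: q_heavy_at_def)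
  obtain z3 where z3: "z3 \<noteq> t3" "{x. E b3 x} = {t3, z3}" using other[of b3 t3] ed q by (auto simp: q_heavy_at_def)
  have nE: "E t2 x \<longleftrightarrow> x \<in> {t1, t3, b2}" "E t3 x \<longleftrightarrow> x \<in> {t1, t2, b3}" "E b2 x \<longleftrightarrow> x \<in> {t2, z2}" "E b3 x \<longleftrightarrow> x \<in> {t3, z3}" for x
    using t2' t3' z2(2) z3(2) by blast+
  have DE: "D x y \<longleftrightarrow> E x y" if "x \<in> {t2, t3, b2, b3} \<or> y \<in> {t2, t3, b2, b3}" for x y
    using dcl_nbr_q_heavy[OF net nE _ that] dcl.base[of E x y] by blast
  have nD: "D t2 x \<longleftrightarrow> x \<in> {t1, t3, b2}" "D t3 x \<longleftrightarrow> x \<in> {t1, t2, b3}" "D b2 x \<longleftrightarrow> x \<in> {t2, z2}" "D b3 x \<longleftrightarrow> x \<in> {t3, z3}" for x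
    using DE[of t2 x] DE[of t3 x] DE[of b2 x] DE[of b3 x] nE[of x] by simp_all
  have netD: "net D t1 t2 t3 b1 b2 b3"
    using net DE unfolding net_def by (simp add: dcl.base)
  have V': "\<forall>x y. D x y \<longrightarrow> x \<in> V" using DV by blast
  have heavy: "card V \<le> 2 * card {x. D t1 x}" "card V \<le> 2 * card {x. D z2 x}" "card V \<le> 2 * card {x. D z3 x}"
  proof -
    have "card V \<le> 2 * deg E t1" "card V \<le> 2 * deg E z2" "card V \<le> 2 * deg E z3"
      using q nE(3)[of z2] nE(4)[of z3] z2(1) z3(1) by (simp_all add: q_heavy_at_def)
    then show "card V \<le> 2 * card {x. D t1 x}" "card V \<le> 2 * card {x. D z2 x}" "card V \<le> 2 * card {x. D z3 x}"
      using degD[of t1] degD[of z2] degD[of z3] by linarith+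
  qed
  have qt: "q_type D V t1 t2 t3"
    by (rule D.q_heavy_q_type[OF netD nD z2(1) z3(1) V(1) V' heavy])
  have aD: "D a1 a2" "D a1 a3" "D a2 a3" using a(1) by (auto simp: good_net_def net_def)
  then have aQ: "a1 \<in> clq D a1 a2" "a2 \<in> clq D a1 a2" "a3 \<in> clq D a1 a2" by (auto simp: clq_def D.sym_iff)
  have in_t: "x \<in> {t1, t2, t3}" if "x \<in> clq D a1 a2" for x
  proof (rule ccontr)
    assume x: "x \<notin> {t1, t2, t3}"
    have "D t2 x" "D t3 x"
      using D.clq_clique[OF aD(1), of t2 x] D.clq_clique[OF aD(1), of t3 x] a(2) that x by auto
    then show False using nD(1)[of x] nD(2)[of x] x d by auto
  qed
  have qt': "q_type D V t1 t3 t2" using qt by (rule D.q_type_commute)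
  have "a1 \<in> {t1, t2, t3}" "a2 \<in> {t1, t2, t3}" "a3 \<in> {t1, t2, t3}" "a1 \<noteq> a2" "a1 \<noteq> a3" "a2 \<noteq> a3"
    using in_t[OF aQ(1)] in_t[OF aQ(2)] in_t[OF aQ(3)] aD dcl_irrefl by blast+
  then have "q_type D V a1 a2 a3 \<or> q_type D V a2 a1 a3 \<or> q_type D V a3 a1 a2"
    using qt qt' by (elim insertE emptyE) simp_all
  then show False using a(1) by (simp add: good_net_def)
qed

text \<open>The net of the graph found in the clique cannot be \<open>q\<close>-heavy for any index
  by \<open>q_heavy_in_clq\<close>; its heavy pair stays heavy because degrees grow from
  \<open>E\<close> to \<open>dcl E\<close>.\<close>

lemma ex_heavy_pair:
  assumes pq: "\<And>t1 t2 t3 b1 b2 b3. net E t1 t2 t3 b1 b2 b3 \<Longrightarrow>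
      (\<exists>u\<in>{t1, t2, t3}. \<exists>v\<in>{t1, t2, t3}. E u v \<and> card V \<le> deg E u + deg E v) \<or>
      q_heavy_at E V t1 t2 t3 b2 b3 \<or> q_heavy_at E V t2 t1 t3 b1 b3 \<or> q_heavy_at E V t3 t1 t2 b1 b2"
    and V: "finite V" "\<forall>x y. E x y \<longrightarrow> x \<in> V"
    and a: "good_net D V a1 a2 a3"
  shows "\<exists>u v. D u v \<and> clq D u v = clq D a1 a2 \<and> card V \<le> card {x. D u x} + card {x. D v x}"
proof -
  obtain p1 p2 p3 where "net D a1 a2 a3 p1 p2 p3" using a by (auto simp: good_net_def)
  then obtain t1 t2 t3 b1 b2 b3 where t: "net E t1 t2 t3 b1 b2 b3" "{t1, t2, t3} \<subseteq> clq D a1 a2"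
    using ex_net_in_clq by metis
  have DV: "y \<in> V" if "D x y" for x y using dcl_field[OF that, of V] V(2) by auto
  have degD: "deg E x \<le> card {y. D x y}" for x
    unfolding deg_def by (rule card_mono[OF finite_subset[OF _ V(1)]]) (auto intro: dcl.base DV)
  have perm: "net E t2 t1 t3 b2 b1 b3" "net E t3 t1 t2 b3 b1 b2" using t(1) by (simp_all add: net_def sym_iff)
  have "\<not> q_heavy_at E V t1 t2 t3 b2 b3" using q_heavy_in_clq[OF t(1) _ V a t(2)] by blast
  moreover have "\<not> q_heavy_at E V t2 t1 t3 b1 b3" using q_heavy_in_clq[OF perm(1) _ V a] t(2) by blast
  moreover have "\<not> q_heavy_at E V t3 t1 t2 b1 b2" using q_heavy_in_clq[OF perm(2) _ V a] t(2) by blast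
  ultimately obtain u v where uv: "u \<in> {t1, t2, t3}" "v \<in> {t1, t2, t3}" "E u v" "card V \<le> deg E u + deg E v"
    using pq[OF t(1)] by blast
  have "D a1 a2" using a by (auto simp: good_net_def net_def)
  moreover have "u \<noteq> v" using uv(3) by auto
  ultimately have "clq D u v = clq D a1 a2" using D.clq_eq[of a1 a2 u v] uv t(2) by blast
  moreover have "card V \<le> card {x. D u x} + card {x. D v x}" using uv(4) degD[of u] degD[of v] by linarith
  ultimately show ?thesis using uv(3) dcl.base by metis
qed

end

theorem (in claw_free_graph) spanned_by_cycle_pq_heavy:
  assumes pq: "\<And>t1 t2 t3 b1 b2 b3. net E t1 t2 t3 b1 b2 b3 \<Longrightarrow>
      (\<exists>u\<in>{t1, t2, t3}. \<exists>v\<in>{t1, t2, t3}. E u v \<and> card V \<le> deg E u + deg E v) \<or>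
      q_heavy_at E V t1 t2 t3 b2 b3 \<or> q_heavy_at E V t2 t1 t3 b1 b3 \<or> q_heavy_at E V t3 t1 t2 b1 b2"
    and V: "finite V" "\<forall>x y. E x y \<longrightarrow> x \<in> V" "two_conn E V"
  shows "spanned_by_cycle E V"
proof (rule ccontr)
  assume "\<not> spanned_by_cycle E V"
  then have D: "closed_graph (dcl E)" "\<not> spanned_by_cycle (dcl E) V"
    using closed_graph_dcl[of V] V by auto
  interpret D: closed_graph "dcl E" by (rule D(1))
  interpret closure_pair E by unfold_locales
  have mono: "walk_in (dcl E) S a b" if "walk_in E S a b" for S a b
    using that by (induction rule: walk_in_induct) (auto intro: walk_in_trans walk_in_edge dcl.base)
  have "two_conn (dcl E) V" using V(3) mono unfolding two_conn_def conn_def by blast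
  then obtain x1 x2 x3 y1 y2 y3 where nets: "good_net (dcl E) V x1 x2 x3" "good_net (dcl E) V y1 y2 y3"
    "clq (dcl E) x1 x2 \<inter> clq (dcl E) y1 y2 \<inter> V = {}"
    using D.two_good_nets[OF _ V(1) D(2)] by metis
  obtain u v where uv: "dcl E u v" "clq (dcl E) u v = clq (dcl E) x1 x2"
    "card V \<le> card {x. dcl E u x} + card {x. dcl E v x}"
    using ex_heavy_pair[OF pq V(1,2) nets(1)] by metis
  obtain u' v' where uv': "dcl E u' v'" "clq (dcl E) u' v' = clq (dcl E) y1 y2"
    "card V \<le> card {x. dcl E u' x} + card {x. dcl E v' x}"
    using ex_heavy_pair[OF pq V(1,2) nets(2)] by metis
  have inV: "\<forall>x y. dcl E x y \<longrightarrow> x \<in> V" using dcl_field[of _ _ V] V(2) by metis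
  \<comment> \<open>The clique lies inside \<open>V\<close>, so disjointness within \<open>V\<close>
    is full disjointness.\<close>
  have "clq (dcl E) u v \<subseteq> V" using inV uv(1) by (auto simp: clq_def)
  then have "clq (dcl E) u v \<inter> clq (dcl E) u' v' = {}" using nets(3) uv(2) uv'(2) by blast
  then show False
    using D.spanned_by_cycle_two_heavy_pairs[OF uv(1) uv'(1) _ V(1) inV uv(3) uv'(3)] D(2) by blast
qed

section \<open>Simple graphs as symmetric digraphs\<close>

context graph
begin

abbreviation adj :: "'a \<Rightarrow> 'a \<Rightarrow> bool" where "adj u v \<equiv> u \<rightarrow> v"

lemma adj_sym: "u \<rightarrow> v \<Longrightarrow> v \<rightarrow> u"
  using sym_arcs by (rule arcs_ends_symmetric)

lemma simple_graph_adj: "simple_graph adj"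
  by unfold_locales (auto intro: adj_sym dest: adj_not_same)

lemma out_degree_eq_deg: "out_degree G v = deg adj v"
proof -
  have "inj_on (head G) (out_arcs G v)"
    using no_multi_arcs by (intro inj_onI) (auto simp: arc_to_ends_def)
  moreover have "head G ` out_arcs G v = {w. adj v w}"
    by (auto simp: arcs_ends_conv)
  ultimately show ?thesis unfolding out_degree_def deg_def by (metis card_image)
qed

lemma arcs_ends_induce: "(u, v) \<in> arcs_ends (G \<restriction> S) \<longleftrightarrow> adj u v \<and> u \<in> S \<and> v \<in> S"
  by (auto simp: arcs_ends_conv)

lemma graph_induce:
  assumes "S \<subseteq> verts G"
  shows "graph (G \<restriction> S)"
proof -
  have fin: "finite S" using assms finite_verts by (rule finite_subset)
  have "symmetric (G \<restriction> S)"
    unfolding symmetric_def sym_def arcs_ends_induce using adj_sym by blast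
  then show ?thesis
    using fin no_loops no_multi_arcs by unfold_locales (auto simp: arc_to_ends_def)
qed

lemma claw_free_graph_adj:
  assumes "claw_free G"
  shows "claw_free_graph adj"
proof -
  interpret simple_graph adj by (rule simple_graph_adj)
  show ?thesis
  proof (unfold_locales, rule ccontr)
    fix x a b c assume e: "adj x a" "adj x b" "adj x c" and d: "a \<noteq> b" "b \<noteq> c" "a \<noteq> c"
      and no: "\<not> (adj a b \<or> adj b c \<or> adj a c)"
    let ?S = "{x, a, b, c}"
    have S: "?S \<subseteq> verts G" using e adj_in_verts by auto
    have ind: "induced_subgraph (G \<restriction> ?S) G" using S by (rule induced_induce)
    have g: "graph (G \<restriction> ?S)" by (rule graph_induce) (rule S)
    have "adj u v \<and> u \<in> ?S \<and> v \<in> ?S \<longleftrightarrow> (u, v) \<in> {x} \<times> {a, b, c} \<union> {a, b, c} \<times> {x}" for u v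
    proof -
      have "adj a x" "adj b x" "adj c x" "\<not> adj b a" "\<not> adj c b" "\<not> adj c a"
        "\<not> adj x x" "\<not> adj a a" "\<not> adj b b" "\<not> adj c c"
        using e[THEN adj_sym] no adj_sym[of b a] adj_sym[of c b] adj_sym[of c a]
          adj_not_same[of x] adj_not_same[of a] adj_not_same[of b] adj_not_same[of c] by blast+
      then show ?thesis using e no by auto
    qed
    then have ends: "arcs_ends (G \<restriction> ?S) = {x} \<times> {a, b, c} \<union> {a, b, c} \<times> {x}"
      by (intro set_eqI) (clarsimp simp only: split_paired_all arcs_ends_induce)
    have x: "x \<notin> {a, b, c}" using e adj_not_same[of x] by auto
    have "complete_bipartite_digraph 1 3 (G \<restriction> ?S)"
      unfolding complete_bipartite_digraph_def
      by (rule conjI[OF g], rule exI[of _ "{x}"], rule exI[of _ "{a, b, c}"]) (use x d ends in \<open>simp add: insert_commute\<close>)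
    then show False using assms ind unfolding claw_free_def by blast
  qed
qed

text \<open>Connectedness is defined on the symmetrized graph with arcs as pairs; the arcs being
  symmetric already, this adds no adjacency.\<close>

lemma conn_of_connected:
  assumes "Digraph_Component.connected (G \<restriction> S)"
  shows "conn adj S"
  unfolding conn_def
proof (intro ballI)
  fix a b assume ab: "a \<in> S" "b \<in> S"
  let ?H = "mk_symmetric (G \<restriction> S)"
  have "a \<rightarrow>\<^sup>*\<^bsub>with_proj ?H\<^esub> b"
    using assms ab unfolding connected_def strongly_connected_def by simp
  then have "(a, b) \<in> (arcs_ends (with_proj ?H))\<^sup>*" by (rule reachable_rtranclI)
  then show "walk_in adj S a b"
  proof (induction rule: rtrancl_induct)
    case (step x y)
    then have "(x, y) \<in> parcs ?H" by simp
    then have "adj x y" "x \<in> S" "y \<in> S"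
      unfolding parcs_mk_symmetric by (auto simp: arcs_ends_conv intro: adj_sym[unfolded arcs_ends_conv])
    then show ?case using step.IH by (auto intro: walk_in_trans walk_in_edge)
  qed simp
qed

lemma two_conn_of_k_connected:
  assumes "k_connected 2 G"
  shows "two_conn adj (verts G)"
  unfolding two_conn_def
proof (intro conjI allI)
  have "2 < card (verts G)" using assms unfolding k_connected_def by (rule conjunct1)
  then show "3 \<le> card (verts G)" by simp
  fix z
  \<comment> \<open>\<open>z\<close> may lie outside the graph; the deleted set is then
    empty.\<close>
  have eq: "verts G - {z} = verts G - ({z} \<inter> verts G)" by auto
  have "card ({z} \<inter> verts G) \<le> card {z}" by (rule card_mono) auto
  then have "card ({z} \<inter> verts G) < 2" by simp
  then have "{z} \<inter> verts G \<subseteq> verts G \<and> card ({z} \<inter> verts G) < 2" by simp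
  then have "Digraph_Component.connected (G \<restriction> (verts G - ({z} \<inter> verts G)))"
    by (rule assms[unfolded k_connected_def, THEN conjunct2, THEN spec, THEN mp])
  then show "conn adj (verts G - {z})" unfolding eq by (rule conn_of_connected)
qed

lemma awalk_of_successively:
  assumes "successively adj (x # xs)" "x \<in> verts G"
  shows "\<exists>p. awalk x p (last (x # xs)) \<and> awalk_verts x p = x # xs"
  using assms
proof (induction xs arbitrary: x)
  case Nil
  then show ?case by (intro exI[of _ "[]"]) (simp add: awalk_Nil_iff)
next
  case (Cons y ys)
  then have xy: "adj x y" by simp
  then obtain e where e: "e \<in> arcs G" "tail G e = x" "head G e = y" by (rule reachableE)
  obtain p where "awalk y p (last (y # ys))" "awalk_verts y p = y # ys"
    using Cons.IH[OF _ adj_in_verts(2)[OF xy]] Cons.prems(1) by (metis successively.simps(3))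
  then have "awalk x (e # p) (last (x # y # ys)) \<and> awalk_verts x (e # p) = x # y # ys"
    using e by (simp add: awalk_Cons_iff)
  then show ?case ..
qed

text \<open>The closed walk repeats its first vertex at the end, but the tails of its arcs list each
  vertex once.\<close>

lemma hamiltonian_of_spanned_by_cycle:
  assumes "spanned_by_cycle adj (verts G)"
  shows "hamiltonian G"
proof -
  obtain ys where ys: "cyc adj ys" "set ys = verts G" using assms unfolding spanned_by_cycle_def by blast
  then obtain x xs where "ys = x # xs" by (cases ys) (auto simp: cyc_def)
  then have xs: "cyc adj (x # xs)" "set (x # xs) = verts G" using ys by simp_all
  then have "successively adj ((x # xs) @ [x])" "x \<in> verts G"
    by (simp_all only: cyc_def successively_append_iff) auto
  then have "successively adj (x # xs @ [x])" "x \<in> verts G" by simp_all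
  then obtain p where p: "awalk x p x" "awalk_verts x p = x # xs @ [x]"
    using awalk_of_successively[of x "xs @ [x]"] by auto
  then have "p \<noteq> []" by auto
  then have "map (tail G) p @ [head G (last p)] = (x # xs) @ [x]" using p(2) by (simp add: awalk_verts_conv)
  then have tails: "map (tail G) p = x # xs" by (simp only: append1_eq_conv)
  have "cycle p" unfolding cycle_def using p \<open>p \<noteq> []\<close> xs(1) by (auto simp: cyc_def)
  moreover have "3 \<le> length p" using arg_cong[OF tails, of length] xs(1) by (auto simp: cyc_def)
  moreover have "tail G ` set p = verts G" using arg_cong[OF tails, of set] xs(2) by simp
  ultimately show ?thesis unfolding hamiltonian_def by blast
qed

lemma heavy_iff: "heavy G v \<longleftrightarrow> card (verts G) \<le> 2 * deg adj v"
  unfolding heavy_def out_degree_eq_deg by linarith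

lemma pq_heavy_net:
  assumes "N_pq_heavy G" "net adj t1 t2 t3 b1 b2 b3"
  shows "(\<exists>u\<in>{t1, t2, t3}. \<exists>v\<in>{t1, t2, t3}. adj u v \<and> card (verts G) \<le> deg adj u + deg adj v) \<or>
    q_heavy_at adj (verts G) t1 t2 t3 b2 b3 \<or> q_heavy_at adj (verts G) t2 t1 t3 b1 b3 \<or>
    q_heavy_at adj (verts G) t3 t1 t2 b1 b2"
proof -
  interpret simple_graph adj by (rule simple_graph_adj)
  \<comment> \<open>Indices other than 1 and 2 default to the third vertex; only 1, 2, 3
    matter.\<close>
  define a where "a i = (if i = 1 then t1 else if i = 2 then t2 else t3)" for i :: nat
  define b where "b i = (if i = 1 then b1 else if i = 2 then b2 else b3)" for i :: nat
  have ab: "a 1 = t1" "a 2 = t2" "a 3 = t3" "b 1 = b1" "b 2 = b2" "b 3 = b3" by (auto simp: a_def b_def)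
  have net: "adj t1 t2" "adj t2 t3" "adj t1 t3" "adj t1 b1" "adj t2 b2" "adj t3 b3"
    "\<not> adj t1 b2" "\<not> adj t1 b3" "\<not> adj t2 b1" "\<not> adj t2 b3" "\<not> adj t3 b1" "\<not> adj t3 b2"
    "\<not> adj b1 b2" "\<not> adj b1 b3" "\<not> adj b2 b3"
    using assms(2) by (simp_all add: net_def)
  have rev: "adj t2 t1" "adj t3 t2" "adj t3 t1" "adj b1 t1" "adj b2 t2" "adj b3 t3"
    "\<not> adj b2 t1" "\<not> adj b3 t1" "\<not> adj b1 t2" "\<not> adj b3 t2" "\<not> adj b1 t3" "\<not> adj b2 t3"
    "\<not> adj b2 b1" "\<not> adj b3 b1" "\<not> adj b3 b2"
    using net by (simp_all add: sym_iff)
  have self: "\<not> adj x x" for x by simp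
  have "induced_net G a b"
    unfolding induced_net_def ab
  proof (intro conjI)
    show "distinct [t1, t2, t3, b1, b2, b3]" using net rev self by auto
    show "{t1, t2, t3, b1, b2, b3} \<subseteq> verts G"
      using adj_in_verts[OF net(4)] adj_in_verts[OF net(5)] adj_in_verts[OF net(6)] by simp
    have "adj u v \<and> u \<in> {t1, t2, t3, b1, b2, b3} \<and> v \<in> {t1, t2, t3, b1, b2, b3} \<longleftrightarrow>
        (u, v) \<in> symcl {(t1, t2), (t2, t3), (t1, t3), (t1, b1), (t2, b2), (t3, b3)}" (is "?l \<longleftrightarrow> ?r") for u v
    proof
      assume ?l
      then have uv: "adj u v" "u \<in> {t1, t2, t3, b1, b2, b3}" "v \<in> {t1, t2, t3, b1, b2, b3}" by simp_all
      then show ?r using net rev self unfolding symcl_def by (elim insertE emptyE) simp_all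
    next
      assume ?r
      then show ?l using net rev unfolding symcl_def by auto
    qed
    then show "arcs_ends (G \<restriction> {t1, t2, t3, b1, b2, b3}) =
        symcl {(t1, t2), (t2, t3), (t1, t3), (t1, b1), (t2, b2), (t3, b3)}"
      by (intro set_eqI) (clarsimp simp only: split_paired_all arcs_ends_induce)
  qed
  then have "p_heavy G a b \<or> q_heavy G a b" using assms(1) by (simp add: N_pq_heavy_def)
  moreover have ?thesis if "p_heavy G a b"
    using that unfolding p_heavy_def a_heavy_pair_def ab out_degree_eq_deg by (rule disjI1)
  moreover have ?thesis if "q_heavy G a b"
  proof -
    obtain i where i: "i \<in> {1, 2, 3}" "heavy G (a i)"
      "\<forall>j\<in>{1, 2, 3} - {i}. out_degree G (a j) = 3 \<and> out_degree G (b j) = 2 \<and>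
           (\<forall>w. b j \<rightarrow> w \<and> w \<noteq> a j \<longrightarrow> heavy G w)"
      using \<open>q_heavy G a b\<close> unfolding q_heavy_def by blast
    consider "i = 1" | "i = 2" | "i = 3" using i(1) by auto
    then show ?thesis
    proof cases
      case 1
      then have "q_heavy_at adj (verts G) t1 t2 t3 b2 b3"
        using i(2) bspec[OF i(3), of 2] bspec[OF i(3), of 3]
        unfolding q_heavy_at_def heavy_iff out_degree_eq_deg by (simp add: a_def b_def)
      then show ?thesis by blast
    next
      case 2
      then have "q_heavy_at adj (verts G) t2 t1 t3 b1 b3"
        using i(2) bspec[OF i(3), of 1] bspec[OF i(3), of 3]
        unfolding q_heavy_at_def heavy_iff out_degree_eq_deg by (simp add: a_def b_def)
      then show ?thesis by blast
    next
      case 3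
      then have "q_heavy_at adj (verts G) t3 t1 t2 b1 b2"
        using i(2) bspec[OF i(3), of 1] bspec[OF i(3), of 2]
        unfolding q_heavy_at_def heavy_iff out_degree_eq_deg by (simp add: a_def b_def)
      then show ?thesis by blast
    qed
  qed
  ultimately show ?thesis by blast
qed

end

theorem theorem16:
  fixes G :: "('a, 'b) pre_digraph"
  assumes "graph G"
    and "k_connected 2 G"
    and "claw_free G"
    and "N_pq_heavy G"
  shows "hamiltonian G"
proof -
  interpret graph G by (rule assms(1))
  interpret C: claw_free_graph adj by (rule claw_free_graph_adj[OF assms(3)])
  have "\<forall>x y. adj x y \<longrightarrow> x \<in> verts G" using adj_in_verts(1) by blast
  then have "spanned_by_cycle adj (verts G)"
    using C.spanned_by_cycle_pq_heavy[OF pq_heavy_net[OF assms(4)]] two_conn_of_k_connected[OF assms(2)] by simp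
  then show ?thesis by (rule hamiltonian_of_spanned_by_cycle)
qed

end
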